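(* Let $\mathscr{H}=\ell\boxtimes\mathcal{H}$ be a homogeneous pre-foliation of co-degree $1$ and degree $d\geq3$ on $\mathbb{P}^2_{\mathbb{C}}$, defined by the $1$-form $$\omega=(\alpha x+\beta y)\left(A(x,y)\,dx+B(x,y)\,dy\right),\quad A,B\in\mathbb{C}[x,y]_{d-1},\ \gcd(A,B)=1.$$ Write $\underline{\mathcal{G}}_{\mathcal H}^{-1}(\underline{\mathcal{G}}_{\mathcal H}([-\alpha:\beta]))=\{[-\alpha:\beta],[a_1:b_1],\ldots,[a_n:b_n]\}$ and denote by $\nu_i$ (resp. $\nu_0$) the ramification index of $\underline{\mathcal{G}}_{\mathcal H}$ at the point $[a_i:b_i]$ (resp. $[-\alpha:\beta]$). Define $P_0\in\mathbb{C}[x,y]_{d-\nu_0-1}$ and $Q_0\in\mathbb{C}[x,y]_{2d-\nu_0-3}$ by $$P_0(x,y;\alpha,\beta):=\frac{\begin{vmatrix}A(x,y)&A(\beta,-\alpha)\\ B(x,y)&B(\beta,-\alpha)\end{vmatrix}}{(\alpha x+\beta y)^{\nu_0}},$$ $$Q_0(x,y;\alpha,\beta):=(\nu_0-1)\left(\frac{\partial B}{\partial x}-\frac{\partial A}{\partial y}\right)P_0(x,y;\alpha,\beta)+(2\nu_0+1)\begin{vmatrix}\frac{\partial P_0}{\partial x}&A(x,y)\\ \frac{\partial P_0}{\partial y}&B(x,y)\end{vmatrix},$$ and, for $i=1,\ldots,n$, define $$P_i(x,y;a_i,b_i):=\frac{\begin{vmatrix}A(x,y)&A(b_i,a_i)\\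 B(x,y)&B(b_i,a_i)\end{vmatrix}}{(b_iy-a_ix)^{\nu_i}},$$ $$Q_i(x,y;a_i,b_i):=(\nu_i-2)\left(\frac{\partial B}{\partial x}-\frac{\partial A}{\partial y}\right)P_i(x,y;a_i,b_i)+2(\nu_i+1)\begin{vmatrix}\frac{\partial P_i}{\partial x}&A(x,y)\\ \frac{\partial P_i}{\partial y}&B(x,y)\end{vmatrix}.$$ Assume that $\underline{\mathcal{G}}_{\mathcal H}([-\alpha:\beta])\neq\infty$ and let $p_0\in\mathbb{C}$ be such that $[p_0:1]=\underline{\mathcal{G}}_{\mathcal H}([-\alpha:\beta])$. Then the curvature of $\mathrm{Leg}\,\mathscr{H}$ is holomorphic on $D_\ell$ if and only if $$\left(1+\frac{1}{\nu_0}\right)\frac{(\alpha+p_0\beta)Q_0(\beta,-\alpha;\alpha,\beta)}{B(\beta,-\alpha)P_0(\beta,-\alpha;\alpha,\beta)}+\sum_{i=1}^{n}\left(1-\frac{1}{\nu_i}\right)(p_0b_i-a_i)\left(\frac{Q_i(b_i,a_i;a_i,b_i)}{B(b_i,a_i)P_i(b_i,a_i;a_i,b_i)}+\frac{3\nu_i(\alpha+p_0\beta)}{\alpha b_i+\beta a_i}\right)=0.$$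
   Context: Setting. $\mathscr H=\ell\boxtimes\mathcal H$ is the pair of the line $\ell=(\alpha x+\beta y=0)$ through the origin $O$ and the foliation $\mathcal H$ of degree $d-1$ on $\mathbb{P}^2_{\mathbb{C}}$ defined in the affine chart $(x,y)$ by $A\,dx+B\,dy$. The map $\underline{\mathcal G}_{\mathcal H}:\mathbb{P}^1_{\mathbb{C}}\to\mathbb{P}^1_{\mathbb{C}}$ is $[y:x]\mapsto[-A(x,y):B(x,y)]$, and $\infty=[1:0]$. $D_\ell$: if $\ell$ is $\mathcal H$-invariant, $D_\ell$ is the line of $\check{\mathbb{P}}^2_{\mathbb{C}}$ dual to the point $\ell\cap L_\infty$ ($L_\infty$ the line at infinity); otherwise $D_\ell$ is the closure of the image of $\ell\setminus\mathrm{Sing}\,\mathcal H$ under the Gauss map $m\mapsto$ (tangent line at $m$ to the leaf of $\mathcal H$). In both cases $D_\ell$ is the line $\{p=p_0\}$ in the affine chart $(p,q)$ of $\check{\mathbb{P}}^2_{\mathbb{C}}$ associated to the line $\{y=px-q\}\subset\mathbb{P}^2_{\mathbb{C}}$. Legendre transform. $\mathrm{Leg}\,\mathscr H$ is the $d$-web on $\check{\mathbb{P}}^2_{\mathbb{C}}$ given in the chart $(p,q)$ by $\big(\alpha x+\beta(px-q)\big)\big(A(x,px-q)+pB(x,px-q)\big)=0$, with $x=dq/dp$. Curvature. At a generic point a $d$-web $\mathcal W$ is a superposition $\mathcal F_1\boxtimes\cdots\boxtimes\mathcal F_d$ of pairwise transverse foliations, $\mathcal F_i:\omega_i=0$. In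 local coordinates $(u,v)$ put $\omega_i\wedge\omega_j=\delta_{ij}\,du\wedge dv$. For $r<s<t$ let $\eta_{rst}$ be the unique meromorphic 1-form with $d(\delta_{st}\omega_r)=\eta_{rst}\wedge\delta_{st}\omega_r$, $d(\delta_{tr}\omega_s)=\eta_{rst}\wedge\delta_{tr}\omega_s$, $d(\delta_{rs}\omega_t)=\eta_{rst}\wedge\delta_{rs}\omega_t$. The curvature $K(\mathcal W)=d\big(\sum_{r<s<t}\eta_{rst}\big)$ is a well-defined global meromorphic 2-form. "Holomorphic on $D_\ell$" means holomorphic at the generic points of $D_\ell$. *)

theory Defs
  imports "HOL-Complex_Analysis.Complex_Analysis"
begin

text \<open>An element of \<open>\<complex>[x,y]\<close> is a polynomial in \<open>y\<close> whose coefficients are polynomials in \<open>x\<close>.\<close>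

type_synonym bpoly = "complex poly poly"

definition varX :: bpoly where "varX = [:[:0, 1:]:]"

definition varY :: bpoly where "varY = [:0, 1:]"

definition cst :: "complex \<Rightarrow> bpoly" where "cst c = [:[:c:]:]"

definition ev :: "bpoly \<Rightarrow> complex \<Rightarrow> complex \<Rightarrow> complex" where
  "ev P x y = poly (poly P [:y:]) x"

definition dX :: "bpoly \<Rightarrow> bpoly" where "dX P = map_poly pderiv P"

definition dY :: "bpoly \<Rightarrow> bpoly" where "dY P = pderiv P"

definition homogeneous :: "nat \<Rightarrow> bpoly \<Rightarrow> bool" where
  "homogeneous k P \<longleftrightarrow> (\<forall>i j. coeff (coeff P j) i \<noteq> 0 \<longrightarrow> i + j = k)"

definition det2 :: "'a::comm_ring \<Rightarrow> 'a \<Rightarrow> 'a \<Rightarrow> 'a \<Rightarrow> 'a" where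
  "det2 a b c d = a * d - b * c"

text \<open>A point of the projective line is the set of all its homogeneous coordinate vectors;
  \<open>pt y x\<close> is \<open>[y : x]\<close>.\<close>

type_synonym ppoint = "(complex \<times> complex) set"

definition pt :: "complex \<Rightarrow> complex \<Rightarrow> ppoint" where
  "pt y x = {(t * y, t * x) | t. t \<noteq> 0}"

definition P1 :: "ppoint set" where
  "P1 = {pt y x | y x. (y, x) \<noteq> (0, 0)}"

definition inf_pt :: ppoint where "inf_pt = pt 1 0"

definition aff :: "ppoint \<Rightarrow> complex" where
  "aff P = (THE c. P = pt c 1)"

definition coaff :: "ppoint \<Rightarrow> complex" where
  "coaff P = (THE c. P = pt 1 c)"

text \<open>A holomorphic parametrisation of a neighbourhood of \<open>P\<close> sending \<open>0\<close> to \<open>P\<close>.\<close>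

definition local_param :: "ppoint \<Rightarrow> complex \<Rightarrow> ppoint" where
  "local_param P t = (if P = inf_pt then pt 1 t else pt (aff P + t) 1)"

text \<open>The value at \<open>R\<close> (near \<open>Q\<close>) of an affine coordinate that vanishes at \<open>Q\<close>.\<close>

definition local_coord :: "ppoint \<Rightarrow> ppoint \<Rightarrow> complex" where
  "local_coord Q R = (if Q = inf_pt then coaff R else aff R - aff Q)"

definition ramification_index :: "(ppoint \<Rightarrow> ppoint) \<Rightarrow> ppoint \<Rightarrow> nat" where
  "ramification_index g P = nat (zorder (\<lambda>t. local_coord (g P) (g (local_param P t))) 0)"

text \<open>The map \<open>[y : x] \<mapsto> [-A(x,y) : B(x,y)]\<close>. For homogeneous \<open>A\<close>, \<open>B\<close> of the same degree without
  common zero other than the origin, all representatives contribute the same point to the union.\<close>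

definition gauss :: "bpoly \<Rightarrow> bpoly \<Rightarrow> ppoint \<Rightarrow> ppoint" where
  "gauss A B P = (\<Union>(y, x)\<in>P. pt (- ev A x y) (ev B x y))"

text \<open>A 1-form \<open>a du + b dv\<close> is the function \<open>(u,v) \<mapsto> (a(u,v), b(u,v))\<close>, a 2-form \<open>k du \<and> dv\<close> is its
  coefficient \<open>k\<close>.\<close>

type_synonym form1 = "complex \<times> complex \<Rightarrow> complex \<times> complex"

definition wedge :: "complex \<times> complex \<Rightarrow> complex \<times> complex \<Rightarrow> complex" where
  "wedge a b = fst a * snd b - snd a * fst b"

definition ext_d :: "form1 \<Rightarrow> complex \<times> complex \<Rightarrow> complex" where
  "ext_d \<theta> z = deriv (\<lambda>u. snd (\<theta> (u, snd z))) (fst z) - deriv (\<lambda>v. fst (\<theta> (fst z, v))) (snd z)"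

definition fmult :: "(complex \<times> complex \<Rightarrow> complex) \<Rightarrow> form1 \<Rightarrow> form1" where
  "fmult f \<theta> z = (f z * fst (\<theta> z), f z * snd (\<theta> z))"

definition holomorphic2_on :: "(complex \<times> complex \<Rightarrow> complex) \<Rightarrow> (complex \<times> complex) set \<Rightarrow> bool" where
  "holomorphic2_on f U \<longleftrightarrow>
     (\<forall>z\<in>U. \<exists>a b. (f has_derivative (\<lambda>(h, k). a * h + b * k)) (at z))"

text \<open>A completely decomposable \<open>d\<close>-web on an open set is given by 1-forms \<open>\<omega> i\<close>, \<open>i < d\<close>, one for
  each foliation.\<close>

definition wdelta :: "(nat \<Rightarrow> form1) \<Rightarrow> nat \<Rightarrow> nat \<Rightarrow> complex \<times> complex \<Rightarrow> complex" where
  "wdelta \<omega> i j z = wedge (\<omega> i z) (\<omega> j z)"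

definition weta :: "(nat \<Rightarrow> form1) \<Rightarrow> nat \<Rightarrow> nat \<Rightarrow> nat \<Rightarrow> form1" where
  "weta \<omega> r s t z = (THE e.
     ext_d (fmult (wdelta \<omega> s t) (\<omega> r)) z = wedge e (fmult (wdelta \<omega> s t) (\<omega> r) z) \<and>
     ext_d (fmult (wdelta \<omega> t r) (\<omega> s)) z = wedge e (fmult (wdelta \<omega> t r) (\<omega> s) z) \<and>
     ext_d (fmult (wdelta \<omega> r s) (\<omega> t)) z = wedge e (fmult (wdelta \<omega> r s) (\<omega> t) z))"

definition curvature :: "nat \<Rightarrow> (nat \<Rightarrow> form1) \<Rightarrow> complex \<times> complex \<Rightarrow> complex" where
  "curvature d \<omega> =
     ext_d (\<lambda>z. \<Sum>(r, s, t)\<in>{(r, s, t). r < s \<and> s < t \<and> t < d}. weta \<omega> r s t z)"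

text \<open>A \<open>d\<close>-web in the chart \<open>(p,q)\<close> given by \<open>F(p,q,x) = 0\<close>, \<open>x = dq/dp\<close>, with \<open>F\<close> of degree \<open>d\<close> in
  \<open>x\<close>. Near a generic point the equation has \<open>d\<close> distinct holomorphic roots \<open>\<xi> i\<close>, and the web is the
  superposition of the foliations \<open>dq - \<xi> i dp = 0\<close>.\<close>

definition web_slopes ::
  "(complex \<times> complex \<Rightarrow> complex \<Rightarrow> complex) \<Rightarrow> nat \<Rightarrow> (complex \<times> complex) set \<Rightarrow>
   (nat \<Rightarrow> complex \<times> complex \<Rightarrow> complex) \<Rightarrow> bool" where
  "web_slopes F d U \<xi> \<longleftrightarrow> open U \<and> (\<forall>i<d. holomorphic2_on (\<xi> i) U) \<and>
     (\<forall>z\<in>U. inj_on (\<lambda>i. \<xi> i z) {..<d} \<and> {x. F z x = 0} = (\<lambda>i. \<xi> i z) ` {..<d})"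

definition slope_form :: "(nat \<Rightarrow> complex \<times> complex \<Rightarrow> complex) \<Rightarrow> nat \<Rightarrow> form1" where
  "slope_form \<xi> i z = (- \<xi> i z, 1)"

text \<open>\<open>k\<close> is the coefficient at the generic point \<open>z\<close> of the curvature of the web. It is determined by
  \<open>F\<close>, \<open>d\<close> and \<open>z\<close>: near \<open>z\<close> the slopes are unique up to their numbering, and the curvature does not
  depend on the numbering (nor on the choice of the 1-forms defining the foliations).\<close>

definition web_curvature_at ::
  "(complex \<times> complex \<Rightarrow> complex \<Rightarrow> complex) \<Rightarrow> nat \<Rightarrow> complex \<times> complex \<Rightarrow> complex \<Rightarrow> bool" where
  "web_curvature_at F d z k \<longleftrightarrow>
     (\<exists>U \<xi>. z \<in> U \<and> web_slopes F d U \<xi> \<and> k = curvature d (slope_form \<xi>) z)"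

text \<open>The curvature, a meromorphic 2-form that is only given at generic points, extends
  holomorphically to a neighbourhood of \<open>z\<close>.\<close>

definition curvature_holomorphic_at ::
  "(complex \<times> complex \<Rightarrow> complex \<Rightarrow> complex) \<Rightarrow> nat \<Rightarrow> complex \<times> complex \<Rightarrow> bool" where
  "curvature_holomorphic_at F d z \<longleftrightarrow>
     (\<exists>U h. open U \<and> z \<in> U \<and> holomorphic2_on h U \<and>
        (\<forall>w\<in>U. \<forall>k. web_curvature_at F d w k \<longrightarrow> k = h w))"

text \<open>For an algebraic curve \<open>D\<close>: holomorphic at the generic points, i.e. at all but finitely many.\<close>

definition curvature_holomorphic_on ::
  "(complex \<times> complex \<Rightarrow> complex \<Rightarrow> complex) \<Rightarrow> nat \<Rightarrow> (complex \<times> complex) set \<Rightarrow> bool" where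
  "curvature_holomorphic_on F d D \<longleftrightarrow>
     (\<exists>S. finite S \<and> (\<forall>z\<in>D - S. curvature_holomorphic_at F d z))"

definition ell :: "complex \<Rightarrow> complex \<Rightarrow> (complex \<times> complex) set" where
  "ell \<alpha> \<beta> = {(x, y). \<alpha> * x + \<beta> * y = 0}"

definition leg ::
  "complex \<Rightarrow> complex \<Rightarrow> bpoly \<Rightarrow> bpoly \<Rightarrow> complex \<times> complex \<Rightarrow> complex \<Rightarrow> complex" where
  "leg \<alpha> \<beta> A B = (\<lambda>(p, q) x.
     (\<alpha> * x + \<beta> * (p * x - q)) * (ev A x (p * x - q) + p * ev B x (p * x - q)))"

text \<open>The form \<open>A dx + B dy\<close> vanishes on the tangent vector \<open>(\<beta>, -\<alpha>)\<close> of the line along the line.\<close>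

definition ell_invariant :: "complex \<Rightarrow> complex \<Rightarrow> bpoly \<Rightarrow> bpoly \<Rightarrow> bool" where
  "ell_invariant \<alpha> \<beta> A B \<longleftrightarrow> (\<forall>(x, y)\<in>ell \<alpha> \<beta>. ev A x y * \<beta> + ev B x y * (- \<alpha>) = 0)"

text \<open>The part of \<open>D\<^sub>\<ell>\<close> in the chart \<open>(p,q)\<close> of the dual plane; \<open>(p,q)\<close> stands for the line
  \<open>y = p x - q\<close>. The line \<open>\<ell>\<close> meets the line at infinity in the point \<open>[\<beta> : -\<alpha> : 0]\<close>, whose dual line
  consists of the lines \<open>y = p x - q z\<close> through that point. As the chart is open, closure in
  the dual plane followed by restriction to the chart is closure in the chart. Only affine points
  \<open>(x,y)\<close> of \<open>\<ell>\<close> need be considered: the line at infinity is invariant, so the Gauss map sends the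
  point of \<open>\<ell>\<close> at infinity outside the chart.\<close>

definition D_ell :: "complex \<Rightarrow> complex \<Rightarrow> bpoly \<Rightarrow> bpoly \<Rightarrow> (complex \<times> complex) set" where
  "D_ell \<alpha> \<beta> A B =
    (if ell_invariant \<alpha> \<beta> A B then {(p, q). - \<alpha> = p * \<beta> - q * 0}
     else closure {(p, q). \<exists>(x, y)\<in>ell \<alpha> \<beta>. (ev A x y, ev B x y) \<noteq> (0, 0) \<and>
       {(x', y'). y' = p * x' - q} =
       {(x', y'). ev A x y * (x' - x) + ev B x y * (y' - y) = 0}})"

text \<open>In both quotients the division is exact when \<open>\<nu>\<close> is the ramification index of the Gauss map
  at \<open>[-\<alpha> : \<beta>]\<close>, respectively \<open>[a : b]\<close>.\<close>

definition P_ell :: "bpoly \<Rightarrow> bpoly \<Rightarrow> complex \<Rightarrow> complex \<Rightarrow> nat \<Rightarrow> bpoly" where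
  "P_ell A B \<alpha> \<beta> \<nu> =
     det2 A (cst (ev A \<beta> (- \<alpha>)))
          B (cst (ev B \<beta> (- \<alpha>))) div (cst \<alpha> * varX + cst \<beta> * varY) ^ \<nu>"

definition Q_ell :: "bpoly \<Rightarrow> bpoly \<Rightarrow> complex \<Rightarrow> complex \<Rightarrow> nat \<Rightarrow> bpoly" where
  "Q_ell A B \<alpha> \<beta> \<nu> =
     (of_nat \<nu> - 1) * (dX B - dY A) * P_ell A B \<alpha> \<beta> \<nu> +
     (2 * of_nat \<nu> + 1) * det2 (dX (P_ell A B \<alpha> \<beta> \<nu>)) A
                               (dY (P_ell A B \<alpha> \<beta> \<nu>)) B"

definition P_pt :: "bpoly \<Rightarrow> bpoly \<Rightarrow> complex \<Rightarrow> complex \<Rightarrow> nat \<Rightarrow> bpoly" where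
  "P_pt A B a b \<nu> =
     det2 A (cst (ev A b a))
          B (cst (ev B b a)) div (cst b * varY - cst a * varX) ^ \<nu>"

definition Q_pt :: "bpoly \<Rightarrow> bpoly \<Rightarrow> complex \<Rightarrow> complex \<Rightarrow> nat \<Rightarrow> bpoly" where
  "Q_pt A B a b \<nu> =
     (of_nat \<nu> - 2) * (dX B - dY A) * P_pt A B a b \<nu> +
     2 * (of_nat \<nu> + 1) * det2 (dX (P_pt A B a b \<nu>)) A
                               (dY (P_pt A B a b \<nu>)) B"

end

theory Submission
  imports Defs "HOL-Computational_Algebra.Fundamental_Theorem_Algebra"
begin

text \<open>By homogeneity, the slopes of the web at \<open>(p, q)\<close> are \<open>q w(p)\<close>, where \<open>w\<close> runs through a Moebius
  transform, depending on \<open>p\<close>, of the fibre of the Gauss map \<open>G\<close> over \<open>p\<close> and of the direction of the line.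
  Hence the curvature is \<open>- T'(p) / q dp \<and> dq\<close>, where \<open>T\<close> is a symmetric function of the fibre. More precisely
  \<open>T dp\<close> is the trace under \<open>G\<close> of a meromorphic 1-form \<open>R ds\<close> whose poles over \<open>p\<^sub>0\<close> have order at most two.
  The double poles have trace zero at a ramified point and do not occur at an unramified one, so that \<open>T\<close> has at
  most a simple pole at \<open>p\<^sub>0\<close>, and its residue is the sum of the residues of \<open>R ds\<close> over the fibre. Six times
  this sum is the left-hand side of the criterion.\<close>

subsection \<open>The curvature of a homogeneous web\<close>

text \<open>The dq-component of each \<open>weta\<close> is (3 - I)/q, where I has three terms, one
  per point of the triple. Collecting them by point gives, for each s of the fibre, its velocity
  1/G'(s) times a symmetric function of the quotients N t/(s - t). That function is rational in the
  Taylor coefficients at s of the polynomial with the fibre as its roots; inserting p = G(s) leaves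
  a function of s alone. The direction of the line does not move, so it occurs only among the t.

  Near a point c of the fibre over p0 write R = H/(s - c)^2. The trace is a contour integral minus
  the residue of R/(G - p) at c, which is H'(c)/(p0 - p) - H(c) G'(c)/(p0 - p)^2. The last term
  vanishes: G'(c) = 0 at a ramified point, and H(c) has the factor \<nu> - 1. The coefficient 1/6 of
  the third derivative in \<open>H\<close> is the origin of the factor six.

  A simple pole of T is a double pole of T'. Holomorphy, however, is defined through the values at
  points that carry a web with d distinct slopes, so local webs near the line must be constructed
  before the residue can be shown to vanish.\<close>

lemma sum_increasing_triples:
  fixes g :: "nat \<Rightarrow> nat \<Rightarrow> nat \<Rightarrow> complex"
  assumes sym: "\<And>r s t. g r s t = g r t s"
  shows "2 * (\<Sum>(r, s, t)\<in>{(r, s, t). r < s \<and> s < t \<and> t < n}. g r s t + g s t r + g t r s) =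
    (\<Sum>r<n. \<Sum>s\<in>{..<n} - {r}. \<Sum>t\<in>{..<n} - {r, s}. g r s t)"
proof -
  \<comment> \<open>Sums run over the whole cube, with the conditions as indicators in the summand:
    a permutation of the variables is then an exchange of summations.\<close>
  define C where "C = (\<lambda>f :: nat \<Rightarrow> nat \<Rightarrow> nat \<Rightarrow> complex. \<Sum>r<n. \<Sum>s<n. \<Sum>t<n. f r s t)"
  have add: "C (\<lambda>r s t. f r s t + h r s t) = C f + C h" for f h
    by (simp add: C_def sum.distrib)
  have rot: "C (\<lambda>r s t. f s t r) = C f" for f
  proof -
    have "(\<Sum>r<n. \<Sum>s<n. \<Sum>t<n. f s t r) = (\<Sum>s<n. \<Sum>r<n. \<Sum>t<n. f s t r)"
      by (rule sum.swap)
    also have "\<dots> = (\<Sum>s<n. \<Sum>t<n. \<Sum>r<n. f s t r)"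
      by (rule sum.cong[OF refl], rule sum.swap)
    finally show ?thesis by (simp add: C_def)
  qed
  have swap: "C (\<lambda>r s t. f r t s) = C f" for f
    unfolding C_def by (rule sum.cong[OF refl], rule sum.swap)
  let ?i = "\<lambda>(b :: bool) (x :: complex). if b then x else 0"
  have "(\<Sum>(r, s, t)\<in>{(r, s, t). r < s \<and> s < t \<and> t < n}. f r s t) = C (\<lambda>r s t. ?i (r < s \<and> s < t) (f r s t))" for f
  proof -
    have "C (\<lambda>r s t. ?i (r < s \<and> s < t) (f r s t)) =
      (\<Sum>(r, s, t)\<in>{..<n} \<times> {..<n} \<times> {..<n}. ?i (r < s \<and> s < t) (f r s t))"
      by (simp add: C_def sum.cartesian_product)
    also have "\<dots> = (\<Sum>(r, s, t)\<in>{(r, s, t). r < s \<and> s < t \<and> t < n}. f r s t)"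
      by (rule sum.mono_neutral_cong_right) (auto split: if_splits)
    finally show ?thesis by simp
  qed
  then have "(\<Sum>(r, s, t)\<in>{(r, s, t). r < s \<and> s < t \<and> t < n}. g r s t + g s t r + g t r s) =
     C (\<lambda>r s t. ?i (r < s \<and> s < t) (g r s t + g s t r + g t r s))" .
  also have "\<dots> = C (\<lambda>r s t. ?i (r < s \<and> s < t) (g r s t) + (?i (r < s \<and> s < t) (g s t r) + ?i (r < s \<and> s < t) (g t r s)))"
    by (intro arg_cong[where f = C] ext) auto
  also have "\<dots> = C (\<lambda>r s t. ?i (r < s \<and> s < t) (g r s t)) + (C (\<lambda>r s t. ?i (r < s \<and> s < t) (g s t r))
      + C (\<lambda>r s t. ?i (r < s \<and> s < t) (g t r s)))"
    by (simp only: add)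
  also have "C (\<lambda>r s t. ?i (r < s \<and> s < t) (g s t r)) = C (\<lambda>r s t. ?i (t < r \<and> r < s) (g r s t))"
    using rot[of "\<lambda>r s t. ?i (t < r \<and> r < s) (g r s t)"] by simp
  also have "C (\<lambda>r s t. ?i (r < s \<and> s < t) (g t r s)) = C (\<lambda>r s t. ?i (s < t \<and> t < r) (g r s t))"
    using rot[of "\<lambda>r s t. ?i (r < s \<and> s < t) (g t r s)"] by simp
  also have "C (\<lambda>r s t. ?i (r < s \<and> s < t) (g r s t)) + (C (\<lambda>r s t. ?i (t < r \<and> r < s) (g r s t))
      + C (\<lambda>r s t. ?i (s < t \<and> t < r) (g r s t))) =
      C (\<lambda>r s t. ?i (r < s \<and> s < t) (g r s t) + (?i (t < r \<and> r < s) (g r s t) + ?i (s < t \<and> t < r) (g r s t)))"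
    (is "_ = C ?h")
    by (simp only: add)
  \<comment> \<open>\<open>?h\<close> collects the three cyclic orderings of an increasing triple.
    Exchanging the last two variables produces the other three orderings, and \<open>g\<close> is
    invariant under this exchange.\<close>
  finally have "2 * (\<Sum>(r, s, t)\<in>{(r, s, t). r < s \<and> s < t \<and> t < n}. g r s t + g s t r + g t r s) =
      C ?h + C (\<lambda>r s t. ?h r t s)"
    using swap[of ?h] by simp
  also have "\<dots> = C (\<lambda>r s t. ?h r s t + ?h r t s)"
    by (simp only: add)
  also have "\<dots> = C (\<lambda>r s t. ?i (s \<noteq> r \<and> t \<noteq> r \<and> t \<noteq> s) (g r s t))"
    by (intro arg_cong[where f = C] ext) (auto simp: sym[of _ t s for s t])
  also have "\<dots> = (\<Sum>r<n. \<Sum>s\<in>{..<n} - {r}. \<Sum>t\<in>{..<n} - {r, s}. g r s t)"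
    unfolding C_def
  proof (rule sum.cong[OF refl])
    fix r
    have "(\<Sum>t<n. ?i (s \<noteq> r \<and> t \<noteq> r \<and> t \<noteq> s) (g r s t)) = (\<Sum>t\<in>{..<n} - {r, s}. g r s t)" if "s \<noteq> r" for s
      using that by (intro sum.mono_neutral_cong_right) auto
    then show "(\<Sum>s<n. \<Sum>t<n. ?i (s \<noteq> r \<and> t \<noteq> r \<and> t \<noteq> s) (g r s t)) = (\<Sum>s\<in>{..<n} - {r}. \<Sum>t\<in>{..<n} - {r, s}. g r s t)"
      by (intro sum.mono_neutral_cong_right) auto
  qed
  finally show ?thesis .
qed

lemma sum_products_distinct:
  fixes x :: "'b \<Rightarrow> complex"
  assumes "finite S"
  shows "(\<Sum>s\<in>S. \<Sum>t\<in>S - {s}. x s * x t) = (\<Sum>s\<in>S. x s)\<^sup>2 - (\<Sum>s\<in>S. (x s)\<^sup>2)"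
proof -
  have "(\<Sum>s\<in>S. \<Sum>t\<in>S - {s}. x s * x t) = (\<Sum>s\<in>S. x s * (\<Sum>t\<in>S. x t) - (x s)\<^sup>2)"
    using assms by (intro sum.cong refl) (simp add: sum_distrib_left[symmetric] sum_diff1 power2_eq_square algebra_simps)
  then show ?thesis
    by (simp add: sum_subtractf sum_distrib_right[symmetric] power2_eq_square)
qed

text \<open>Regroups a sum over triples by a distinguished index: what remains at r is a sum over
  pairs of other indices, which two power sums determine.\<close>

lemma sum_increasing_triples_product:
  fixes y :: "nat \<Rightarrow> complex" and x :: "nat \<Rightarrow> nat \<Rightarrow> complex"
  shows "(\<Sum>(r, s, t)\<in>{(r, s, t). r < s \<and> s < t \<and> t < n}.
      y r * (x r s * x r t) + y s * (x s t * x s r) + y t * (x t r * x t s)) =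
    (\<Sum>r<n. y r * (((\<Sum>s\<in>{..<n} - {r}. x r s)\<^sup>2 - (\<Sum>s\<in>{..<n} - {r}. (x r s)\<^sup>2)) / 2))"
proof -
  have "(\<Sum>s\<in>{..<n} - {r}. \<Sum>t\<in>{..<n} - {r, s}. y r * (x r s * x r t)) =
      y r * ((\<Sum>s\<in>{..<n} - {r}. x r s)\<^sup>2 - (\<Sum>s\<in>{..<n} - {r}. (x r s)\<^sup>2))" for r
  proof -
    have d: "{..<n} - {r, s} = {..<n} - {r} - {s}" for s by auto
    have "(\<Sum>s\<in>{..<n} - {r}. \<Sum>t\<in>{..<n} - {r, s}. y r * (x r s * x r t)) =
        y r * (\<Sum>s\<in>{..<n} - {r}. \<Sum>t\<in>{..<n} - {r} - {s}. x r s * x r t)"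
      unfolding d by (simp only: sum_distrib_left)
    then show ?thesis
      by (simp only: sum_products_distinct finite_Diff finite_lessThan)
  qed
  then show ?thesis
    using sum_increasing_triples[of "\<lambda>r s t. y r * (x r s * x r t)" n]
    by (simp add: sum_divide_distrib[symmetric] mult.commute)
qed

text \<open>The condition for the foliation i fixes the value of eta on (1, \<xi> i), a vector that
  spans the kernel of dq - \<xi> i dp. Two such values at distinct slopes determine eta; the third
  expresses compatibility.\<close>

lemma weta_slope_form:
  fixes \<xi> :: "nat \<Rightarrow> complex \<times> complex \<Rightarrow> complex"
  assumes dp: "\<And>i. i \<in> {r, s, t} \<Longrightarrow> ((\<lambda>u. \<xi> i (u, q)) has_field_derivative X i) (at p)"
    and dq: "\<And>i. i \<in> {r, s, t} \<Longrightarrow> ((\<lambda>v. \<xi> i (p, v)) has_field_derivative Y i) (at q)"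
    and ne: "\<xi> r (p, q) \<noteq> \<xi> s (p, q)" "\<xi> s (p, q) \<noteq> \<xi> t (p, q)" "\<xi> t (p, q) \<noteq> \<xi> r (p, q)"
    and er: "e1 + e2 * \<xi> r (p, q) = (X t - X s + (Y t - Y s) * \<xi> r (p, q)) / (\<xi> t (p, q) - \<xi> s (p, q)) + Y r"
    and es: "e1 + e2 * \<xi> s (p, q) = (X r - X t + (Y r - Y t) * \<xi> s (p, q)) / (\<xi> r (p, q) - \<xi> t (p, q)) + Y s"
    and et: "e1 + e2 * \<xi> t (p, q) = (X s - X r + (Y s - Y r) * \<xi> t (p, q)) / (\<xi> s (p, q) - \<xi> r (p, q)) + Y t"
  shows "weta (slope_form \<xi>) r s t (p, q) = (e1, e2)"
proof -
  have ed: "ext_d (fmult (wdelta (slope_form \<xi>) j k) (slope_form \<xi> i)) (p, q) =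
      X k - X j + (Y k - Y j) * \<xi> i (p, q) + (\<xi> k (p, q) - \<xi> j (p, q)) * Y i"
    if i: "i \<in> {r, s, t}" "j \<in> {r, s, t}" "k \<in> {r, s, t}" for i j k
  proof -
    have "((\<lambda>u. snd (fmult (wdelta (slope_form \<xi>) j k) (slope_form \<xi> i) (u, q))) has_field_derivative
        X k - X j) (at p)"
      by (auto simp: fmult_def wdelta_def wedge_def slope_form_def intro!: derivative_eq_intros dp i)
    moreover have "((\<lambda>v. fst (fmult (wdelta (slope_form \<xi>) j k) (slope_form \<xi> i) (p, v))) has_field_derivative
        - ((Y k - Y j) * \<xi> i (p, q) + (\<xi> k (p, q) - \<xi> j (p, q)) * Y i)) (at q)"
      by (auto simp: fmult_def wdelta_def wedge_def slope_form_def algebra_simps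
          intro!: derivative_eq_intros dq i)
    ultimately show ?thesis
      by (simp add: ext_d_def DERIV_imp_deriv)
  qed
  have wd: "wedge e (fmult (wdelta (slope_form \<xi>) j k) (slope_form \<xi> i) (p, q)) =
      (fst e + snd e * \<xi> i (p, q)) * (\<xi> k (p, q) - \<xi> j (p, q))" for e i j k
    by (simp add: fmult_def wdelta_def wedge_def slope_form_def algebra_simps)
  have iff: "ext_d (fmult (wdelta (slope_form \<xi>) j k) (slope_form \<xi> i)) (p, q) =
      wedge e (fmult (wdelta (slope_form \<xi>) j k) (slope_form \<xi> i) (p, q)) \<longleftrightarrow>
      fst e + snd e * \<xi> i (p, q) =
        (X k - X j + (Y k - Y j) * \<xi> i (p, q)) / (\<xi> k (p, q) - \<xi> j (p, q)) + Y i"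
    if i: "i \<in> {r, s, t}" "j \<in> {r, s, t}" "k \<in> {r, s, t}" and "\<xi> k (p, q) \<noteq> \<xi> j (p, q)" for e i j k
  proof -
    have "A + D * y = z * D \<longleftrightarrow> z = A / D + y" if "D \<noteq> 0" for A D y z :: complex
      using that by (auto simp: field_simps)
    then show ?thesis
      using that(4) unfolding ed[OF i] wd by simp
  qed
  show ?thesis
    unfolding weta_def
  proof (rule the_equality)
    show "ext_d (fmult (wdelta (slope_form \<xi>) s t) (slope_form \<xi> r)) (p, q) =
        wedge (e1, e2) (fmult (wdelta (slope_form \<xi>) s t) (slope_form \<xi> r) (p, q)) \<and>
      ext_d (fmult (wdelta (slope_form \<xi>) t r) (slope_form \<xi> s)) (p, q) =
        wedge (e1, e2) (fmult (wdelta (slope_form \<xi>) t r) (slope_form \<xi> s) (p, q)) \<and>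
      ext_d (fmult (wdelta (slope_form \<xi>) r s) (slope_form \<xi> t)) (p, q) =
        wedge (e1, e2) (fmult (wdelta (slope_form \<xi>) r s) (slope_form \<xi> t) (p, q))"
      using ne er es et by (subst (1 2 3) iff) auto
  next
    fix e assume h: "ext_d (fmult (wdelta (slope_form \<xi>) s t) (slope_form \<xi> r)) (p, q) =
        wedge e (fmult (wdelta (slope_form \<xi>) s t) (slope_form \<xi> r) (p, q)) \<and>
      ext_d (fmult (wdelta (slope_form \<xi>) t r) (slope_form \<xi> s)) (p, q) =
        wedge e (fmult (wdelta (slope_form \<xi>) t r) (slope_form \<xi> s) (p, q)) \<and>
      ext_d (fmult (wdelta (slope_form \<xi>) r s) (slope_form \<xi> t)) (p, q) =
        wedge e (fmult (wdelta (slope_form \<xi>) r s) (slope_form \<xi> t) (p, q))"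
    have 1: "fst e + snd e * \<xi> r (p, q) = e1 + e2 * \<xi> r (p, q)"
      using h iff[of r s t e] ne er by auto
    have 2: "fst e + snd e * \<xi> s (p, q) = e1 + e2 * \<xi> s (p, q)"
      using h iff[of s t r e] ne es by auto
    have "(snd e - e2) * (\<xi> r (p, q) - \<xi> s (p, q)) = (fst e + snd e * \<xi> r (p, q)) -
        (fst e + snd e * \<xi> s (p, q)) - (e1 + e2 * \<xi> r (p, q)) + (e1 + e2 * \<xi> s (p, q))"
      by algebra
    then have "(snd e - e2) * (\<xi> r (p, q) - \<xi> s (p, q)) = 0"
      unfolding 1 2 by simp
    then have "snd e = e2" using ne by simp
    then show "e = (e1, e2)" using 1 by (simp add: prod_eq_iff)
  qed
qed

lemma sum_cyclic_fractions:
  fixes x1 x2 x3 a1 a2 a3 :: "'a :: field"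
  assumes "x1 \<noteq> x2" "x2 \<noteq> x3" "x3 \<noteq> x1"
  shows "a1 / ((x1 - x2) * (x1 - x3)) + a2 / ((x2 - x3) * (x2 - x1)) + a3 / ((x3 - x1) * (x3 - x2)) =
    - (a1 * (x2 - x3) + a2 * (x3 - x1) + a3 * (x1 - x2)) / ((x1 - x2) * (x2 - x3) * (x3 - x1))"
proof -
  let ?D = "(x1 - x2) * (x2 - x3) * (x3 - x1)"
  have D: "?D = ((x1 - x2) * (x1 - x3)) * (- (x2 - x3))" "?D = ((x2 - x3) * (x2 - x1)) * (- (x3 - x1))"
    "?D = ((x3 - x1) * (x3 - x2)) * (- (x1 - x2))"
    by algebra+
  have "a / c = - (a * k) / ?D" if "?D = c * (- k)" "k \<noteq> 0" for a c k
    unfolding that(1) using that(2) by simp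
  from this[OF D(1), of a1] this[OF D(2), of a2] this[OF D(3), of a3]
  have "a1 / ((x1 - x2) * (x1 - x3)) = - (a1 * (x2 - x3)) / ?D"
    "a2 / ((x2 - x3) * (x2 - x1)) = - (a2 * (x3 - x1)) / ?D"
    "a3 / ((x3 - x1) * (x3 - x2)) = - (a3 * (x1 - x2)) / ?D"
    using assms by simp_all
  then show ?thesis by (simp only: add_divide_distrib[symmetric] minus_add_distrib[symmetric] minus_divide_left[symmetric])
qed

text \<open>The forms \<open>dq - q w dp\<close>, where \<open>w\<close> depends on \<open>p\<close> only: \<open>w\<^sub>1'\<close> etc. are the derivatives.\<close>

lemma eta_equations_homogeneous:
  fixes w1 w2 w3 w1' w2' w3' q :: complex
  assumes "w1 \<noteq> w2" "w2 \<noteq> w3" "w3 \<noteq> w1" "q \<noteq> 0"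
  defines "f \<equiv> - (w1' / ((w1 - w2) * (w1 - w3)) + w2' / ((w2 - w3) * (w2 - w1)) + w3' / ((w3 - w1) * (w3 - w2)))"
  defines "e \<equiv> (w3' - w2') / (w3 - w2) - f * w1"
  shows "e + (2 + f) / q * (q * w1) = (q * w3' - q * w2' + (w3 - w2) * (q * w1)) / (q * w3 - q * w2) + w1"
    and "e + (2 + f) / q * (q * w2) = (q * w1' - q * w3' + (w1 - w3) * (q * w2)) / (q * w1 - q * w3) + w2"
    and "e + (2 + f) / q * (q * w3) = (q * w2' - q * w1' + (w2 - w1) * (q * w3)) / (q * w2 - q * w1) + w3"
proof -
  have ne: "w1 - w2 \<noteq> 0" "w2 - w1 \<noteq> 0" "w2 - w3 \<noteq> 0" "w3 - w2 \<noteq> 0" "w3 - w1 \<noteq> 0" "w1 - w3 \<noteq> 0"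
    using assms by auto
  \<comment> \<open>After \<open>R\<close> and \<open>L\<close> the factor q has cancelled, and the
    three equations ask for an affine function e + f w that takes at each w_i the difference
    quotient of the other two velocities. \<open>d12\<close> and \<open>d13\<close> below say that
    these three values lie on one line of slope f.\<close>
  have R: "(q * a - q * b + (c - d) * (q * x)) / (q * c - q * d) + x = (a - b) / (c - d) + 2 * x"
    if "c - d \<noteq> 0" for a b c d x
  proof -
    have "q * a - q * b + (c - d) * (q * x) = q * ((a - b) + (c - d) * x)" "q * c - q * d = q * (c - d)"
      by (simp_all add: algebra_simps)
    then show ?thesis using that \<open>q \<noteq> 0\<close> by (simp add: add_divide_distrib)
  qed
  have L: "e + (2 + f) / q * (q * x) = e + f * x + 2 * x" for x
  proof -
    have "(2 + f) / q * (q * x) = (2 + f) * x" using \<open>q \<noteq> 0\<close> by simp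
    then show ?thesis by (simp add: algebra_simps)
  qed
  define D where "D = (w1 - w2) * (w2 - w3) * (w3 - w1)"
  have fD: "f = (w1' * (w2 - w3) + w2' * (w3 - w1) + w3' * (w1 - w2)) / D"
    unfolding f_def D_def sum_cyclic_fractions[OF assms(1-3)]
    by (simp only: minus_divide_left[symmetric] minus_minus)
  have d: "a / (w3 - w2) = - a * (w1 - w2) * (w3 - w1) / D" "a / (w1 - w3) = - a * (w1 - w2) * (w2 - w3) / D"
    "a / (w2 - w1) = - a * (w2 - w3) * (w3 - w1) / D" for a
  proof -
    have frac: "a / c = - a * k * l / D" if "k \<noteq> 0" "l \<noteq> 0" "D = - (c * k * l)" for c k l
      unfolding that(3) using that(1,2) by simp
    show "a / (w3 - w2) = - a * (w1 - w2) * (w3 - w1) / D"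
      by (rule frac[OF ne(1,5)]) (simp add: D_def algebra_simps)
    show "a / (w1 - w3) = - a * (w1 - w2) * (w2 - w3) / D"
      by (rule frac[OF ne(1,3)]) (simp add: D_def algebra_simps)
    show "a / (w2 - w1) = - a * (w2 - w3) * (w3 - w1) / D"
      by (rule frac[OF ne(3,5)]) (simp add: D_def algebra_simps)
  qed
  have d12: "f * (w1 - w2) = (w3' - w2') / (w3 - w2) - (w1' - w3') / (w1 - w3)"
    unfolding fD d by (simp add: diff_divide_distrib[symmetric]) (simp add: algebra_simps)
  have d13: "f * (w1 - w3) = (w3' - w2') / (w3 - w2) - (w2' - w1') / (w2 - w1)"
    unfolding fD d by (simp add: diff_divide_distrib[symmetric]) (simp add: algebra_simps)
  show "e + (2 + f) / q * (q * w1) = (q * w3' - q * w2' + (w3 - w2) * (q * w1)) / (q * w3 - q * w2) + w1"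
    unfolding L R[OF ne(4)] by (simp add: e_def)
  have "e + f * w2 = (w1' - w3') / (w1 - w3)"
    using d12 by (simp add: e_def algebra_simps)
  then show "e + (2 + f) / q * (q * w2) = (q * w1' - q * w3' + (w1 - w3) * (q * w2)) / (q * w1 - q * w3) + w2"
    unfolding L R[OF ne(6)] by simp
  have "e + f * w3 = (w2' - w1') / (w2 - w1)"
    using d13 by (simp add: e_def algebra_simps)
  then show "e + (2 + f) / q * (q * w3) = (q * w2' - q * w1' + (w2 - w1) * (q * w3)) / (q * w2 - q * w1) + w3"
    unfolding L R[OF ne(2)] by simp
qed

text \<open>Here n stands for p - \<kappa>, which has velocity 1 in p, so \<open>w'\<close> is the
  velocity of \<open>w\<close> when s moves with velocity S. The parts -s^2 add up to a constant;
  only the velocities of the points remain.\<close>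

lemma invariant_moebius:
  fixes s1 s2 s3 S1 S2 S3 n :: complex
  assumes ne: "s1 \<noteq> s2" "s2 \<noteq> s3" "s3 \<noteq> s1"
  defines "N \<equiv> \<lambda>s. 1 + n * s" and "w \<equiv> \<lambda>s. s / (1 + n * s)" and "w' \<equiv> \<lambda>s S. (S - s\<^sup>2) / (1 + n * s)\<^sup>2"
  assumes nz: "N s1 \<noteq> 0" "N s2 \<noteq> 0" "N s3 \<noteq> 0"
  shows "- (w' s1 S1 / ((w s1 - w s2) * (w s1 - w s3)) + w' s2 S2 / ((w s2 - w s3) * (w s2 - w s1)) +
        w' s3 S3 / ((w s3 - w s1) * (w s3 - w s2))) =
     1 - (S1 * (N s2 / (s1 - s2) * (N s3 / (s1 - s3))) + S2 * (N s3 / (s2 - s3) * (N s1 / (s2 - s1))) +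
        S3 * (N s1 / (s3 - s1) * (N s2 / (s3 - s2))))"
proof -
  have wd: "w s - w t = (s - t) / (N s * N t)" if "N s \<noteq> 0" "N t \<noteq> 0" for s t
    using that by (simp add: w_def N_def field_simps)
  have T: "w' s S / ((w s - w t) * (w s - w u)) =
      S * (N t / (s - t) * (N u / (s - u))) - s\<^sup>2 * (N t * N u / ((s - t) * (s - u)))"
    if "N s \<noteq> 0" "N t \<noteq> 0" "N u \<noteq> 0" "s \<noteq> t" "s \<noteq> u" for s t u S
  proof -
    have q: "(a / k) / (d / (k * l)) = a * l / d" if "k \<noteq> 0" for a d k l :: complex
      using that by simp
    have "w' s S = (S - s\<^sup>2) / (N s)\<^sup>2" by (simp add: w'_def N_def)
    moreover have "(w s - w t) * (w s - w u) = (s - t) * (s - u) / ((N s)\<^sup>2 * (N t * N u))"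
      using that by (simp add: wd power2_eq_square mult_ac)
    ultimately have "w' s S / ((w s - w t) * (w s - w u)) = (S - s\<^sup>2) * (N t * N u) / ((s - t) * (s - u))"
      using q[of "(N s)\<^sup>2"] that by simp
    also have "\<dots> = S * (N t * N u / ((s - t) * (s - u))) - s\<^sup>2 * (N t * N u / ((s - t) * (s - u)))"
      by (simp only: times_divide_eq_right[symmetric] left_diff_distrib[symmetric])
    finally show ?thesis by (simp only: times_divide_times_eq)
  qed
  have gen: "x1 + x2 + x3 = 1 \<Longrightarrow> - ((A1 - x1) + (A2 - x2) + (A3 - x3)) = 1 - (A1 + A2 + A3)"
    for x1 x2 x3 A1 A2 A3 :: complex
    by algebra
  have "s1\<^sup>2 * (N s2 * N s3 / ((s1 - s2) * (s1 - s3))) + s2\<^sup>2 * (N s3 * N s1 / ((s2 - s3) * (s2 - s1))) +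
      s3\<^sup>2 * (N s1 * N s2 / ((s3 - s1) * (s3 - s2))) = 1"
  proof -
    have "- (s1\<^sup>2 * (N s2 * N s3) * (s2 - s3) + s2\<^sup>2 * (N s3 * N s1) * (s3 - s1) + s3\<^sup>2 * (N s1 * N s2) * (s1 - s2)) =
        (s1 - s2) * (s2 - s3) * (s3 - s1)"
      unfolding N_def by algebra
    then show ?thesis
      using sum_cyclic_fractions[OF ne, of "s1\<^sup>2 * (N s2 * N s3)" "s2\<^sup>2 * (N s3 * N s1)" "s3\<^sup>2 * (N s1 * N s2)"] ne
      by simp
  qed
  then show ?thesis
    using ne nz T[of s1 s2 s3 S1] T[of s2 s3 s1 S2] T[of s3 s1 s2 S3] by (simp only: gen not_sym simp_thms)
qed

subsection \<open>Traces of meromorphic forms\<close>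

text \<open>Leibniz rule under the integral sign; it yields the regular part of a trace as a
  function of p.\<close>

lemma holomorphic_parameter_circlepath:
  fixes F G :: "complex \<Rightarrow> complex"
  assumes "continuous_on (path_image (circlepath c r)) F" "continuous_on (path_image (circlepath c r)) G"
    and ne: "\<And>z p. z \<in> path_image (circlepath c r) \<Longrightarrow> p \<in> ball p0 \<epsilon> \<Longrightarrow> G z \<noteq> p"
  shows "(\<lambda>p. contour_integral (circlepath c r) (\<lambda>z. F z / (G z - p))) holomorphic_on ball p0 \<epsilon>"
proof -
  let ?g = "circlepath c r"
  let ?v = "\<lambda>t. vector_derivative ?g (at t)"
  have g: "continuous_on S ?g" for S
    by (auto simp: circlepath intro!: continuous_intros)
  have gi: "?g t \<in> path_image ?g" if "t \<in> cbox 0 1" for t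
    using that by (auto simp: path_image_def)
  have v: "continuous_on S ?v" for S
    by (auto simp: vector_derivative_circlepath intro!: continuous_intros)
  have F: "continuous_on (cbox 0 1) (\<lambda>t. F (?g t))" 
    by (rule continuous_on_compose2[OF assms(1) g]) (use gi in auto)
  have G: "continuous_on (cbox 0 1) (\<lambda>t. G (?g t))"
    by (rule continuous_on_compose2[OF assms(2) g]) (use gi in auto)
  have F2: "continuous_on (ball p0 \<epsilon> \<times> cbox 0 1) (\<lambda>x. F (?g (snd x)))"
    by (rule continuous_on_compose2[OF F]) (auto intro!: continuous_intros)
  have G2: "continuous_on (ball p0 \<epsilon> \<times> cbox 0 1) (\<lambda>x. G (?g (snd x)))"
    by (rule continuous_on_compose2[OF G]) (auto intro!: continuous_intros)
  have v2: "continuous_on (ball p0 \<epsilon> \<times> cbox 0 1) (\<lambda>x. ?v (snd x))"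
    by (rule continuous_on_compose2[OF v[of UNIV]]) (auto intro!: continuous_intros)
  have "(\<lambda>p. integral (cbox 0 1) (\<lambda>t. F (?g t) / (G (?g t) - p) * ?v t)) holomorphic_on ball p0 \<epsilon>"
  proof (rule leibniz_rule_holomorphic[where fx = "\<lambda>p t. F (?g t) / (G (?g t) - p)^2 * ?v t"])
    fix x t assume "x \<in> ball p0 \<epsilon>" "t \<in> cbox 0 (1::real)"
    then show "((\<lambda>x. F (?g t) / (G (?g t) - x) * ?v t) has_field_derivative
        F (?g t) / (G (?g t) - x)\<^sup>2 * ?v t) (at x within ball p0 \<epsilon>)"
      using ne[OF gi] by (auto intro!: derivative_eq_intros simp: power2_eq_square)
  next
    fix x assume "x \<in> ball p0 \<epsilon>"
    then show "(\<lambda>t. F (?g t) / (G (?g t) - x) * ?v t) integrable_on cbox 0 1"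
      using ne[OF gi] by (intro integrable_continuous continuous_intros F G v) auto
  next
    show "continuous_on (ball p0 \<epsilon> \<times> cbox 0 1) (\<lambda>(x, t). F (?g t) / (G (?g t) - x)\<^sup>2 * ?v t)"
      unfolding split_beta using ne[OF gi] by (intro continuous_intros F2 G2 v2) auto
  qed auto
  then show ?thesis
    by (simp add: contour_integral_integral)
qed

text \<open>Residue theorem for H/((z - c)^2 (G - p)). The residues at the points over p are the
  summands of the trace, the contour integral is holomorphic in p because G avoids p on the circle,
  and the residue at c supplies the polar part.\<close>

lemma local_trace_double_pole:
  fixes G H :: "complex \<Rightarrow> complex"
  assumes r: "0 < r" "r < r0"
    and hol: "G holomorphic_on ball c r0" "H holomorphic_on ball c r0"
    and Gc: "G c = p0"
    and Gp: "\<And>z. z \<in> ball c r0 \<Longrightarrow> z \<noteq> c \<Longrightarrow> G z \<noteq> p0"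
    and G': "\<And>z. z \<in> ball c r0 \<Longrightarrow> z \<noteq> c \<Longrightarrow> deriv G z \<noteq> 0"
    and fin: "\<And>p. finite {z \<in> ball c r0. G z = p}"
    and HG: "H c * deriv G c = 0"
  obtains \<epsilon> \<tau> where "\<epsilon> > 0" "\<tau> holomorphic_on ball p0 \<epsilon>"
    "\<forall>p\<in>ball p0 \<epsilon> - {p0}.
       (\<Sum>z | z \<in> ball c r \<and> G z = p. H z / (z - c)\<^sup>2 / deriv G z) = \<tau> p + deriv H c / (p - p0)"
proof -
  let ?g = "circlepath c r"
  have im: "path_image ?g \<subseteq> ball c r0" "path_image ?g = sphere c r"
    using r by (auto simp: path_image_circlepath)
  have contG: "continuous_on (sphere c r) G"
    using hol(1) im holomorphic_on_imp_continuous_on continuous_on_subset by metis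
  have contH: "continuous_on (sphere c r) H"
    using hol(2) im holomorphic_on_imp_continuous_on continuous_on_subset by metis
  have "compact ((\<lambda>z. G z) ` sphere c r)"
    by (intro compact_continuous_image contG) auto
  moreover have "p0 \<notin> G ` sphere c r"
    using Gp r by (force simp: dist_norm)
  ultimately obtain \<epsilon> where \<epsilon>: "\<epsilon> > 0" "ball p0 \<epsilon> \<inter> G ` sphere c r = {}"
    by (metis compact_imp_closed open_contains_ball_eq open_Compl ComplI Compl_disjoint2 disjoint_eq_subset_Compl)
  define \<tau> where "\<tau> p = contour_integral ?g (\<lambda>z. H z / (z - c)\<^sup>2 / (G z - p)) / (2 * pi * \<i>)" for p
  have "\<tau> holomorphic_on ball p0 \<epsilon>"
    unfolding \<tau>_def using \<epsilon>(2) r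
    by (intro holomorphic_intros holomorphic_parameter_circlepath continuous_intros)
       (auto simp: im contG contH)
  moreover have "(\<Sum>z | z \<in> ball c r \<and> G z = p. H z / (z - c)\<^sup>2 / deriv G z) = \<tau> p + deriv H c / (p - p0)"
    if p: "p \<in> ball p0 \<epsilon>" "p \<noteq> p0" for p
  proof -
    let ?Z = "{z \<in> ball c r0. G z = p}"
    let ?f = "\<lambda>z. H z / (z - c)\<^sup>2 / (G z - p)"
    have cZ: "c \<notin> ?Z" using Gc p by auto
    have sph: "\<And>z. z \<in> sphere c r \<Longrightarrow> G z \<noteq> p" using \<epsilon> p(1) by auto
    have fhol: "?f holomorphic_on ball c r0 - insert c ?Z"
      by (intro holomorphic_intros holomorphic_on_subset[OF hol(1)] holomorphic_on_subset[OF hol(2)]) auto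
    have "contour_integral ?g ?f = 2 * pi * \<i> * (\<Sum>z\<in>insert c ?Z. winding_number ?g z * residue ?f z)"
    proof (rule Residue_theorem[OF _ _ _ fhol])
      show "path_image ?g \<subseteq> ball c r0 - insert c ?Z"
      proof
        fix z assume "z \<in> path_image ?g"
        then have z: "z \<in> sphere c r" "z \<in> ball c r0" using im by blast+
        moreover have "z \<noteq> c" using z(1) r by auto
        ultimately show "z \<in> ball c r0 - insert c ?Z" using sph[OF z(1)] by simp
      qed
      show "\<forall>z. z \<notin> ball c r0 \<longrightarrow> winding_number ?g z = 0"
        using r by (auto intro!: winding_number_zero_outside[where s = "cball c r"] simp: path_image_circlepath)
    qed (use fin in auto)
    also have "(\<Sum>z\<in>insert c ?Z. winding_number ?g z * residue ?f z) =
       winding_number ?g c * residue ?f c + (\<Sum>z\<in>?Z. winding_number ?g z * residue ?f z)"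
      using fin cZ by (subst sum.insert) auto
    also have "winding_number ?g c = 1" using r by (simp add: winding_number_circlepath)
    \<comment> \<open>The residue theorem runs over all points of the larger disc; those outside the
      circle have winding number zero.\<close>
    also have "(\<Sum>z\<in>?Z. winding_number ?g z * residue ?f z) =
        (\<Sum>z | z \<in> ball c r \<and> G z = p. H z / (z - c)\<^sup>2 / deriv G z)"
    proof (rule sum.mono_neutral_cong_right)
      show "finite ?Z" by (rule fin)
      show "{z \<in> ball c r. G z = p} \<subseteq> ?Z" using r by auto
      show "\<forall>z\<in>?Z - {z \<in> ball c r. G z = p}. winding_number ?g z * residue ?f z = 0"
      proof
        fix z assume z: "z \<in> ?Z - {z \<in> ball c r. G z = p}"
        then have "z \<notin> sphere c r" "z \<notin> ball c r" using sph by blast+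
        then have "z \<notin> cball c r" by simp
        then have "winding_number ?g z = 0"
          using r by (intro winding_number_zero_outside[where s = "cball c r"]) (auto simp: path_image_circlepath)
        then show "winding_number ?g z * residue ?f z = 0" by simp
      qed
      fix z assume z: "z \<in> {z \<in> ball c r. G z = p}"
      then have zZ: "z \<in> ball c r0" "G z = p" "z \<noteq> c" using r Gc p by auto
      have "winding_number ?g z = 1"
        using z by (intro winding_number_circlepath) (auto simp: dist_norm norm_minus_commute)
      moreover have "residue ?f z = H z / (z - c)\<^sup>2 / deriv G z"
      proof (rule residue_simple')
        let ?s = "ball c r0 - (insert c ?Z - {z})"
        show "open ?s" using fin by (intro open_Diff finite_imp_closed) auto
        show "z \<in> ?s" using zZ by auto
        show "?f holomorphic_on ?s - {z}" by (rule holomorphic_on_subset[OF fhol]) auto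
        have "(G has_field_derivative deriv G z) (at z)"
          using hol(1) zZ by (intro holomorphic_derivI) auto
        then have "((\<lambda>w. (G w - p) / (w - z)) \<longlongrightarrow> deriv G z) (at z)"
          using zZ by (simp add: has_field_derivative_iff)
        moreover have "isCont H z"
          using holomorphic_on_imp_continuous_on[OF hol(2)] zZ(1)
          by (simp add: continuous_on_eq_continuous_at)
        ultimately have "((\<lambda>w. (H w / (w - c)\<^sup>2) / ((G w - p) / (w - z))) \<longlongrightarrow>
             (H z / (z - c)\<^sup>2) / deriv G z) (at z)"
          using zZ G' by (intro tendsto_intros) (auto simp: isCont_def)
        then show "((\<lambda>w. ?f w * (w - z)) \<longlongrightarrow> H z / (z - c)\<^sup>2 / deriv G z) (at z)"
          by simp
      qed
      ultimately show "winding_number ?g z * residue ?f z = H z / (z - c)\<^sup>2 / deriv G z" by simp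
    qed
    \<comment> \<open>At the double pole c the residue is the derivative of H/(G - p).
      \<open>HG\<close> removes its term of second order in 1/(p - p0).\<close>
    also have "residue ?f c = - deriv H c / (p - p0)"
    proof -
      let ?s = "ball c r0 - ?Z"
      have os: "open ?s" using fin by (intro open_Diff finite_imp_closed) auto
      have cs: "c \<in> ?s" using cZ r by auto
      have h: "(\<lambda>z. H z / (G z - p)) holomorphic_on ?s"
        by (intro holomorphic_intros holomorphic_on_subset[OF hol(1)] holomorphic_on_subset[OF hol(2)]) auto
      have dG: "(G has_field_derivative deriv G c) (at c)"
        using hol(1) r by (intro holomorphic_derivI) auto
      have dH: "(H has_field_derivative deriv H c) (at c)"
        using hol(2) r by (intro holomorphic_derivI) auto
      have "((\<lambda>z. H z / (G z - p)) has_field_derivative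
          (deriv H c * (G c - p) - H c * deriv G c) / ((G c - p) * (G c - p))) (at c)"
        using p Gc by (auto intro!: derivative_eq_intros dG dH)
      then have "deriv (\<lambda>z. H z / (G z - p)) c = deriv H c / (p0 - p)"
        using p by (simp add: DERIV_imp_deriv HG Gc)
      moreover have "residue (\<lambda>z. H z / (G z - p) / (z - c) ^ Suc 1) c = (deriv ^^ 1) (\<lambda>z. H z / (G z - p)) c / fact 1"
        by (rule residue_holomorphic_over_power[OF os cs h])
      ultimately show ?thesis 
        by (simp add: power2_eq_square mult.commute minus_divide_right)
    qed
    finally show ?thesis by (simp add: \<tau>_def)
  qed
  ultimately show ?thesis using \<epsilon>(1) by (intro that[of \<epsilon> \<tau>]) auto
qed

subsection \<open>Binary forms\<close>

lemma ev_add [simp]: "ev (P + Q) x y = ev P x y + ev Q x y"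
  and ev_diff [simp]: "ev (P - Q) x y = ev P x y - ev Q x y"
  and ev_uminus [simp]: "ev (- P) x y = - ev P x y"
  and ev_mult [simp]: "ev (P * Q) x y = ev P x y * ev Q x y"
  and ev_power [simp]: "ev (P ^ k) x y = ev P x y ^ k"
  and ev_cst [simp]: "ev (cst c) x y = c"
  and ev_varX [simp]: "ev varX x y = x"
  and ev_varY [simp]: "ev varY x y = y"
  and ev_zero [simp]: "ev 0 x y = 0"
  and ev_one [simp]: "ev 1 x y = 1"
  and ev_of_nat [simp]: "ev (of_nat k) x y = of_nat k"
  and ev_numeral [simp]: "ev (numeral w) x y = numeral w"
  by (simp_all add: ev_def cst_def varX_def varY_def)

lemma ev_pCons: "ev (pCons f P) x y = poly f x + y * ev P x y"
  by (simp add: ev_def)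

lemma coeff_dX: "coeff (coeff (dX P) j) i = of_nat (Suc i) * coeff (coeff P j) (Suc i)"
  by (simp add: dX_def coeff_map_poly coeff_pderiv)

lemma dX_zero [simp]: "dX 0 = 0"
  by (simp add: dX_def)

lemma dX_pCons: "dX (pCons f P) = pCons (pderiv f) (dX P)"
  by (cases "f = 0 \<and> P = 0") (auto simp: dX_def map_poly_pCons)

lemma dX_add: "dX (P + Q) = dX P + dX Q"
  by (simp add: poly_eq_iff coeff_dX algebra_simps)

lemma dX_smult: "dX (smult f P) = smult (pderiv f) P + smult f (dX P)"
  by (intro poly_eqI) (simp add: dX_def coeff_map_poly pderiv_mult mult.commute)

lemma dX_mult: "dX (P * Q) = dX P * Q + P * dX Q"
proof (induction P)
  case (pCons f P)
  have "dX (pCons 0 R) = pCons 0 (dX R)" for R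
    by (simp add: dX_pCons)
  with pCons show ?case
    by (simp add: mult_pCons_left dX_add dX_smult dX_pCons algebra_simps)
qed simp

lemma dY_mult: "dY (P * Q) = dY P * Q + P * dY Q"
  by (simp add: dY_def pderiv_mult algebra_simps)

lemma dX_cst_mult: "dX (cst c * P) = cst c * dX P"
  and dY_cst_mult: "dY (cst c * P) = cst c * dY P"
  by (simp_all add: cst_def dX_smult dY_def pderiv_smult)

definition euler :: "bpoly \<Rightarrow> bpoly" where
  "euler P = varX * dX P + varY * dY P"

lemma coeff_varX_mult: "coeff (coeff (varX * P) j) i = (case i of 0 \<Rightarrow> 0 | Suc i \<Rightarrow> coeff (coeff P j) i)"
  by (simp add: varX_def coeff_pCons split: nat.split)

lemma coeff_varY_mult: "coeff (coeff (varY * P) j) i = (case j of 0 \<Rightarrow> 0 | Suc j \<Rightarrow> coeff (coeff P j) i)"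
  by (simp add: varY_def coeff_pCons split: nat.split)

lemma coeff_of_nat_mult: "coeff (of_nat n * p) k = of_nat n * coeff p k"
  by (induction n) (simp_all add: algebra_simps)

lemma coeff_dY: "coeff (coeff (dY P) j) i = of_nat (Suc j) * coeff (coeff P (Suc j)) i"
  by (simp add: dY_def coeff_pderiv coeff_of_nat_mult del: of_nat_Suc)

lemma coeff_euler: "coeff (coeff (euler P) j) i = of_nat (i + j) * coeff (coeff P j) i"
  by (simp add: euler_def coeff_varX_mult coeff_varY_mult coeff_dX coeff_dY algebra_simps
      split: nat.split)

text \<open>Homogeneity becomes an eigenvalue equation of a derivation, so that products and
  cofactors can be treated by cancellation instead of by coefficients.\<close>

lemma homogeneous_iff_euler: "homogeneous k P \<longleftrightarrow> euler P = of_nat k * P"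
proof -
  have "euler P = of_nat k * P \<longleftrightarrow>
      (\<forall>j i. of_nat (i + j) * coeff (coeff P j) i = of_nat k * coeff (coeff P j) i)"
    by (simp add: poly_eq_iff coeff_euler coeff_of_nat_mult)
  also have "\<dots> \<longleftrightarrow> homogeneous k P"
    unfolding homogeneous_def
    by (metis mult_cancel_right of_nat_eq_iff)
  finally show ?thesis by simp
qed

lemma euler_mult: "euler (P * Q) = euler P * Q + P * euler Q"
  by (simp add: euler_def dX_mult dY_mult algebra_simps)

lemma homogeneous_mult:
  "homogeneous k P \<Longrightarrow> homogeneous l Q \<Longrightarrow> homogeneous (k + l) (P * Q)"
  by (simp add: homogeneous_iff_euler euler_mult algebra_simps)

lemma homogeneous_add:
  "homogeneous k P \<Longrightarrow> homogeneous k Q \<Longrightarrow> homogeneous k (P + Q)"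
  unfolding homogeneous_def coeff_add by (metis add_0)

lemma homogeneous_cst: "homogeneous 0 (cst c)"
  by (auto simp: homogeneous_def cst_def coeff_pCons split: nat.splits)

lemma homogeneous_cofactor:
  assumes "homogeneous k (L * P)" "homogeneous 1 L" "L \<noteq> 0" "P \<noteq> 0"
  shows "k \<ge> 1" "homogeneous (k - 1) P"
proof -
  have "L * (P + euler P) = L * (of_nat k * P)"
    using assms(1,2) by (simp add: homogeneous_iff_euler euler_mult algebra_simps)
  then have e: "P + euler P = of_nat k * P"
    using assms(3) by simp
  \<comment> \<open>For k = 0 the equation multiplies the coefficient of x^i y^j by 1 + i + j, which
    is nonzero in characteristic zero.\<close>
  show "k \<ge> 1"
  proof (rule ccontr)
    assume "\<not> k \<ge> 1"
    then have "P + euler P = 0" using e by simp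
    then have "coeff (coeff (P + euler P) j) i = 0" for i j by simp
    then have "coeff (coeff P j) i + of_nat (i + j) * coeff (coeff P j) i = 0" for i j
      by (metis coeff_add coeff_euler)
    then have "(1 + of_nat (i + j)) * coeff (coeff P j) i = 0" for i j
      by (simp only: distrib_right mult_1)
    then have "coeff (coeff P j) i = 0" for i j
      by (metis mult_eq_0_iff of_nat_Suc of_nat_neq_0)
    then show False using assms(4) by (simp add: poly_eq_iff)
  qed
  then have "euler P = of_nat (k - 1) * P"
    using e by (simp add: of_nat_diff algebra_simps)
  then show "homogeneous (k - 1) P"
    by (simp add: homogeneous_iff_euler)
qed

lemma homogeneous_coeff:
  assumes "homogeneous k P"
  shows "coeff P j = (if j \<le> k then monom (coeff (coeff P j) (k - j)) (k - j) else 0)"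
proof (rule poly_eqI)
  fix i
  show "coeff (coeff P j) i = coeff (if j \<le> k then monom (coeff (coeff P j) (k - j)) (k - j) else 0) i"
  proof (cases "coeff (coeff P j) i = 0")
    case False
    then have "i + j = k" using assms by (auto simp: homogeneous_def)
    then show ?thesis by auto
  qed auto
qed

lemma homogeneous_expansion:
  assumes "homogeneous k P"
  shows "poly P f = (\<Sum>j\<le>k. monom (coeff (coeff P j) (k - j)) (k - j) * f ^ j)"
proof -
  have "degree P \<le> k"
    by (rule degree_le) (metis homogeneous_coeff[OF assms] not_le)
  then have "poly P f = (\<Sum>j\<le>k. coeff P j * f ^ j)"
    by (subst poly_altdef, intro sum.mono_neutral_left) (auto simp: coeff_eq_0)
  also have "\<dots> = (\<Sum>j\<le>k. monom (coeff (coeff P j) (k - j)) (k - j) * f ^ j)"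
  proof (intro sum.cong refl arg_cong2[where f = "(*)"])
    fix j assume "j \<in> {..k}"
    then show "coeff P j = monom (coeff (coeff P j) (k - j)) (k - j)"
      by (subst homogeneous_coeff[OF assms]) simp
  qed
  finally show ?thesis .
qed

lemma ev_homogeneous:
  assumes "homogeneous k P"
  shows "ev P (t * x) (t * y) = t ^ k * ev P x y"
proof -
  have "c * (t * x) ^ (k - j) * (t * y) ^ j = t ^ k * (c * x ^ (k - j) * y ^ j)" if "j \<le> k" for j c
  proof -
    have "c * (t * x) ^ (k - j) * (t * y) ^ j = (t ^ (k - j) * t ^ j) * (c * x ^ (k - j) * y ^ j)"
      by (simp add: power_mult_distrib)
    with that show ?thesis by (simp add: power_add[symmetric])
  qed
  then show ?thesis
    by (auto simp: ev_def homogeneous_expansion[OF assms] poly_sum poly_monom sum_distrib_left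
        poly_power intro!: sum.cong)
qed

lemma ev_euler:
  assumes "homogeneous k P"
  shows "x * ev (dX P) x y + y * ev (dY P) x y = of_nat k * ev P x y"
proof -
  have "ev (euler P) x y = ev (of_nat k * P) x y"
    using assms by (simp add: homogeneous_iff_euler)
  then show ?thesis by (simp add: euler_def)
qed

subsection \<open>Zeros of binary forms\<close>

definition root_form :: "complex \<Rightarrow> complex \<Rightarrow> bpoly" where
  "root_form X Y = cst X * varY - cst Y * varX"

lemma ev_root_form [simp]: "ev (root_form X Y) x y = X * y - Y * x"
  by (simp add: root_form_def)

lemma homogeneous_root_form: "homogeneous 1 (root_form X Y)"
  by (auto simp: homogeneous_def root_form_def cst_def varX_def varY_def coeff_pCons split: nat.splits)

lemma root_form_nonzero:
  assumes "(X, Y) \<noteq> (0, 0)" shows "root_form X Y \<noteq> 0"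
proof
  assume "root_form X Y = 0"
  then have "ev (root_form X Y) x y = 0" for x y by simp
  from this[of 1 0] this[of 0 1] show False using assms by simp
qed

lemma root_form_not_unit: "\<not> root_form X Y dvd 1"
proof
  assume "root_form X Y dvd 1"
  then obtain M where "1 = root_form X Y * M" by (elim dvdE)
  then have "ev 1 X Y = ev (root_form X Y * M) X Y" by simp
  then show False by (simp add: mult.commute)
qed

text \<open>For X nonzero, P as a polynomial in y over the polynomials in x has the root (Y/X) x.
  For X = 0, every coefficient of P vanishes at x = 0.\<close>

lemma root_form_dvd:
  assumes hom: "homogeneous k P" and nz: "(X, Y) \<noteq> (0, 0)" and root: "ev P X Y = 0"
  shows "root_form X Y dvd P"
proof (cases "X = 0")
  case False
  define s where "s = Y / X"
  have "poly (poly P [:0, s:]) x = ev P x (s * x)" for x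
    by (induction P) (simp_all add: ev_pCons algebra_simps)
  moreover have "ev P x (s * x) = 0" for x
    using ev_homogeneous[OF hom, of "x / X" X Y] False root by (simp add: s_def mult.commute)
  ultimately have "poly P [:0, s:] = 0"
    by (simp add: poly_all_0_iff_0[symmetric])
  then have "[:- [:0, s:], 1:] dvd P"
    by (simp only: poly_eq_0_iff_dvd)
  then obtain R where "P = [:- [:0, s:], 1:] * R" by (elim dvdE)
  moreover have "smult [:1 / X:] (root_form X Y) = [:- [:0, s:], 1:]"
    using False by (simp add: root_form_def cst_def varX_def varY_def s_def)
  ultimately have "P = root_form X Y * smult [:1 / X:] R"
    by (metis mult_smult_left mult_smult_right)
  then show ?thesis by (rule dvdI)
next
  case True
  then have Y: "Y \<noteq> 0" using nz by simp
  have "poly (map_poly (\<lambda>f. poly f 0) P) y = ev P 0 y" for y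
    by (induction P) (simp_all add: ev_pCons map_poly_pCons)
  moreover have "ev P 0 y = 0" for y
    using ev_homogeneous[OF hom, of "y / Y" X Y] True Y root by simp
  ultimately have "map_poly (\<lambda>f. poly f 0) P = 0"
    by (simp add: poly_all_0_iff_0[symmetric])
  then have "poly (coeff P j) 0 = 0" for j
    by (metis coeff_0 coeff_map_poly poly_0)
  then have "[:0, - Y:] dvd coeff P j" for j
  proof -
    assume "\<And>j. poly (coeff P j) 0 = 0"
    then have "[:- 0, 1:] dvd coeff P j" using poly_eq_0_iff_dvd by blast
    then have "smult (- Y) [:0, 1:] dvd coeff P j" using Y by (subst smult_dvd_iff) simp
    then show ?thesis by simp
  qed
  then have "[:[:0, - Y:]:] dvd P" by (simp add: const_poly_dvd_iff)
  moreover have "root_form X Y = [:[:0, - Y:]:]"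
    using True by (simp add: root_form_def cst_def varX_def varY_def)
  ultimately show ?thesis by simp
qed

lemma homogeneous_factor_root:
  assumes "homogeneous k D" "D \<noteq> 0" "(X, Y) \<noteq> (0, 0)"
  obtains \<nu> P where "D = root_form X Y ^ \<nu> * P" "\<nu> \<le> k" "homogeneous (k - \<nu>) P" "ev P X Y \<noteq> 0"
  using assms(1,2)
proof (induction k arbitrary: D thesis)
  case 0
  have "ev D X Y \<noteq> 0"
  proof
    assume "ev D X Y = 0"
    then obtain P where "D = root_form X Y * P"
      using root_form_dvd[OF "0.prems"(2) assms(3)] by (auto elim: dvdE)
    then show False
      using homogeneous_cofactor(1)[of 0 "root_form X Y" P] "0.prems" homogeneous_root_form
        root_form_nonzero[OF assms(3)] by auto
  qed
  then show ?case using "0.prems"(1)[of 0 D] "0.prems"(2) by simp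
next
  case (Suc k)
  show ?case
  proof (cases "ev D X Y = 0")
    case False
    then show ?thesis using Suc.prems(1)[of 0 D] Suc.prems(2) by simp
  next
    case True
    then obtain P where P: "D = root_form X Y * P"
      using root_form_dvd[OF Suc.prems(2) assms(3)] True by (auto elim: dvdE)
    have P0: "P \<noteq> 0" using P Suc.prems(3) by auto
    have "homogeneous k P"
      using homogeneous_cofactor(2)[of "Suc k" "root_form X Y" P] Suc.prems(2) P P0 homogeneous_root_form
        root_form_nonzero[OF assms(3)] by auto
    from Suc.IH[OF _ this P0] obtain \<nu> P' where
      "P = root_form X Y ^ \<nu> * P'" "\<nu> \<le> k" "homogeneous (k - \<nu>) P'" "ev P' X Y \<noteq> 0" by blast
    then show ?thesis
      using Suc.prems(1)[of "Suc \<nu>" P'] P by (simp add: mult.assoc)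
  qed
qed

lemma coprime_no_common_zero:
  assumes "homogeneous k A" "homogeneous l B" "coprime A B" "(X, Y) \<noteq> (0, 0)"
  shows "ev A X Y \<noteq> 0 \<or> ev B X Y \<noteq> 0"
  using assms root_form_dvd root_form_not_unit by (meson coprime_common_divisor)

subsection \<open>The chart $y = \kappa x - 1$\<close>

text \<open>The restriction to the affine line y = \<kappa> x - 1, which meets every direction
  except (1, \<kappa>) exactly once.\<close>

definition chart :: "complex \<Rightarrow> bpoly \<Rightarrow> complex poly" where
  "chart \<kappa> P = poly P [:- 1, \<kappa>:]"

lemma chart_simps [simp]:
  "chart \<kappa> (P + Q) = chart \<kappa> P + chart \<kappa> Q"
  "chart \<kappa> (P * Q) = chart \<kappa> P * chart \<kappa> Q"
  "chart \<kappa> (P ^ k) = chart \<kappa> P ^ k"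
  "chart \<kappa> (cst c) = [:c:]"
  by (simp_all add: chart_def cst_def)

lemma chart_root_form: "chart \<kappa> (root_form X Y) = [:- X, \<kappa> * X - Y:]"
  by (simp add: chart_def root_form_def cst_def varX_def varY_def algebra_simps)

lemma poly_chart: "poly (chart \<kappa> P) \<sigma> = ev P \<sigma> (\<kappa> * \<sigma> - 1)"
  unfolding chart_def
  by (induction P) (simp_all add: ev_pCons algebra_simps)

lemma pderiv_chart: "pderiv (chart \<kappa> P) = chart \<kappa> (dX P) + smult \<kappa> (chart \<kappa> (dY P))"
  unfolding chart_def dY_def
proof (induction P)
  case (pCons f P)
  have "pderiv [:-1, \<kappa>:] = [:\<kappa>:]" by (simp add: pderiv_pCons)
  then show ?case
    using pCons by (simp add: dX_pCons pderiv_add pderiv_mult pderiv_pCons[of f P] del: mult_pCons_left)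
       (simp add: algebra_simps smult_add_right smult_diff_right)
qed simp

lemma degree_chart_le:
  assumes "homogeneous k P"
  shows "degree (chart \<kappa> P) \<le> k"
  unfolding chart_def homogeneous_expansion[OF assms]
proof (rule degree_sum_le)
  fix j assume "j \<in> {..k}"
  have "degree (monom c (k - j) * [:- 1, \<kappa>:] ^ j) \<le> (k - j) + j" for c
    by (intro order.trans[OF degree_mult_le] add_mono degree_monom_le order.trans[OF degree_power_le])
       (auto intro: order.trans)
  then show "degree (monom (coeff (coeff P j) (k - j)) (k - j) * [:- 1, \<kappa>:] ^ j) \<le> k"
    using \<open>j \<in> {..k}\<close> by auto
qed simp

text \<open>The top coefficient is the value at the one direction missing from the chart; if it is
  nonzero, no root lies at infinity.\<close>

lemma coeff_chart:
  assumes "homogeneous k P"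
  shows "coeff (chart \<kappa> P) k = ev P 1 \<kappa>"
proof -
  have c: "coeff ([:- 1, \<kappa>:] ^ j) j = \<kappa> ^ j \<and> degree ([:- 1, \<kappa>:] ^ j) \<le> j" for j
  proof (induction j)
    case (Suc j)
    have "degree ([:- 1, \<kappa>:] ^ Suc j) \<le> degree [:- 1, \<kappa>:] + degree ([:- 1, \<kappa>:] ^ j)"
      unfolding power_Suc by (rule degree_mult_le)
    also have "\<dots> \<le> Suc j" using Suc by auto
    finally show ?case using Suc by (simp add: coeff_eq_0)
  qed simp
  have "coeff (chart \<kappa> P) k = (\<Sum>j\<le>k. coeff (coeff P j) (k - j) * \<kappa> ^ j)"
    unfolding chart_def homogeneous_expansion[OF assms] coeff_sum
    by (intro sum.cong) (auto simp: coeff_monom_mult c split: if_splits)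
  also have "\<dots> = ev P 1 \<kappa>"
    unfolding ev_def homogeneous_expansion[OF assms]
    by (simp add: poly_sum poly_monom poly_power)
  finally show ?thesis .
qed

text \<open>The derivative along the chart and Euler's identity form a linear system of determinant
  -1 for the two partial derivatives. The factor \<tau> on the left makes the power \<tau>^k, so
  that degree zero needs no separate formula.\<close>

lemma ev_derivs_chart:
  fixes \<kappa> c \<tau> :: complex
  assumes hom: "homogeneous k P" and \<tau>: "X = \<tau> * c" "Y = \<tau> * (\<kappa> * c - 1)"
  shows "\<tau> * ev (dX P) X Y = \<tau> ^ k * ((1 - \<kappa> * c) * poly (pderiv (chart \<kappa> P)) c + \<kappa> * of_nat k * poly (chart \<kappa> P) c)"
    and "\<tau> * ev (dY P) X Y = \<tau> ^ k * (c * poly (pderiv (chart \<kappa> P)) c - of_nat k * poly (chart \<kappa> P) c)"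
proof -
  have hX: "\<tau> * ev (dX P) X Y = \<tau> ^ k * ev (dX P) c (\<kappa> * c - 1)"
    and hY: "\<tau> * ev (dY P) X Y = \<tau> ^ k * ev (dY P) c (\<kappa> * c - 1)"
  proof -
    have "homogeneous (k - 1) (dX P) \<and> (k = 0 \<longrightarrow> dX P = 0)"
      using hom unfolding homogeneous_def poly_eq_iff by (force simp: coeff_dX)
    then show "\<tau> * ev (dX P) X Y = \<tau> ^ k * ev (dX P) c (\<kappa> * c - 1)"
      using ev_homogeneous[of "k - 1" "dX P" \<tau> c "\<kappa> * c - 1"] \<tau>
      by (cases k) (simp_all add: mult.assoc)
    have "homogeneous (k - 1) (dY P) \<and> (k = 0 \<longrightarrow> dY P = 0)"
      using hom unfolding homogeneous_def poly_eq_iff by (force simp: coeff_dY)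
    then show "\<tau> * ev (dY P) X Y = \<tau> ^ k * ev (dY P) c (\<kappa> * c - 1)"
      using ev_homogeneous[of "k - 1" "dY P" \<tau> c "\<kappa> * c - 1"] \<tau>
      by (cases k) (simp_all add: mult.assoc)
  qed
  have 1: "poly (pderiv (chart \<kappa> P)) c = ev (dX P) c (\<kappa> * c - 1) + \<kappa> * ev (dY P) c (\<kappa> * c - 1)"
    by (simp add: pderiv_chart poly_chart)
  have 2: "c * ev (dX P) c (\<kappa> * c - 1) + (\<kappa> * c - 1) * ev (dY P) c (\<kappa> * c - 1) = of_nat k * poly (chart \<kappa> P) c"
    using ev_euler[OF hom, of c "\<kappa> * c - 1"] by (simp add: poly_chart)
  have "(1 - \<kappa> * c) * poly (pderiv (chart \<kappa> P)) c + \<kappa> * of_nat k * poly (chart \<kappa> P) c = ev (dX P) c (\<kappa> * c - 1)"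
    unfolding 1 mult.assoc 2[symmetric] by (simp add: algebra_simps)
  moreover have "c * poly (pderiv (chart \<kappa> P)) c - of_nat k * poly (chart \<kappa> P) c = ev (dY P) c (\<kappa> * c - 1)"
    unfolding 1 2[symmetric] by (simp add: algebra_simps)
  ultimately show "\<tau> * ev (dX P) X Y = \<tau> ^ k * ((1 - \<kappa> * c) * poly (pderiv (chart \<kappa> P)) c + \<kappa> * of_nat k * poly (chart \<kappa> P) c)"
    and "\<tau> * ev (dY P) X Y = \<tau> ^ k * (c * poly (pderiv (chart \<kappa> P)) c - of_nat k * poly (chart \<kappa> P) c)"
    using hX hY by simp_all
qed


subsection \<open>Points of the projective line and the Gauss map\<close>

lemma pt_scale:
  assumes "t \<noteq> 0" shows "pt (t * y) (t * x) = pt y x"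
proof -
  have "\<exists>u. s * (t * y) = u * y \<and> s * (t * x) = u * x \<and> u \<noteq> 0" if "s \<noteq> 0" for s
    by (rule exI[of _ "s * t"]) (use that assms in auto)
  moreover have "\<exists>u. s * y = u * (t * y) \<and> s * x = u * (t * x) \<and> u \<noteq> 0" if "s \<noteq> 0" for s
    by (rule exI[of _ "s / t"]) (use that assms in auto)
  ultimately show ?thesis by (auto simp: pt_def)
qed

lemma pt_self: "(y, x) \<in> pt y x"
  by (auto simp: pt_def intro: exI[of _ 1])

lemma pt_eq_iff:
  assumes "(y, x) \<noteq> (0, 0)" "(y', x') \<noteq> (0, 0)"
  shows "pt y x = pt y' x' \<longleftrightarrow> y * x' = y' * x"
proof
  assume "pt y x = pt y' x'"
  then have "(y, x) \<in> pt y' x'" using pt_self by metis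
  then show "y * x' = y' * x" by (auto simp: pt_def)
next
  assume e: "y * x' = y' * x"
  show "pt y x = pt y' x'"
  proof (cases "x = 0")
    case True
    then have "x' = 0" "y \<noteq> 0" "y' \<noteq> 0" using assms e by auto
    then show ?thesis using True pt_scale[of "y / y'" y' x'] by simp
  next
    case False
    then have "x' \<noteq> 0" using assms e by auto
    then have "y = x / x' * y'" "x = x / x' * x'" using e by (simp_all add: field_simps)
    then show ?thesis using pt_scale[of "x / x'" y' x'] False \<open>x' \<noteq> 0\<close> by auto
  qed
qed

lemma aff_pt:
  assumes "x \<noteq> 0" shows "aff (pt y x) = y / x"
  unfolding aff_def
proof (rule the_equality)
  show "pt y x = pt (y / x) 1" using assms by (subst pt_eq_iff) auto
  show "c = y / x" if "pt y x = pt c 1" for c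
    using that assms by (subst (asm) pt_eq_iff) (auto simp: field_simps)
qed

lemma gauss_pt:
  assumes "homogeneous k A" "homogeneous k B"
  shows "gauss A B (pt y x) = pt (- ev A x y) (ev B x y)"
proof -
  have "pt (- ev A (t * x) (t * y)) (ev B (t * x) (t * y)) = pt (- ev A x y) (ev B x y)" if "t \<noteq> 0" for t
    using that pt_scale[of "t ^ k" "- ev A x y" "ev B x y"]
    by (simp add: ev_homogeneous[OF assms(1)] ev_homogeneous[OF assms(2)])
  moreover have "gauss A B (pt y x) = (\<Union>t\<in>{t. t \<noteq> 0}. pt (- ev A (t * x) (t * y)) (ev B (t * x) (t * y)))"
    by (auto simp: gauss_def pt_def[of y x])
  ultimately show ?thesis by (auto intro: exI[of _ 1])
qed

lemma holomorphic_ev: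
  assumes "f holomorphic_on S" "g holomorphic_on S"
  shows "(\<lambda>t. ev P (f t) (g t)) holomorphic_on S"
proof (induction P)
  case (pCons p P)
  have "(\<lambda>t. poly p (f t)) holomorphic_on S"
    using assms(1) by (induction p) (auto intro!: holomorphic_intros)
  with pCons show ?case by (auto simp: ev_pCons intro!: holomorphic_intros assms)
qed simp

text \<open>In the affine coordinate, the map minus p0 is -(A + p0 B)/B, and B does not vanish at
  the point; hence the order of A + p0 B there is the ramification index.\<close>

lemma ramification_index_gauss:
  assumes hom: "homogeneous k A" "homogeneous k B" and cop: "coprime A B"
    and XY: "(X, Y) \<noteq> (0, 0)" and g: "gauss A B (pt Y X) = pt p0 1"
    and fac: "A + cst p0 * B = root_form X Y ^ \<nu> * P" and homP: "homogeneous l P" and P: "ev P X Y \<noteq> 0"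
  shows "ramification_index (gauss A B) (pt Y X) = \<nu>"
proof -
  \<comment> \<open>Homogeneous coordinates of \<open>local_param\<close>, in the finite case and at
    infinity; along them the linear form X y - Y x equals \<open>e\<close> times t.\<close>
  define u v :: "complex \<Rightarrow> complex" where "u = (\<lambda>t. if X = 0 then t else 1)" and "v = (\<lambda>t. if X = 0 then 1 else Y / X + t)"
  define e where "e = (if X = 0 then - Y else X)"
  have e0: "e \<noteq> 0" using XY by (auto simp: e_def)
  have lp: "local_param (pt Y X) t = pt (v t) (u t)" for t
    using XY by (auto simp: local_param_def inf_pt_def pt_eq_iff u_def v_def aff_pt)
  have hol: "u holomorphic_on UNIV" "v holomorphic_on UNIV"
    unfolding u_def v_def by (cases "X = 0"; auto intro!: holomorphic_intros)+
  have AB: "(- ev A X Y, ev B X Y) \<noteq> (0, 0)"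
    using coprime_no_common_zero[OF hom cop XY] by auto
  have "pt (- ev A X Y) (ev B X Y) = pt p0 1" using g gauss_pt[OF hom] by simp
  then have "ev B X Y \<noteq> 0"
    using AB by (subst (asm) pt_eq_iff) auto
  moreover have scale: "u 0 = X / (if X = 0 then Y else X)" "v 0 = Y / (if X = 0 then Y else X)"
    using XY by (auto simp: u_def v_def)
  then have uv: "u 0 = inverse (if X = 0 then Y else X) * X" "v 0 = inverse (if X = 0 then Y else X) * Y"
    by (simp_all add: field_simps)
  moreover have "(if X = 0 then Y else X) \<noteq> 0" using XY by auto
  ultimately have B0: "ev B (u 0) (v 0) \<noteq> 0"
    by (simp only: uv ev_homogeneous[OF hom(2)]) auto
  have P0: "ev P (u 0) (v 0) \<noteq> 0"
    using P XY by (simp only: uv ev_homogeneous[OF homP]) (auto split: if_splits)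
  let ?S = "{t. ev B (u t) (v t) \<noteq> 0}"
  have "open ?S"
  proof -
    have "continuous_on UNIV (\<lambda>t. ev B (u t) (v t))"
      by (intro holomorphic_on_imp_continuous_on holomorphic_ev hol)
    from open_vimage[OF _ this, of "- {0}"] show ?thesis by (auto simp: vimage_def)
  qed
  have eq: "local_coord (gauss A B (pt Y X)) (gauss A B (local_param (pt Y X) t)) =
      - (e ^ \<nu>) * ev P (u t) (v t) / ev B (u t) (v t) * (t - 0) powi int \<nu>" if "t \<in> ?S" for t
  proof -
    have "X * v t - Y * u t = e * t" by (auto simp: u_def v_def e_def algebra_simps)
    moreover have "ev (A + cst p0 * B) (u t) (v t) = ev (root_form X Y ^ \<nu> * P) (u t) (v t)"
      by (simp only: fac)
    ultimately have A_eq: "ev A (u t) (v t) = (e * t) ^ \<nu> * ev P (u t) (v t) - p0 * ev B (u t) (v t)"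
      by (simp add: algebra_simps)
    have "pt p0 1 \<noteq> inf_pt" by (simp add: inf_pt_def pt_eq_iff)
    then show ?thesis using that
      unfolding local_coord_def g lp
      by (simp add: gauss_pt[OF hom] aff_pt A_eq diff_divide_distrib power_mult_distrib)
  qed
  have "zorder (\<lambda>t. local_coord (gauss A B (pt Y X)) (gauss A B (local_param (pt Y X) t))) 0 = int \<nu>"
  proof (rule zorder_eqI[OF \<open>open ?S\<close>])
    show "(\<lambda>t. - (e ^ \<nu>) * ev P (u t) (v t) / ev B (u t) (v t)) holomorphic_on ?S"
      by (intro holomorphic_intros holomorphic_ev holomorphic_on_subset[OF hol(1)] holomorphic_on_subset[OF hol(2)]) auto
  qed (use eq B0 P0 e0 in auto)
  then show ?thesis by (simp add: ramification_index_def)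
qed

text \<open>On the fibre A(X,Y) = -p0 B(X,Y), so the determinant is the constant B(X,Y) times A + p0
  B. This constant drops out of the quotient of Q by P.\<close>

lemma P_pt_eq:
  assumes XY: "(X, Y) \<noteq> (0, 0)" and A: "ev A X Y = - p0 * ev B X Y"
    and fac: "A + cst p0 * B = root_form X Y ^ \<nu> * P"
  shows "P_pt A B Y X \<nu> = cst (ev B X Y) * P"
proof -
  have "cst (- p0 * ev B X Y) = - (cst (ev B X Y) * cst p0)"
    by (simp add: cst_def)
  then have "det2 A (cst (ev A X Y)) B (cst (ev B X Y)) = cst (ev B X Y) * (A + cst p0 * B)"
    by (simp add: det2_def A algebra_simps)
  also have "\<dots> = root_form X Y ^ \<nu> * (cst (ev B X Y) * P)"
    unfolding fac by (simp only: mult_ac)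
  finally have "P_pt A B Y X \<nu> = root_form X Y ^ \<nu> * (cst (ev B X Y) * P) div root_form X Y ^ \<nu>"
    by (simp add: P_pt_def root_form_def)
  then show ?thesis using root_form_nonzero[OF XY] by simp
qed

lemma P_ell_eq_P_pt: "P_ell A B \<alpha> \<beta> \<nu> = P_pt A B (- \<alpha>) \<beta> \<nu>"
proof -
  have "cst \<alpha> * varX + cst \<beta> * varY = cst \<beta> * varY - cst (- \<alpha>) * varX"
    by (simp add: cst_def varX_def)
  then show ?thesis by (simp add: P_ell_def P_pt_def)
qed

text \<open>The quotient Q/(B P) of the criterion with free weights: \<nu> - 1 and 2 \<nu> + 1 at
  the direction of the line, \<nu> - 2 and 2 (\<nu> + 1) at the other points. Both kinds of points
  are thus carried to the chart together.\<close>

definition point_quotient ::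
  "bpoly \<Rightarrow> bpoly \<Rightarrow> bpoly \<Rightarrow> complex \<Rightarrow> complex \<Rightarrow> complex \<Rightarrow> complex \<Rightarrow> complex" where
  "point_quotient A B P X Y u1 u2 =
     (u1 * (ev (dX B) X Y - ev (dY A) X Y) * ev P X Y
      + u2 * (ev (dX P) X Y * ev B X Y - ev A X Y * ev (dY P) X Y)) / (ev B X Y * ev P X Y)"

definition chart_quotient ::
  "complex \<Rightarrow> complex \<Rightarrow> bpoly \<Rightarrow> complex poly \<Rightarrow> nat \<Rightarrow> complex \<Rightarrow> complex \<Rightarrow> complex \<Rightarrow> complex \<Rightarrow> complex" where
  "chart_quotient \<kappa> p0 B K m l c u1 u2 =
     u1 * ((1 + (p0 - \<kappa>) * c) * (poly (pderiv (chart \<kappa> B)) c / poly (chart \<kappa> B) c) - (p0 - \<kappa>) * of_nat m) +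
     u2 * ((1 + (p0 - \<kappa>) * c) * (poly (pderiv K) c / poly K c) - (p0 - \<kappa>) * l)"

text \<open>In the chart, the linear factor of \<open>A + p\<^sub>0 B\<close> at the point \<open>\<tau> (c, \<kappa> c - 1)\<close> becomes
  \<open>\<tau> (\<sigma> - c)\<close>, whence the power of \<open>\<tau>\<close> in \<open>K\<close>.\<close>

lemma ev_quotient_chart:
  fixes \<kappa> c \<tau> p0 u1 u2 :: complex
  assumes hom: "homogeneous m A" "homogeneous m B" "homogeneous l P" and \<nu>: "l + \<nu> = m"
    and XY: "X = \<tau> * c" "Y = \<tau> * (\<kappa> * c - 1)" and \<tau>: "\<tau> \<noteq> 0"
    and fac: "A + cst p0 * B = root_form X Y ^ \<nu> * P"
    and A: "ev A X Y = - p0 * ev B X Y" and B: "ev B X Y \<noteq> 0" and P: "ev P X Y \<noteq> 0"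
    and u: "u1 = 0 \<or> poly (pderiv (chart \<kappa> (A + cst p0 * B))) c = 0"
  defines "K \<equiv> smult (\<tau> ^ \<nu>) (chart \<kappa> P)"
  shows "chart \<kappa> A + smult p0 (chart \<kappa> B) = [:- c, 1:] ^ \<nu> * K" "poly K c \<noteq> 0" "poly (chart \<kappa> B) c \<noteq> 0"
    and "\<tau> * point_quotient A B (cst (ev B X Y) * P) X Y u1 u2 = chart_quotient \<kappa> p0 B K m (of_nat l) c u1 u2"
proof -
  define N0 where "N0 = 1 + (p0 - \<kappa>) * c"
  define b where "b = poly (pderiv (chart \<kappa> B)) c / poly (chart \<kappa> B) c"
  have evs: "ev A X Y = \<tau> ^ m * poly (chart \<kappa> A) c" "ev B X Y = \<tau> ^ m * poly (chart \<kappa> B) c"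
    "ev P X Y = \<tau> ^ l * poly (chart \<kappa> P) c"
    unfolding XY by (simp_all add: ev_homogeneous[OF hom(1)] ev_homogeneous[OF hom(2)] ev_homogeneous[OF hom(3)] poly_chart)
  have [simp]: "poly (chart \<kappa> P) c \<noteq> 0" using evs P by auto
  show Bc [simp]: "poly (chart \<kappa> B) c \<noteq> 0" using evs B by auto
  show Kc: "poly K c \<noteq> 0" using \<tau> by (simp add: K_def)
  have rf: "chart \<kappa> (root_form X Y) = smult \<tau> [:- c, 1:]"
    by (simp add: chart_root_form XY algebra_simps)
  have "chart \<kappa> (A + cst p0 * B) = chart \<kappa> (root_form X Y) ^ \<nu> * chart \<kappa> P"
    by (simp only: fac chart_simps)
  then have "chart \<kappa> A + smult p0 (chart \<kappa> B) = chart \<kappa> (root_form X Y) ^ \<nu> * chart \<kappa> P"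
    by simp
  then show "chart \<kappa> A + smult p0 (chart \<kappa> B) = [:- c, 1:] ^ \<nu> * K"
    unfolding rf K_def smult_power by (simp only: mult_smult_left mult_smult_right)
  have Ac: "poly (chart \<kappa> A) c = - p0 * poly (chart \<kappa> B) c"
  proof -
    have "\<tau> ^ m * poly (chart \<kappa> A) c = \<tau> ^ m * (- p0 * poly (chart \<kappa> B) c)"
      using A evs by (simp add: algebra_simps)
    then show ?thesis using \<tau> by (metis mult_cancel_left power_not_zero)
  qed
  let ?B = "poly (chart \<kappa> B) c" and ?B' = "poly (pderiv (chart \<kappa> B)) c" and ?A' = "poly (pderiv (chart \<kappa> A)) c"
    and ?P = "poly (chart \<kappa> P) c" and ?P' = "poly (pderiv (chart \<kappa> P)) c"
  note d = ev_derivs_chart[OF _ XY]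
  have K': "poly (pderiv K) c / poly K c = ?P' / ?P"
    using \<tau> by (simp add: K_def pderiv_smult)
  \<comment> \<open>This term contains the derivative of A. Where A + p0 B has a multiple zero in
    the chart, that derivative is -p0 times the derivative of B; in the other case of the hypothesis
    \<open>u\<close> the weight is zero.\<close>
  have part1: "u1 * (\<tau> * (ev (dX B) X Y - ev (dY A) X Y)) = u1 * (\<tau> ^ m * (N0 * ?B' - (p0 - \<kappa>) * of_nat m * ?B))"
  proof (cases "u1 = 0")
    case False
    then have "poly (pderiv (chart \<kappa> (A + cst p0 * B))) c = 0" using u by auto
    then have A': "?A' = - p0 * ?B'"
      by (simp add: pderiv_add pderiv_smult eq_neg_iff_add_eq_0)
    have "\<tau> * (ev (dX B) X Y - ev (dY A) X Y) =
       \<tau> ^ m * ((1 - \<kappa> * c) * ?B' + \<kappa> * of_nat m * ?B) - \<tau> ^ m * (c * ?A' - of_nat m * poly (chart \<kappa> A) c)"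
      using d(1)[OF hom(2)] d(2)[OF hom(1)] by (simp add: algebra_simps)
    also have "\<dots> = \<tau> ^ m * (N0 * ?B' - (p0 - \<kappa>) * of_nat m * ?B)"
      unfolding A' Ac N0_def by (simp add: algebra_simps)
    finally show ?thesis by simp
  qed simp
  have part2: "\<tau> * (ev (dX P) X Y + p0 * ev (dY P) X Y) = \<tau> ^ l * (N0 * ?P' - (p0 - \<kappa>) * of_nat l * ?P)"
  proof -
    have "\<tau> * (ev (dX P) X Y + p0 * ev (dY P) X Y) = \<tau> * ev (dX P) X Y + p0 * (\<tau> * ev (dY P) X Y)"
      by (simp add: algebra_simps)
    then show ?thesis unfolding d[OF hom(3)] N0_def by (simp add: algebra_simps)
  qed
  have B2: "ev B X Y = \<tau> ^ m * ?B" and P2: "ev P X Y = \<tau> ^ l * ?P" by (rule evs)+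
  have "\<tau> * point_quotient A B (cst (ev B X Y) * P) X Y u1 u2 =
      u1 * (\<tau> * (ev (dX B) X Y - ev (dY A) X Y)) / ev B X Y +
      u2 * (\<tau> * (ev (dX P) X Y + p0 * ev (dY P) X Y)) / ev P X Y"
    using B P unfolding point_quotient_def dX_cst_mult dY_cst_mult ev_mult ev_cst A by (simp add: field_simps)
  also have "u1 * (\<tau> * (ev (dX B) X Y - ev (dY A) X Y)) / ev B X Y = u1 * (N0 * b - (p0 - \<kappa>) * of_nat m)"
    unfolding part1 B2 b_def using \<tau> by (simp add: divide_simps)
  also have "u2 * (\<tau> * (ev (dX P) X Y + p0 * ev (dY P) X Y)) / ev P X Y =
      u2 * (N0 * (poly (pderiv K) c / poly K c) - (p0 - \<kappa>) * of_nat l)"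
    unfolding part2 P2 K' using \<tau> by (simp add: divide_simps)
  finally show "\<tau> * point_quotient A B (cst (ev B X Y) * P) X Y u1 u2 = chart_quotient \<kappa> p0 B K m (of_nat l) c u1 u2"
    by (simp only: chart_quotient_def N0_def b_def)
qed

subsection \<open>Simple roots and multiple roots of polynomials\<close>

text \<open>The logarithmic derivative of M is the sum of the 1/(r - z), and its own derivative is
  minus the sum of their squares.\<close>

lemma poly_prod_linear_derivs:
  fixes r :: "'a :: field"
  assumes "finite Z" "r \<notin> Z"
  defines "M \<equiv> \<Prod>z\<in>Z. [:- z, 1:]" and "u \<equiv> \<lambda>z. 1 / (r - z)"
  shows "poly M r \<noteq> 0" "poly (pderiv M) r = poly M r * sum u Z"
    "poly (pderiv (pderiv M)) r = poly M r * ((sum u Z)\<^sup>2 - (\<Sum>z\<in>Z. (u z)\<^sup>2))"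
proof -
  have "poly M r \<noteq> 0 \<and> poly (pderiv M) r = poly M r * sum u Z \<and>
    poly (pderiv (pderiv M)) r = poly M r * ((sum u Z)\<^sup>2 - (\<Sum>z\<in>Z. (u z)\<^sup>2))"
    using assms(1,2) unfolding M_def
  proof (induction Z rule: finite_induct)
    case (insert z Z)
    let ?M = "\<Prod>z\<in>Z. [:- z, 1:]"
    have z: "r - z \<noteq> 0" and IH: "poly ?M r \<noteq> 0" "poly (pderiv ?M) r = poly ?M r * sum u Z"
      "poly (pderiv (pderiv ?M)) r = poly ?M r * ((sum u Z)\<^sup>2 - (\<Sum>z\<in>Z. (u z)\<^sup>2))"
      using insert by auto
    have uz: "u z * (r - z) = 1" using z by (simp add: u_def)
    have ins: "(\<Prod>z\<in>insert z Z. [:- z, 1:]) = [:- z, 1:] * ?M" using insert by simp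
    have d: "pderiv ([:- z, 1:] * ?M) = ?M + [:- z, 1:] * pderiv ?M"
      "pderiv (pderiv ([:- z, 1:] * ?M)) = pderiv ?M + pderiv ?M + [:- z, 1:] * pderiv (pderiv ?M)"
      by (simp_all add: pderiv_mult pderiv_add pderiv_pCons del: mult_pCons_left)
    have "poly ?M r + (r - z) * (poly ?M r * sum u Z) = (r - z) * poly ?M r * (u z + sum u Z)"
    proof -
      have "(r - z) * poly ?M r * (u z + sum u Z) = (u z * (r - z)) * poly ?M r + (r - z) * (poly ?M r * sum u Z)"
        by algebra
      then show ?thesis using uz by simp
    qed
    note eqs = this
    have "2 * (poly ?M r * sum u Z) + (r - z) * (poly ?M r * ((sum u Z)\<^sup>2 - (\<Sum>z\<in>Z. (u z)\<^sup>2))) =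
        (r - z) * poly ?M r * ((u z + sum u Z)\<^sup>2 - ((u z)\<^sup>2 + (\<Sum>z\<in>Z. (u z)\<^sup>2)))"
    proof -
      have "(r - z) * poly ?M r * ((u z + sum u Z)\<^sup>2 - ((u z)\<^sup>2 + (\<Sum>z\<in>Z. (u z)\<^sup>2))) =
        (u z * (r - z)) * (2 * (poly ?M r * sum u Z)) + (r - z) * (poly ?M r * ((sum u Z)\<^sup>2 - (\<Sum>z\<in>Z. (u z)\<^sup>2)))"
        by algebra
      then show ?thesis using uz by simp
    qed
    note eqs = eqs this
    show ?case
    proof -
      have "poly (pderiv ([:- z, 1:] * ?M)) r = poly ?M r + (r - z) * poly (pderiv ?M) r"
        unfolding d(1) poly_add poly_mult by simp
      moreover have "poly (pderiv (pderiv ([:- z, 1:] * ?M))) r =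
          2 * poly (pderiv ?M) r + (r - z) * poly (pderiv (pderiv ?M)) r"
        unfolding d(2) poly_add poly_mult by simp
      moreover have "poly ([:- z, 1:] * ?M) r = (r - z) * poly ?M r"
        unfolding poly_mult by simp
      ultimately show ?thesis
        using z IH(1) insert.hyps eqs unfolding ins IH(2,3) by simp
    qed
  qed simp
  then show "poly M r \<noteq> 0" "poly (pderiv M) r = poly M r * sum u Z"
    "poly (pderiv (pderiv M)) r = poly M r * ((sum u Z)\<^sup>2 - (\<Sum>z\<in>Z. (u z)\<^sup>2))"
    by auto
qed

text \<open>Splitting off the factor z - r shifts the derivatives by one: the first three
  derivatives of p at r are 1, 2, 3 times those of order 0, 1, 2 of the cofactor. So the power sums
  over the other roots are Taylor data of p at r.\<close>

lemma poly_simple_roots_derivs: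
  fixes p :: "complex poly"
  assumes card: "card {z. poly p z = 0} = degree p" and p: "p \<noteq> 0" and r: "poly p r = 0"
  defines "Z \<equiv> {z. poly p z = 0} - {r}" and "u \<equiv> \<lambda>z. 1 / (r - z)"
  shows "poly (pderiv p) r \<noteq> 0"
    "poly (pderiv (pderiv p)) r = 2 * poly (pderiv p) r * sum u Z"
    "poly (pderiv (pderiv (pderiv p))) r = 3 * poly (pderiv p) r * ((sum u Z)\<^sup>2 - (\<Sum>z\<in>Z. (u z)\<^sup>2))"
proof -
  let ?R = "{z. poly p z = 0}"
  have fin: "finite ?R" using p poly_roots_finite by blast
  \<comment> \<open>All orders are at least 1 and add up to the degree, which is the number of
    roots.\<close>
  have "order z p = 1" if "z \<in> ?R" for z
  proof (rule ccontr)
    assume "order z p \<noteq> 1"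
    moreover have ge: "order y p \<ge> 1" if "y \<in> ?R" for y
      using that p by (simp add: order_root Suc_le_eq)
    ultimately have "(\<Sum>y\<in>?R. 1) < (\<Sum>y\<in>?R. order y p)"
      using fin that by (intro sum_strict_mono2[where b = z] | intro sum_strict_mono_ex1) (auto intro!: bexI[of _ z] simp: le_neq_implies_less)
    also have "(\<Sum>y\<in>?R. order y p) = degree (smult (lead_coeff p) (\<Prod>z\<in>?R. [:-z, 1:] ^ order z p))"
      using p by (simp add: degree_prod_sum_eq degree_power_eq)
    also have "\<dots> = degree p" by (simp only: complex_poly_decompose)
    finally show False using card by simp
  qed
  then have "p = smult (lead_coeff p) (\<Prod>z\<in>?R. [:-z, 1:])"
    by (subst complex_poly_decompose[symmetric], intro arg_cong2[where f = smult] prod.cong) simp_all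
  also have "?R = insert r Z" using r by (auto simp: Z_def)
  finally obtain l where pe: "p = smult l ([:- r, 1:] * (\<Prod>z\<in>Z. [:-z, 1:]))"
    using fin by (subst (asm) prod.insert) (auto simp: Z_def simp del: mult_pCons_left)
  let ?M = "\<Prod>z\<in>Z. [:-z, 1:]"
  have l: "l \<noteq> 0" using pe p by auto
  have lin: "pderiv ([:- r, 1:] * P) = P + [:- r, 1:] * pderiv P" for P
    by (simp add: pderiv_mult pderiv_pCons del: mult_pCons_left)
  have "pderiv p = smult l (?M + [:- r, 1:] * pderiv ?M)"
    "pderiv (pderiv p) = smult l (pderiv ?M + pderiv ?M + [:- r, 1:] * pderiv (pderiv ?M))"
    "pderiv (pderiv (pderiv p)) = smult l (pderiv (pderiv ?M) + pderiv (pderiv ?M) + pderiv (pderiv ?M) + [:- r, 1:] * pderiv (pderiv (pderiv ?M)))"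
    unfolding pe pderiv_smult lin pderiv_add by (simp_all only: add_ac)
  then have ev: "poly (pderiv p) r = l * poly ?M r" "poly (pderiv (pderiv p)) r = l * (2 * poly (pderiv ?M) r)"
    "poly (pderiv (pderiv (pderiv p))) r = l * (3 * poly (pderiv (pderiv ?M)) r)"
    by simp_all
  have Z: "finite Z" "r \<notin> Z" using fin by (auto simp: Z_def)
  note P = poly_prod_linear_derivs[OF Z]
  show "poly (pderiv p) r \<noteq> 0" using ev P l by simp
  show "poly (pderiv (pderiv p)) r = 2 * poly (pderiv p) r * sum u Z"
    "poly (pderiv (pderiv (pderiv p))) r = 3 * poly (pderiv p) r * ((sum u Z)\<^sup>2 - (\<Sum>z\<in>Z. (u z)\<^sup>2))"
    unfolding ev P(2,3) u_def by simp_all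
qed

lemma has_field_derivative_slices:
  assumes "(f has_derivative (\<lambda>(h, k). a * h + b * k)) (at (p :: complex, q :: complex))"
  shows "((\<lambda>u. f (u, q)) has_field_derivative a) (at p)" "((\<lambda>v. f (p, v)) has_field_derivative b) (at q)"
proof -
  have "((\<lambda>u. f (u, q)) has_derivative (\<lambda>h. (\<lambda>(h, k). a * h + b * k) (h, 0))) (at p)"
    by (rule has_derivative_compose[of "\<lambda>u. (u, q)" "\<lambda>h. (h, 0)" p UNIV f])
      (use assms in \<open>auto intro!: derivative_eq_intros\<close>)
  then show "((\<lambda>u. f (u, q)) has_field_derivative a) (at p)"
    by (simp add: has_field_derivative_def)
  have "((\<lambda>v. f (p, v)) has_derivative (\<lambda>k. (\<lambda>(h, k). a * h + b * k) (0, k))) (at q)"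
    by (rule has_derivative_compose[of "\<lambda>v. (p, v)" "\<lambda>k. (0, k)" q UNIV f])
      (use assms in \<open>auto intro!: derivative_eq_intros\<close>)
  then show "((\<lambda>v. f (p, v)) has_field_derivative b) (at q)"
    by (simp add: has_field_derivative_def)
qed

lemma open_slices:
  assumes "open V" "(p :: complex, q :: complex) \<in> V"
  obtains e where "e > 0" "\<And>u. u \<in> ball p e \<Longrightarrow> (u, q) \<in> V" "\<And>v. v \<in> ball q e \<Longrightarrow> (p, v) \<in> V"
proof -
  obtain e where "e > 0" "ball (p, q) e \<subseteq> V" using assms open_contains_ball_eq by metis
  then show ?thesis
    by (intro that[of e]) (auto simp: subset_iff dist_Pair_Pair)
qed

lemma has_field_derivative_locally_zero:
  assumes "(f has_field_derivative D) (at x)" "e > 0" "\<And>u. u \<in> ball x e \<Longrightarrow> f u = (0 :: complex)"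
  shows "D = 0"
proof -
  have "((\<lambda>_. 0) has_field_derivative D) (at x)"
    by (rule has_field_derivative_transform_within_open[OF assms(1), of "ball x e"]) (use assms in auto)
  then show ?thesis using DERIV_const DERIV_unique by blast
qed

lemma poly_simple_roots_card:
  fixes p :: "complex poly"
  assumes "p \<noteq> 0" "\<And>z. poly p z = 0 \<Longrightarrow> poly (pderiv p) z \<noteq> 0"
  shows "card {z. poly p z = 0} = degree p"
proof -
  have "rsquarefree p" using assms by (auto simp: rsquarefree_roots)
  then have "degree p = degree (smult (lead_coeff p) (\<Prod>z\<in>{z. poly p z = 0}. [:- z, 1:]))"
    by (simp only: complex_poly_decompose_rsquarefree)
  also have "\<dots> = card {z. poly p z = 0}"
    using assms(1) by (simp add: degree_prod_sum_eq)
  finally show ?thesis by simp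
qed

text \<open>Confines the roots of p + t b for small t: at distance r from the roots of p the
  perturbation is smaller than p, and the degree bound makes this uniform up to infinity.\<close>

lemma poly_bounded_away_from_roots:
  fixes p b :: "complex poly"
  assumes p: "p \<noteq> 0" and deg: "degree b \<le> degree p" and r: "r > 0"
  obtains M where "M > 0"
    "\<And>s. (\<And>c. poly p c = 0 \<Longrightarrow> r \<le> dist c s) \<Longrightarrow> norm (poly b s) \<le> M * norm (poly p s)"
proof -
  obtain root where root: "smult (lead_coeff p) (\<Prod>i<degree p. [:- root i, 1:]) = p"
    using complex_poly_decompose' .
  have rt: "poly p (root i) = 0" if "i < degree p" for i
    by (subst root[symmetric]) (use that in \<open>auto simp: poly_prod\<close>)
  define R where "R = (\<Sum>i<degree p. norm (root i))"
  have R: "norm (root i) \<le> R" if "i < degree p" for i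
    unfolding R_def using that by (intro member_le_sum) auto
  have R0: "R \<ge> 0" by (auto simp: R_def intro: sum_nonneg)
  \<comment> \<open>Chosen such that norm s + 1 is at most C times the distance of s to each root:
    \<open>R\<close> bounds the roots, and R + 1 is at most (R + 1)/r times that distance.\<close>
  define C where "C = 1 + (R + 1) / r"
  have C: "C > 0" using R0 r by (simp add: C_def add_pos_nonneg)
  define B where "B = (\<Sum>i\<le>degree p. norm (coeff b i))"
  have B: "B \<ge> 0" by (auto simp: B_def intro: sum_nonneg)
  let ?l = "norm (lead_coeff p)"
  have l: "?l > 0" using p by simp
  show ?thesis
  proof (rule that[of "(B + 1) * C ^ degree p / ?l"])
    show "(B + 1) * C ^ degree p / ?l > 0" using B C l by simp
    fix s assume s: "\<And>c. poly p c = 0 \<Longrightarrow> r \<le> dist c s"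
    have "norm (poly b s) \<le> (\<Sum>i\<le>degree p. norm (coeff b i) * norm s ^ i)"
    proof -
      have "poly b s = (\<Sum>i\<le>degree p. coeff b i * s ^ i)"
        using deg by (subst poly_altdef, intro sum.mono_neutral_left) (auto simp: coeff_eq_0)
      then show ?thesis by (metis (no_types, lifting) norm_mult norm_power norm_sum sum.cong)
    qed
    also have "\<dots> \<le> (\<Sum>i\<le>degree p. norm (coeff b i) * (norm s + 1) ^ degree p)"
    proof (intro sum_mono mult_left_mono)
      fix i assume "i \<in> {..degree p}"
      have "norm s ^ i \<le> (norm s + 1) ^ i" by (intro power_mono) auto
      also have "\<dots> \<le> (norm s + 1) ^ degree p" using \<open>i \<in> _\<close> by (intro power_increasing) auto
      finally show "norm s ^ i \<le> (norm s + 1) ^ degree p" .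
    qed auto
    also have "\<dots> = B * (norm s + 1) ^ degree p" by (simp add: B_def sum_distrib_right)
    also have "\<dots> \<le> (B + 1) * (norm s + 1) ^ degree p" by (intro mult_right_mono) auto
    also have "(norm s + 1) ^ degree p \<le> (\<Prod>i<degree p. C * norm (s - root i))"
    proof -
      have "norm s + 1 \<le> C * norm (s - root i)" if i: "i < degree p" for i
      proof -
        have d: "r \<le> norm (s - root i)"
          using s[OF rt[OF i]] by (simp add: dist_norm norm_minus_commute)
        have "norm s + 1 \<le> norm (s - root i) + (R + 1)"
          using R[OF i] norm_triangle_sub[of s "root i"] by simp
        also have "R + 1 \<le> (R + 1) / r * norm (s - root i)"
          using d r R0 by (simp add: pos_le_divide_eq mult_left_mono)
        finally show ?thesis by (simp add: C_def algebra_simps)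
      qed
      then have "(\<Prod>i<degree p. norm s + 1) \<le> (\<Prod>i<degree p. C * norm (s - root i))"
        by (intro prod_mono) auto
      then show ?thesis by simp
    qed
    also have "(\<Prod>i<degree p. C * norm (s - root i)) = C ^ degree p * (norm (poly p s) / ?l)"
    proof -
      have "poly p s = lead_coeff p * (\<Prod>i<degree p. s - root i)"
        by (subst root[symmetric]) (simp add: poly_prod)
      then show ?thesis using l by (simp add: prod.distrib norm_mult prod_norm)
    qed
    finally show "norm (poly b s) \<le> (B + 1) * C ^ degree p / ?l * norm (poly p s)"
      using B by (simp add: mult.assoc)
  qed
qed

text \<open>Put \<delta> = (s - c) d/ds. Then (s - c)^2 and (s - c)^3 times the second and third
  derivative are \<delta>(\<delta> - 1) and \<delta>(\<delta> - 1)(\<delta> - 2), and on (s -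
  c)^\<nu> X the operator \<delta> acts as \<nu> + \<delta> on X. What is left after removing (s -
  c)^\<nu> is a polynomial, whose value at c for \<open>cleared1\<close> is \<nu> K(c).\<close>

definition cleared1 :: "complex \<Rightarrow> nat \<Rightarrow> complex poly \<Rightarrow> complex poly" where
  "cleared1 c \<nu> K = smult (of_nat \<nu>) K + [:- c, 1:] * pderiv K"

definition cleared2 :: "complex \<Rightarrow> nat \<Rightarrow> complex poly \<Rightarrow> complex poly" where
  "cleared2 c \<nu> K = smult (of_nat \<nu> - 1) (cleared1 c \<nu> K) + [:- c, 1:] * pderiv (cleared1 c \<nu> K)"

definition cleared3 :: "complex \<Rightarrow> nat \<Rightarrow> complex poly \<Rightarrow> complex poly" where
  "cleared3 c \<nu> K = smult (of_nat \<nu> - 2) (cleared2 c \<nu> K) + [:- c, 1:] * pderiv (cleared2 c \<nu> K)"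

lemma cleared_derivs:
  fixes c :: complex and K :: "complex poly" and \<nu> :: nat
  defines "P \<equiv> [:- c, 1:] ^ \<nu> * K"
  shows "(s - c) * poly (pderiv P) s = (s - c) ^ \<nu> * poly (cleared1 c \<nu> K) s"
    "(s - c)\<^sup>2 * poly (pderiv (pderiv P)) s = (s - c) ^ \<nu> * poly (cleared2 c \<nu> K) s"
    "(s - c) ^ 3 * poly (pderiv (pderiv (pderiv P))) s = (s - c) ^ \<nu> * poly (cleared3 c \<nu> K) s"
proof -
  let ?L = "[:- c, 1:]"
  have dL: "pderiv ?L = 1" by (simp add: pderiv_pCons one_pCons)
  have op: "?L * pderiv (?L ^ \<nu> * X) = ?L ^ \<nu> * (smult (of_nat \<nu>) X + ?L * pderiv X)" for X
  proof (cases \<nu>)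
    case (Suc n)
    show ?thesis
      unfolding Suc pderiv_mult pderiv_power_Suc dL
      by (simp add: algebra_simps del: mult_pCons_left mult_pCons_right)
  qed simp
  have two: "smult 2 X = X + X" for X :: "complex poly"
    by (metis one_add_one smult_1_left smult_add_left)
  have e1: "?L * pderiv P = ?L ^ \<nu> * cleared1 c \<nu> K"
    unfolding P_def cleared1_def by (rule op)
  have "?L * pderiv (?L * pderiv P) = ?L * pderiv P + ?L\<^sup>2 * pderiv (pderiv P)"
    unfolding pderiv_mult dL by (simp add: algebra_simps power2_eq_square del: mult_pCons_left mult_pCons_right)
  then have e2: "?L\<^sup>2 * pderiv (pderiv P) = ?L ^ \<nu> * cleared2 c \<nu> K"
    unfolding e1 op cleared2_def
    by (simp add: algebra_simps smult_diff_left del: mult_pCons_left mult_pCons_right)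
  have "?L * pderiv (?L\<^sup>2 * pderiv (pderiv P)) = ?L\<^sup>2 * pderiv (pderiv P) + ?L\<^sup>2 * pderiv (pderiv P) + ?L ^ 3 * pderiv (pderiv (pderiv P))"
    unfolding power2_eq_square power3_eq_cube pderiv_mult dL
    by (simp only: mult_1_left mult_1_right distrib_left distrib_right mult_ac add_ac)
  then have e3: "?L ^ 3 * pderiv (pderiv (pderiv P)) = ?L ^ \<nu> * cleared3 c \<nu> K"
    unfolding e2 op cleared3_def
    by (simp add: algebra_simps smult_diff_left two del: mult_pCons_left mult_pCons_right)
  show "(s - c) * poly (pderiv P) s = (s - c) ^ \<nu> * poly (cleared1 c \<nu> K) s"
    using arg_cong[OF e1, of "\<lambda>q. poly q s"] unfolding poly_mult poly_power by simp
  show "(s - c)\<^sup>2 * poly (pderiv (pderiv P)) s = (s - c) ^ \<nu> * poly (cleared2 c \<nu> K) s"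
    using arg_cong[OF e2, of "\<lambda>q. poly q s"] unfolding poly_mult poly_power by simp
  show "(s - c) ^ 3 * poly (pderiv (pderiv (pderiv P))) s = (s - c) ^ \<nu> * poly (cleared3 c \<nu> K) s"
    using arg_cong[OF e3, of "\<lambda>q. poly q s"] unfolding poly_mult poly_power by simp
qed

lemma cleared_at:
  "poly (cleared1 c \<nu> K) c = of_nat \<nu> * poly K c"
  "poly (cleared2 c \<nu> K) c = (of_nat \<nu> - 1) * of_nat \<nu> * poly K c"
  "poly (cleared3 c \<nu> K) c = (of_nat \<nu> - 2) * (of_nat \<nu> - 1) * of_nat \<nu> * poly K c"
  "poly (pderiv (cleared1 c \<nu> K)) c = (of_nat \<nu> + 1) * poly (pderiv K) c"
  "poly (pderiv (cleared2 c \<nu> K)) c = of_nat \<nu> * (of_nat \<nu> + 1) * poly (pderiv K) c"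
  "poly (pderiv (cleared3 c \<nu> K)) c = (of_nat \<nu> - 1) * of_nat \<nu> * (of_nat \<nu> + 1) * poly (pderiv K) c"
proof -
  have d: "poly (pderiv (smult a X + [:- c, 1:] * pderiv X)) c = (a + 1) * poly (pderiv X) c" for a X
    by (simp add: pderiv_add pderiv_smult pderiv_mult pderiv_pCons algebra_simps del: mult_pCons_left mult_pCons_right)
  show v: "poly (cleared1 c \<nu> K) c = of_nat \<nu> * poly K c"
    "poly (cleared2 c \<nu> K) c = (of_nat \<nu> - 1) * of_nat \<nu> * poly K c"
    "poly (cleared3 c \<nu> K) c = (of_nat \<nu> - 2) * (of_nat \<nu> - 1) * of_nat \<nu> * poly K c"
    by (simp_all add: cleared1_def cleared2_def cleared3_def)
  show d1: "poly (pderiv (cleared1 c \<nu> K)) c = (of_nat \<nu> + 1) * poly (pderiv K) c"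
    unfolding cleared1_def by (rule d)
  show d2: "poly (pderiv (cleared2 c \<nu> K)) c = of_nat \<nu> * (of_nat \<nu> + 1) * poly (pderiv K) c"
    unfolding cleared2_def d d1 by (simp add: algebra_simps)
  show "poly (pderiv (cleared3 c \<nu> K)) c = (of_nat \<nu> - 1) * of_nat \<nu> * (of_nat \<nu> + 1) * poly (pderiv K) c"
    unfolding cleared3_def d d2 by (simp add: algebra_simps)
qed

subsection \<open>The Legendre web in a chart\<close>

text \<open>A point \<open>s\<close> of the chart stands for the direction \<open>(s, \<kappa> s - 1)\<close>; the number \<open>\<kappa>\<close> is chosen such
  that the fibre of the Gauss map over \<open>p\<^sub>0\<close> lies in the chart. The root \<open>x\<close> of the web equation at
  \<open>(p, q)\<close> belongs to the point \<open>x / (q + (\<kappa> - p) x)\<close>, which depends on \<open>p\<close> only; \<open>\<sigma>0\<close> is the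
  direction of the line.\<close>

locale leg_chart =
  fixes m :: nat and Ah Bh :: "complex poly" and \<kappa> \<sigma>0 p0 :: complex
    and F :: "complex \<times> complex \<Rightarrow> complex \<Rightarrow> complex"
  assumes m2: "m \<ge> 2" and degA: "degree Ah \<le> m" and degB: "degree Bh \<le> m"
    and lead0: "coeff (Ah + smult p0 Bh) m \<noteq> 0"
    and no_common: "\<And>s. poly Ah s = 0 \<Longrightarrow> poly Bh s \<noteq> 0"
    and root0: "poly (Ah + smult p0 Bh) \<sigma>0 = 0"
    and nonfix: "[:0, 1:] * Ah + [:- 1, \<kappa>:] * Bh \<noteq> 0"
    and F_iff: "\<And>p q x. q + (\<kappa> - p) * x \<noteq> 0 \<Longrightarrow> F (p, q) x = 0 \<longleftrightarrow>
        x / (q + (\<kappa> - p) * x) = \<sigma>0 \<or> poly (Ah + smult p Bh) (x / (q + (\<kappa> - p) * x)) = 0"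
    and F_nz: "\<And>p q x. coeff (Ah + smult p Bh) m \<noteq> 0 \<Longrightarrow> q \<noteq> 0 \<Longrightarrow> q + (\<kappa> - p) * x = 0 \<Longrightarrow> F (p, q) x \<noteq> 0"
begin

definition Phi :: "complex \<Rightarrow> complex poly" where "Phi p = Ah + smult p Bh"

definition roots :: "complex \<Rightarrow> complex set" where "roots p = {s. poly (Phi p) s = 0}"

text \<open>The derivative in p of a simple root of \<open>Phi p\<close>, by implicit
  differentiation; the direction of the line stays fixed.\<close>

definition vel :: "complex \<Rightarrow> complex \<Rightarrow> complex" where
  "vel p s = (if s = \<sigma>0 then 0 else - poly Bh s / poly (pderiv (Phi p)) s)"

text \<open>This is p s - (\<kappa> s - 1): it vanishes when the direction of s has slope p, that
  is, when the slope x of the web would be infinite.\<close>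

definition N :: "complex \<Rightarrow> complex \<Rightarrow> complex" where "N p s = 1 + (p - \<kappa>) * s"

definition good :: "complex set" where "good = {p. coeff (Phi p) m \<noteq> 0} - {p0}"

text \<open>The second elementary symmetric function of the quotients N p t/(s - t).\<close>

definition inner :: "complex \<Rightarrow> complex \<Rightarrow> complex" where
  "inner p s = ((\<Sum>t\<in>insert \<sigma>0 (roots p) - {s}. N p t / (s - t))\<^sup>2 -
     (\<Sum>t\<in>insert \<sigma>0 (roots p) - {s}. (N p t / (s - t))\<^sup>2)) / 2"

text \<open>The direction \<sigma>0 is no summand since its velocity is zero, but it occurs inside
  \<open>inner\<close>.\<close>

definition T :: "complex \<Rightarrow> complex" where
  "T p = (\<Sum>s\<in>roots p. vel p s * inner p s)"

lemma poly_Phi: "poly (Phi p) s = poly Ah s + p * poly Bh s"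
  by (simp add: Phi_def)

lemma open_lead: "open {p. coeff (Phi p) m \<noteq> 0}"
proof -
  have "continuous_on UNIV (\<lambda>p. coeff (Phi p) m)"
    by (auto simp: Phi_def intro!: continuous_intros)
  from open_vimage[OF _ this, of "- {0}"] show ?thesis by (auto simp: vimage_def)
qed

lemma open_good: "open good"
  unfolding good_def by (intro open_Diff open_lead) auto

lemma degree_Phi: "coeff (Phi p) m \<noteq> 0 \<Longrightarrow> degree (Phi p) = m"
  using degA degB
  by (intro antisym le_degree) (auto simp: Phi_def intro!: degree_add_le order.trans[OF degree_smult_le])

lemma finite_roots: "coeff (Phi p) m \<noteq> 0 \<Longrightarrow> finite (roots p)"
  unfolding roots_def by (metis coeff_0 poly_roots_finite)

lemma card_roots: "coeff (Phi p) m \<noteq> 0 \<Longrightarrow> card (roots p) \<le> m"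
  unfolding roots_def using card_poly_roots_bound[of "Phi p"] degree_Phi[of p] by auto

lemma Bh_root: "s \<in> roots p \<Longrightarrow> poly Bh s \<noteq> 0"
  using no_common[of s] by (auto simp: roots_def poly_Phi)

lemma roots_disjoint: "s \<in> roots p \<Longrightarrow> s \<in> roots p' \<Longrightarrow> p = p'"
  using Bh_root[of s p] by (simp add: roots_def poly_Phi) (metis add_left_cancel mult_right_cancel)

lemma root0': "\<sigma>0 \<in> roots p0"
  using root0 by (simp add: roots_def Phi_def)

lemma \<sigma>0_not_root: "p \<noteq> p0 \<Longrightarrow> \<sigma>0 \<notin> roots p"
  using root0' roots_disjoint by blast

text \<open>With y = p x - q the denominator is \<kappa> x - y, so (x, y) is the denominator times
  (s, \<kappa> s - 1) for s = \<open>coord w x\<close>.\<close>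

definition coord :: "complex \<times> complex \<Rightarrow> complex \<Rightarrow> complex" where
  "coord w x = x / (snd w + (\<kappa> - fst w) * x)"

lemma coord_zero:
  assumes "F w x = 0" "snd w \<noteq> 0" "coeff (Phi (fst w)) m \<noteq> 0"
  shows "snd w + (\<kappa> - fst w) * x \<noteq> 0" "coord w x \<in> insert \<sigma>0 (roots (fst w))"
    "N (fst w) (coord w x) \<noteq> 0" "x = snd w * coord w x / N (fst w) (coord w x)"
proof -
  show t: "snd w + (\<kappa> - fst w) * x \<noteq> 0"
    using F_nz[of "fst w" "snd w" x] assms by (auto simp: Phi_def)
  show "coord w x \<in> insert \<sigma>0 (roots (fst w))"
    using F_iff[of "snd w" "fst w" x] t assms(1) by (auto simp: coord_def roots_def Phi_def)
  have N: "N (fst w) (coord w x) = snd w / (snd w + (\<kappa> - fst w) * x)"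
    using t by (simp add: N_def coord_def field_simps)
  then show "N (fst w) (coord w x) \<noteq> 0" using t assms by simp
  show "x = snd w * coord w x / N (fst w) (coord w x)"
    unfolding N using t assms by (simp add: coord_def)
qed

text \<open>A count: m + 1 distinct slopes go injectively into a set of at most m + 1 points. Hence
  they fill it, and the fibre has m distinct points.\<close>

lemma web_slopes_coord:
  assumes web: "web_slopes F (Suc m) U \<xi>" and w: "w \<in> U" "snd w \<noteq> 0" "fst w \<in> good"
  shows "inj_on (\<lambda>i. coord w (\<xi> i w)) {..<Suc m}"
    "(\<lambda>i. coord w (\<xi> i w)) ` {..<Suc m} = insert \<sigma>0 (roots (fst w))" "card (roots (fst w)) = m"
proof -
  have lead: "coeff (Phi (fst w)) m \<noteq> 0" using w by (simp add: good_def)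
  have inj: "inj_on (\<lambda>i. \<xi> i w) {..<Suc m}" and Z: "{x. F w x = 0} = (\<lambda>i. \<xi> i w) ` {..<Suc m}"
    using web w by (auto simp: web_slopes_def)
  have F0: "F w (\<xi> i w) = 0" if "i \<in> {..<Suc m}" for i using Z that by auto
  show inj': "inj_on (\<lambda>i. coord w (\<xi> i w)) {..<Suc m}"
    by (rule inj_onI) (metis coord_zero(4) F0 w(2) lead inj_onD[OF inj])
  have sub: "(\<lambda>i. coord w (\<xi> i w)) ` {..<Suc m} \<subseteq> insert \<sigma>0 (roots (fst w))"
    using coord_zero(2)[OF F0 w(2) lead] by blast
  have "Suc m = card ((\<lambda>i. coord w (\<xi> i w)) ` {..<Suc m})"
    using card_image[OF inj'] by simp
  also have "\<dots> \<le> card (insert \<sigma>0 (roots (fst w)))"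
    using sub finite_roots[OF lead] by (intro card_mono) auto
  also have "\<dots> = Suc (card (roots (fst w)))"
    using finite_roots[OF lead] \<sigma>0_not_root w by (subst card_insert_disjoint) (auto simp: good_def)
  finally show card: "card (roots (fst w)) = m"
    using card_roots[OF lead] by simp
  show "(\<lambda>i. coord w (\<xi> i w)) ` {..<Suc m} = insert \<sigma>0 (roots (fst w))"
    using sub finite_roots[OF lead] card_image[OF inj'] card \<sigma>0_not_root w
    by (intro card_subset_eq) (auto simp: good_def)
qed

lemma coord_derivs:
  assumes web: "web_slopes F (Suc m) U \<xi>" and w: "(p, q) \<in> U" "q \<noteq> 0" "p \<in> good" and i: "i < Suc m"
  defines "s \<equiv> coord (p, q) (\<xi> i (p, q))"
  shows "((\<lambda>u. coord (u, q) (\<xi> i (u, q))) has_field_derivative vel p s) (at p)"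
    "((\<lambda>v. coord (p, v) (\<xi> i (p, v))) has_field_derivative 0) (at q)"
    "((\<lambda>u. \<xi> i (u, q)) has_field_derivative q * ((vel p s - s\<^sup>2) / (N p s)\<^sup>2)) (at p)"
    "((\<lambda>v. \<xi> i (p, v)) has_field_derivative s / N p s) (at q)"
proof -
  have lead: "coeff (Phi p) m \<noteq> 0" using w by (simp add: good_def)
  define V where "V = U \<inter> {z. fst z \<in> good \<and> snd z \<noteq> 0}"
  have "open {z :: complex \<times> complex. fst z \<in> good \<and> snd z \<noteq> 0}"
  proof -
    have "{z :: complex \<times> complex. fst z \<in> good \<and> snd z \<noteq> 0} = good \<times> (- {0})" by auto
    moreover have "open (good \<times> (- {0 :: complex}))"
      by (intro open_Times open_good) auto
    ultimately show ?thesis by simp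
  qed
  then have "open V" using web unfolding V_def web_slopes_def by blast
  moreover have "(p, q) \<in> V" using w by (simp add: V_def)
  ultimately obtain e where e: "e > 0" "\<And>u. u \<in> ball p e \<Longrightarrow> (u, q) \<in> V" "\<And>v. v \<in> ball q e \<Longrightarrow> (p, v) \<in> V"
    using open_slices by blast
  have V: "F z (\<xi> i z) = 0" "snd z \<noteq> 0" "coeff (Phi (fst z)) m \<noteq> 0" if "z \<in> V" for z
    using that web i by (auto simp: V_def web_slopes_def good_def)
  have C: "snd z + (\<kappa> - fst z) * \<xi> i z \<noteq> 0" "coord z (\<xi> i z) \<in> insert \<sigma>0 (roots (fst z))"
    "N (fst z) (coord z (\<xi> i z)) \<noteq> 0" "\<xi> i z = snd z * coord z (\<xi> i z) / N (fst z) (coord z (\<xi> i z))"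
    if "z \<in> V" for z
    using coord_zero[OF V[OF that]] by fast+
  have "\<exists>a b. (\<xi> i has_derivative (\<lambda>(h, k). a * h + b * k)) (at (p, q))"
    using web w(1) i unfolding web_slopes_def holomorphic2_on_def by blast
  then obtain a b where "(\<xi> i has_derivative (\<lambda>(h, k). a * h + b * k)) (at (p, q))"
    by blast
  note dxi = has_field_derivative_slices[OF this]
  have t: "q + (\<kappa> - p) * \<xi> i (p, q) \<noteq> 0" using C(1)[OF \<open>(p, q) \<in> V\<close>] by simp
  have "((\<lambda>u. q + (\<kappa> - u) * \<xi> i (u, q)) has_field_derivative (\<kappa> - p) * a - \<xi> i (p, q)) (at p)"
    by (rule derivative_eq_intros dxi refl)+ simp
  from DERIV_divide[OF dxi(1) this t]
  obtain S where S: "((\<lambda>u. coord (u, q) (\<xi> i (u, q))) has_field_derivative S) (at p)"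
    by (auto simp: coord_def)
  have "((\<lambda>v. v + (\<kappa> - p) * \<xi> i (p, v)) has_field_derivative 1 + (\<kappa> - p) * b) (at q)"
    by (rule derivative_eq_intros dxi refl)+ simp
  from DERIV_divide[OF dxi(2) this t]
  obtain R where R: "((\<lambda>v. coord (p, v) (\<xi> i (p, v))) has_field_derivative R) (at q)"
    by (auto simp: coord_def)
  have sm: "s \<in> insert \<sigma>0 (roots p)" using C(2)[OF \<open>(p, q) \<in> V\<close>] by (simp add: s_def)
  have simple: "poly (pderiv (Phi p)) s \<noteq> 0" if "s \<in> roots p"
  proof (rule poly_simple_roots_derivs(1))
    show "card {z. poly (Phi p) z = 0} = degree (Phi p)"
      using web_slopes_coord(3)[OF web w(1)] w degree_Phi[OF lead] by (simp add: roots_def)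
  qed (use that lead in \<open>auto simp: roots_def\<close>)
  \<comment> \<open>It is not known in advance whether a slope stays on the branch of the line or on
    one of the fibre, so the product of both equations is differentiated. As \<sigma>0 is not in the
    fibre over p, exactly one factor vanishes at the point itself.\<close>
  have van: "(coord z (\<xi> i z) - \<sigma>0) * poly (Phi (fst z)) (coord z (\<xi> i z)) = 0" if "z \<in> V" for z
    using C(2)[OF that] by (auto simp: roots_def)
  have dpoly: "(poly P has_field_derivative poly (pderiv P) x) (at x)" for P :: "complex poly" and x
    by (rule poly_DERIV)
  have dP: "((\<lambda>u. poly P (f u)) has_field_derivative poly (pderiv P) (f x) * D) (at x)"
    if "(f has_field_derivative D) (at x)" for P :: "complex poly" and f D x
    using DERIV_chain2[OF poly_DERIV that] .
  have "S * poly (Phi p) s + (s - \<sigma>0) * (poly Bh s + poly (pderiv (Phi p)) s * S) = 0"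
  proof (rule has_field_derivative_locally_zero[OF _ e(1)])
    show "((\<lambda>u. (coord (u, q) (\<xi> i (u, q)) - \<sigma>0) * poly (Phi u) (coord (u, q) (\<xi> i (u, q)))) has_field_derivative
        S * poly (Phi p) s + (s - \<sigma>0) * (poly Bh s + poly (pderiv (Phi p)) s * S)) (at p)"
      unfolding poly_Phi by (rule derivative_eq_intros S dP refl)+
        (simp add: s_def Phi_def pderiv_add pderiv_smult algebra_simps)
    show "(coord (u, q) (\<xi> i (u, q)) - \<sigma>0) * poly (Phi u) (coord (u, q) (\<xi> i (u, q))) = 0" if "u \<in> ball p e" for u
      using van[OF e(2)[OF that]] by simp
  qed
  note Seq = this
  have "p \<noteq> p0" using w by (simp add: good_def)
  have Sv: "S = vel p s"
  proof (cases "s = \<sigma>0")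
    case True
    then show ?thesis
      using Seq \<sigma>0_not_root[OF \<open>p \<noteq> p0\<close>] by (auto simp: vel_def roots_def)
  next
    case False
    then have "s \<in> roots p" using sm by simp
    then have "poly Bh s + poly (pderiv (Phi p)) s * S = 0"
      using Seq False by (simp add: roots_def)
    then have "S * poly (pderiv (Phi p)) s = - poly Bh s"
      by (simp add: eq_neg_iff_add_eq_0 add.commute mult.commute)
    then have "S = - poly Bh s / poly (pderiv (Phi p)) s"
      by (rule eq_divide_imp[OF simple[OF \<open>s \<in> roots p\<close>]])
    then show ?thesis
      using False by (simp add: vel_def)
  qed
  have "R * poly (Phi p) s + (s - \<sigma>0) * (poly (pderiv (Phi p)) s * R) = 0"
  proof (rule has_field_derivative_locally_zero[OF _ e(1)])
    show "((\<lambda>v. (coord (p, v) (\<xi> i (p, v)) - \<sigma>0) * poly (Phi p) (coord (p, v) (\<xi> i (p, v)))) has_field_derivative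
        R * poly (Phi p) s + (s - \<sigma>0) * (poly (pderiv (Phi p)) s * R)) (at q)"
      by (rule derivative_eq_intros R dP refl)+ (simp add: s_def algebra_simps)
    show "(coord (p, v) (\<xi> i (p, v)) - \<sigma>0) * poly (Phi p) (coord (p, v) (\<xi> i (p, v))) = 0" if "v \<in> ball q e" for v
      using van[OF e(3)[OF that]] by simp
  qed
  then have R0: "R = 0"
    using sm simple \<sigma>0_not_root[OF \<open>p \<noteq> p0\<close>] by (auto simp: roots_def)
  show dS: "((\<lambda>u. coord (u, q) (\<xi> i (u, q))) has_field_derivative vel p s) (at p)"
    using S Sv by simp
  show dR: "((\<lambda>v. coord (p, v) (\<xi> i (p, v))) has_field_derivative 0) (at q)"
    using R R0 by simp
  have Nn: "N p s \<noteq> 0" using C(3)[OF \<open>(p, q) \<in> V\<close>] by (simp add: s_def)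
  show "((\<lambda>u. \<xi> i (u, q)) has_field_derivative q * ((vel p s - s\<^sup>2) / (N p s)\<^sup>2)) (at p)"
  proof (rule has_field_derivative_transform_within_open[of _ _ _ "ball p e"])
    show "((\<lambda>u. q * coord (u, q) (\<xi> i (u, q)) / N u (coord (u, q) (\<xi> i (u, q)))) has_field_derivative
        q * ((vel p s - s\<^sup>2) / (N p s)\<^sup>2)) (at p)"
      using Nn unfolding N_def s_def
      by (auto intro!: derivative_eq_intros S[unfolded Sv s_def])
        (simp add: divide_simps power2_eq_square, simp add: algebra_simps)
    show "q * coord (u, q) (\<xi> i (u, q)) / N u (coord (u, q) (\<xi> i (u, q))) = \<xi> i (u, q)" if "u \<in> ball p e" for u
      using C(4)[OF e(2)[OF that]] by simp
  qed (use e in auto)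
  show "((\<lambda>v. \<xi> i (p, v)) has_field_derivative s / N p s) (at q)"
  proof (rule has_field_derivative_transform_within_open[of _ _ _ "ball q e"])
    show "((\<lambda>v. v * coord (p, v) (\<xi> i (p, v)) / N p (coord (p, v) (\<xi> i (p, v)))) has_field_derivative
        s / N p s) (at q)"
      using Nn unfolding N_def s_def
      by (auto intro!: derivative_eq_intros dR[unfolded s_def] simp: power2_eq_square)
    show "v * coord (p, v) (\<xi> i (p, v)) / N p (coord (p, v) (\<xi> i (p, v))) = \<xi> i (p, v)" if "v \<in> ball q e" for v
      using C(4)[OF e(3)[OF that]] by simp
  qed (use e in auto)
qed


section \<open>The connection forms and the curvature of the Legendre web\<close>

lemma sum_web_invariants:
  assumes web: "web_slopes F (Suc m) U \<xi>" and w: "w \<in> U" "snd w \<noteq> 0" "fst w \<in> good"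
  defines "s \<equiv> \<lambda>i. coord w (\<xi> i w)" and "p \<equiv> fst w"
  defines "x \<equiv> \<lambda>i j. N p (s j) / (s i - s j)"
  shows "(\<Sum>(i, j, k)\<in>{(i, j, k). i < j \<and> j < k \<and> k < Suc m}.
      vel p (s i) * (x i j * x i k) + vel p (s j) * (x j k * x j i) + vel p (s k) * (x k i * x k j)) = T p"
proof -
  note S = web_slopes_coord[OF web w, folded s_def p_def]
  have lead: "coeff (Phi p) m \<noteq> 0" "p \<noteq> p0" using w by (auto simp: good_def p_def)
  have re: "(\<Sum>j\<in>{..<Suc m} - {i}. h (s j)) = (\<Sum>t\<in>insert \<sigma>0 (roots p) - {s i}. h t)"
    if "i \<in> {..<Suc m}" for h :: "complex \<Rightarrow> complex" and i
  proof -
    have "s ` ({..<Suc m} - {i}) = insert \<sigma>0 (roots p) - {s i}"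
      using inj_on_image_set_diff[OF S(1), of "{..<Suc m}" "{i}"] S(2) that by auto
    moreover have "inj_on s ({..<Suc m} - {i})" using S(1) by (rule inj_on_diff)
    ultimately show ?thesis by (metis (no_types, lifting) comp_apply sum.cong sum.reindex)
  qed
  have "(\<Sum>(i, j, k)\<in>{(i, j, k). i < j \<and> j < k \<and> k < Suc m}.
      vel p (s i) * (x i j * x i k) + vel p (s j) * (x j k * x j i) + vel p (s k) * (x k i * x k j)) =
    (\<Sum>i<Suc m. vel p (s i) * (((\<Sum>j\<in>{..<Suc m} - {i}. x i j)\<^sup>2 - (\<Sum>j\<in>{..<Suc m} - {i}. (x i j)\<^sup>2)) / 2))"
    by (rule sum_increasing_triples_product)
  also have "\<dots> = (\<Sum>i<Suc m. vel p (s i) * inner p (s i))"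
    unfolding inner_def x_def
    by (intro sum.cong refl) (simp only: re[of _ "\<lambda>t. N p t / (s _ - t)"] re[of _ "\<lambda>t. (N p t / (s _ - t))\<^sup>2"])
  also have "\<dots> = (\<Sum>t\<in>insert \<sigma>0 (roots p). vel p t * inner p t)"
    unfolding S(2)[symmetric] by (subst sum.reindex[OF S(1)]) (simp only: o_def)
  also have "\<dots> = T p"
    using finite_roots[OF lead(1)] \<sigma>0_not_root[OF lead(2)] by (simp add: T_def vel_def)
  finally show ?thesis .
qed

text \<open>The coefficient of dp in eta for the slopes of three points. It involves q only through
  these points, which are locally constant in q, so its derivative along q is zero.\<close>

definition eta_dp :: "complex \<Rightarrow> complex \<Rightarrow> complex \<Rightarrow> complex \<Rightarrow> complex" where
  "eta_dp p s1 s2 s3 = (let w = (\<lambda>s. s / N p s); w' = (\<lambda>s. (vel p s - s\<^sup>2) / (N p s)\<^sup>2) in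
     (w' s3 - w' s2) / (w s3 - w s2) + (w' s1 / ((w s1 - w s2) * (w s1 - w s3)) +
       w' s2 / ((w s2 - w s3) * (w s2 - w s1)) + w' s3 / ((w s3 - w s1) * (w s3 - w s2))) * w s1)"

lemma weta_web:
  assumes web: "web_slopes F (Suc m) U \<xi>" and w: "(p, q) \<in> U" "q \<noteq> 0" "p \<in> good"
    and ijk: "i < j" "j < k" "k < Suc m"
  defines "s \<equiv> \<lambda>i. coord (p, q) (\<xi> i (p, q))"
  defines "x \<equiv> \<lambda>i j. N p (s j) / (s i - s j)"
  shows "weta (slope_form \<xi>) i j k (p, q) = (eta_dp p (s i) (s j) (s k),
      (3 - (vel p (s i) * (x i j * x i k) + vel p (s j) * (x j k * x j i) + vel p (s k) * (x k i * x k j))) / q)"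
proof -
  have lead: "coeff (Phi p) m \<noteq> 0" using w by (auto simp: good_def)
  have F0: "F (p, q) (\<xi> l (p, q)) = 0" if "l < Suc m" for l
    using web w(1) that unfolding web_slopes_def by blast
  have lt: "l < Suc m" if "l \<in> {i, j, k}" for l using that ijk by auto
  have Nn: "N p (s l) \<noteq> 0" and xi: "\<xi> l (p, q) = q * (s l / N p (s l))" if "l \<in> {i, j, k}" for l
    using coord_zero(3,4)[OF F0[OF lt[OF that]]] w lead by (auto simp: s_def)
  have xi3: "\<xi> i (p, q) = q * (s i / N p (s i))" "\<xi> j (p, q) = q * (s j / N p (s j))"
    "\<xi> k (p, q) = q * (s k / N p (s k))"
    by (intro xi; simp)+
  have inj: "inj_on (\<lambda>i. \<xi> i (p, q)) {..<Suc m}"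
    using web w(1) unfolding web_slopes_def by blast
  have "\<xi> i (p, q) \<noteq> \<xi> j (p, q)" "\<xi> j (p, q) \<noteq> \<xi> k (p, q)" "\<xi> k (p, q) \<noteq> \<xi> i (p, q)"
    using inj_onD[OF inj, of i j] inj_onD[OF inj, of j k] inj_onD[OF inj, of k i] ijk by auto
  then have ne: "s i / N p (s i) \<noteq> s j / N p (s j)" "s j / N p (s j) \<noteq> s k / N p (s k)" "s k / N p (s k) \<noteq> s i / N p (s i)"
    unfolding xi3 by metis+
  then have ns: "s i \<noteq> s j" "s j \<noteq> s k" "s k \<noteq> s i" by auto
  note C = coord_derivs[OF web w]
  let ?w = "\<lambda>s. s / N p s" and ?w' = "\<lambda>s. (vel p s - s\<^sup>2) / (N p s)\<^sup>2"
  define f where "f = - (?w' (s i) / ((?w (s i) - ?w (s j)) * (?w (s i) - ?w (s k))) +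
     ?w' (s j) / ((?w (s j) - ?w (s k)) * (?w (s j) - ?w (s i))) +
     ?w' (s k) / ((?w (s k) - ?w (s i)) * (?w (s k) - ?w (s j))))"
  have f: "f = 1 - (vel p (s i) * (x i j * x i k) + vel p (s j) * (x j k * x j i) + vel p (s k) * (x k i * x k j))"
    unfolding f_def x_def N_def by (rule invariant_moebius[OF ns]) (use Nn in \<open>auto simp: N_def\<close>)
  have e: "eta_dp p (s i) (s j) (s k) = (?w' (s k) - ?w' (s j)) / (?w (s k) - ?w (s j)) - f * ?w (s i)"
    unfolding eta_dp_def f_def Let_def by (simp only: mult_minus_left diff_minus_eq_add)
  note eqs = eta_equations_homogeneous[OF ne w(2), where w1' = "?w' (s i)" and w2' = "?w' (s j)" and w3' = "?w' (s k)", folded f_def, folded e]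
  have "weta (slope_form \<xi>) i j k (p, q) = (eta_dp p (s i) (s j) (s k), (2 + f) / q)"
  proof (rule weta_slope_form[where X = "\<lambda>l. q * ?w' (s l)" and Y = "\<lambda>l. ?w (s l)"])
    show "((\<lambda>u. \<xi> l (u, q)) has_field_derivative q * ?w' (s l)) (at p)" if "l \<in> {i, j, k}" for l
      using C(3)[OF lt[OF that]] by (simp add: s_def)
    show "((\<lambda>v. \<xi> l (p, v)) has_field_derivative ?w (s l)) (at q)" if "l \<in> {i, j, k}" for l
      using C(4)[OF lt[OF that]] by (simp add: s_def)
  qed (use ne w(2) in \<open>simp_all only: xi3 eqs mult_cancel_left simp_thms not_False_eq_True\<close>)
  also have "2 + f = 3 - (vel p (s i) * (x i j * x i k) + vel p (s j) * (x j k * x j i) + vel p (s k) * (x k i * x k j))"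
    unfolding f by simp
  finally show ?thesis .
qed

lemma coord_locally_constant:
  assumes web: "web_slopes F (Suc m) U \<xi>" and i: "i < Suc m" and q: "q' \<in> ball q e"
    and e: "\<And>v. v \<in> ball q e \<Longrightarrow> (p, v) \<in> U \<and> v \<noteq> 0" and p: "p \<in> good"
  shows "coord (p, q') (\<xi> i (p, q')) = coord (p, q) (\<xi> i (p, q))"
proof -
  have "\<exists>c. \<forall>v\<in>ball q e. coord (p, v) (\<xi> i (p, v)) = c"
    by (rule has_field_derivative_zero_constant)
      (use coord_derivs(2)[OF web _ _ p i] e in \<open>auto intro: has_field_derivative_at_within\<close>)
  moreover have "q \<in> ball q e" using q by (auto intro: order.strict_trans1[OF zero_le_dist])
  ultimately show ?thesis using q by metis
qed

text \<open>Along q the dp-coefficient of the sum of all eta is constant, and its dq-coefficient is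
  a constant minus T(p), divided by q. Only the derivative of the latter along p survives.\<close>

theorem web_curvature:
  assumes web: "web_slopes F (Suc m) U \<xi>" and w: "(p, q) \<in> U" "q \<noteq> 0" "p \<in> good"
    and T: "T field_differentiable at p"
  shows "curvature (Suc m) (slope_form \<xi>) (p, q) = - deriv T p / q"
proof -
  let ?Tri = "{(i, j, k). i < j \<and> j < k \<and> k < Suc m}"
  let ?\<Theta> = "\<lambda>z. \<Sum>(r, s, t)\<in>?Tri. weta (slope_form \<xi>) r s t z"
  define V where "V = U \<inter> (good \<times> - {0})"
  have "open V"
    using web open_good unfolding V_def web_slopes_def by (auto intro!: open_Int open_Times)
  moreover have "(p, q) \<in> V" using w by (simp add: V_def)
  ultimately obtain e where e: "e > 0" "\<And>u. u \<in> ball p e \<Longrightarrow> (u, q) \<in> V" "\<And>v. v \<in> ball q e \<Longrightarrow> (p, v) \<in> V"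
    using open_slices by blast
  let ?s = "\<lambda>z i. coord z (\<xi> i z)"
  let ?x = "\<lambda>z i j. N (fst z) (?s z j) / (?s z i - ?s z j)"
  have \<Theta>: "?\<Theta> z = (\<Sum>(i, j, k)\<in>?Tri. (eta_dp (fst z) (?s z i) (?s z j) (?s z k),
      (3 - (vel (fst z) (?s z i) * (?x z i j * ?x z i k) + vel (fst z) (?s z j) * (?x z j k * ?x z j i) +
        vel (fst z) (?s z k) * (?x z k i * ?x z k j))) / snd z))" if "z \<in> V" for z
  proof (rule sum.cong[OF refl])
    fix t assume "t \<in> ?Tri"
    then obtain i j k where t: "t = (i, j, k)" "i < j" "j < k" "k < Suc m" by auto
    have z: "(fst z, snd z) \<in> U" "snd z \<noteq> 0" "fst z \<in> good"
      using that by (auto simp: V_def)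
    show "(case t of (r, s, t) \<Rightarrow> weta (slope_form \<xi>) r s t z) = (case t of (i, j, k) \<Rightarrow>
      (eta_dp (fst z) (?s z i) (?s z j) (?s z k),
      (3 - (vel (fst z) (?s z i) * (?x z i j * ?x z i k) + vel (fst z) (?s z j) * (?x z j k * ?x z j i) +
        vel (fst z) (?s z k) * (?x z k i * ?x z k j))) / snd z))"
      using weta_web[OF web z t(2-4)] unfolding t(1) prod.case prod.collapse .
  qed
  have fin: "finite ?Tri"
    by (rule finite_subset[of _ "{..<Suc m} \<times> {..<Suc m} \<times> {..<Suc m}"]) auto
  have fst\<Theta>: "fst (?\<Theta> z) = (\<Sum>(i, j, k)\<in>?Tri. eta_dp (fst z) (?s z i) (?s z j) (?s z k))" if "z \<in> V" for z
    unfolding \<Theta>[OF that] fst_sum by (rule sum.cong) auto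
  have snd\<Theta>: "snd (?\<Theta> z) = (3 * of_nat (card ?Tri) - T (fst z)) / snd z" if "z \<in> V" for z
  proof -
    have "snd (?\<Theta> z) = (\<Sum>(i, j, k)\<in>?Tri. (3 - (vel (fst z) (?s z i) * (?x z i j * ?x z i k) +
        vel (fst z) (?s z j) * (?x z j k * ?x z j i) + vel (fst z) (?s z k) * (?x z k i * ?x z k j))) / snd z)"
      unfolding \<Theta>[OF that] snd_sum by (rule sum.cong) auto
    also have "\<dots> = (3 * of_nat (card ?Tri) - (\<Sum>(i, j, k)\<in>?Tri. (vel (fst z) (?s z i) * (?x z i j * ?x z i k) +
        vel (fst z) (?s z j) * (?x z j k * ?x z j i) + vel (fst z) (?s z k) * (?x z k i * ?x z k j)))) / snd z"
      unfolding case_prod_unfold by (simp only: sum_divide_distrib[symmetric] sum_subtractf sum_constant mult.commute)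
    also have "\<dots> = (3 * of_nat (card ?Tri) - T (fst z)) / snd z"
      using sum_web_invariants[OF web, of z] that by (simp only: V_def) auto
    finally show ?thesis .
  qed
  have "deriv (\<lambda>u. snd (?\<Theta> (u, q))) p = - deriv T p / q"
  proof (rule DERIV_imp_deriv, rule has_field_derivative_transform_within_open[of _ _ _ "ball p e"])
    show "((\<lambda>u. (3 * of_nat (card ?Tri) - T u) / q) has_field_derivative - deriv T p / q) (at p)"
      using T by (auto intro!: derivative_eq_intros simp: field_differentiable_derivI w(2))
    show "(3 * of_nat (card ?Tri) - T u) / q = snd (?\<Theta> (u, q))" if "u \<in> ball p e" for u
      using snd\<Theta>[OF e(2)[OF that]] by simp
  qed (use e in auto)
  moreover have "deriv (\<lambda>v. fst (?\<Theta> (p, v))) q = 0"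
  proof (rule DERIV_imp_deriv, rule has_field_derivative_transform_within_open[of _ _ _ "ball q e"])
    show "((\<lambda>v. fst (?\<Theta> (p, q))) has_field_derivative 0) (at q)" by simp
    show "fst (?\<Theta> (p, q)) = fst (?\<Theta> (p, v))" if v: "v \<in> ball q e" for v
    proof -
      have "?s (p, v) i = ?s (p, q) i" if "i < Suc m" for i
        by (rule coord_locally_constant[OF web that v _ w(3)]) (use e(3) in \<open>auto simp: V_def\<close>)
      then show ?thesis
        unfolding fst\<Theta>[OF e(3)[OF v]] fst\<Theta>[OF \<open>(p, q) \<in> V\<close>] by (intro sum.cong refl) auto
    qed
  qed (use e in auto)
  ultimately show ?thesis
    by (simp add: curvature_def ext_d_def)
qed

section \<open>The Gauss map in the chart and its multiplicities over p0\<close>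

definition G :: "complex \<Rightarrow> complex" where "G s = - poly Ah s / poly Bh s"

definition wronskian :: "complex poly" where "wronskian = pderiv Ah * Bh - Ah * pderiv Bh"

definition mult :: "complex \<Rightarrow> nat" where "mult c = order c (Phi p0)"

definition cofac :: "complex \<Rightarrow> complex poly" where "cofac c = Phi p0 div [:- c, 1:] ^ mult c"

lemma lead_Phi_p0: "coeff (Phi p0) m \<noteq> 0"
  using lead0 by (simp add: Phi_def)

lemma Phi_nonzero: "Phi p \<noteq> 0"
proof
  assume "Phi p = 0"
  then have "\<sigma>0 \<in> roots p" by (simp add: roots_def)
  then have "p = p0" using root0' roots_disjoint by blast
  then show False using \<open>Phi p = 0\<close> lead_Phi_p0 by simp
qed

lemma roots_iff: "s \<in> roots p \<longleftrightarrow> poly Bh s \<noteq> 0 \<and> G s = p"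
proof
  assume s: "s \<in> roots p"
  then show "poly Bh s \<noteq> 0 \<and> G s = p"
    using Bh_root[OF s] by (simp add: roots_def poly_Phi G_def field_simps add_eq_0_iff)
next
  assume "poly Bh s \<noteq> 0 \<and> G s = p"
  then have "poly Bh s \<noteq> 0" "p * poly Bh s = - poly Ah s" by (auto simp: G_def)
  then show "s \<in> roots p" by (simp add: roots_def poly_Phi)
qed

lemma Phi_factor: "Phi p0 = [:- c, 1:] ^ mult c * cofac c" and poly_cofac: "poly (cofac c) c \<noteq> 0"
proof -
  obtain q where q: "Phi p0 = [:- c, 1:] ^ order c (Phi p0) * q" "\<not> [:- c, 1:] dvd q"
    using order_decomp[OF Phi_nonzero] by blast
  have "cofac c = q"
    unfolding cofac_def mult_def by (subst q(1)) simp
  then show "Phi p0 = [:- c, 1:] ^ mult c * cofac c" "poly (cofac c) c \<noteq> 0"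
    using q by (simp_all add: mult_def poly_eq_0_iff_dvd)
qed

lemma mult_cofac_unique:
  assumes "Phi p0 = [:- c, 1:] ^ k * K" "poly K c \<noteq> 0"
  shows "mult c = k" "cofac c = K"
proof -
  have "order c (Phi p0) = k"
    unfolding assms(1)
    using assms(2) by (subst order_mult) (auto simp: order_power_n_n order_root[of K] simp del: mult_pCons_left)
  then show "mult c = k" by (simp add: mult_def)
  then show "cofac c = K" by (simp add: cofac_def assms(1))
qed

lemma mult_pos: "c \<in> roots p0 \<Longrightarrow> mult c > 0"
  using Phi_nonzero by (auto simp: mult_def roots_def order_root)

lemma wronskian_Phi: "poly wronskian s = poly (pderiv (Phi p)) s * poly Bh s - poly (Phi p) s * poly (pderiv Bh) s"
  by (simp add: wronskian_def Phi_def pderiv_add pderiv_smult algebra_simps)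

lemma G_deriv:
  assumes "poly Bh s \<noteq> 0"
  shows "(G has_field_derivative - poly wronskian s / (poly Bh s)\<^sup>2) (at s)"
  unfolding G_def using assms
  by (auto intro!: derivative_eq_intros poly_DERIV simp: wronskian_def power2_eq_square field_simps)

text \<open>A zero Wronskian would equate the logarithmic derivatives of \<open>Phi p0\<close> and
  \<open>Bh\<close>. At \<sigma>0 the first has a pole with the multiplicity as residue, the second
  is regular.\<close>

lemma wronskian_nonzero: "wronskian \<noteq> 0"
proof
  assume "wronskian = 0"
  then have 0: "poly (pderiv (Phi p0)) s * poly Bh s - poly (Phi p0) s * poly (pderiv Bh) s = 0" for s
    using wronskian_Phi[of s p0] by simp
  let ?\<nu> = "mult \<sigma>0" and ?K = "cofac \<sigma>0"
  note D = cleared_derivs(1)[of _ \<sigma>0 ?\<nu> ?K, folded Phi_factor]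
  have "(s - \<sigma>0) ^ ?\<nu> * poly (cleared1 \<sigma>0 ?\<nu> ?K * Bh - [:- \<sigma>0, 1:] * ?K * pderiv Bh) s = 0" for s
  proof -
    have "(s - \<sigma>0) ^ ?\<nu> * poly (cleared1 \<sigma>0 ?\<nu> ?K * Bh - [:- \<sigma>0, 1:] * ?K * pderiv Bh) s =
      ((s - \<sigma>0) ^ ?\<nu> * poly (cleared1 \<sigma>0 ?\<nu> ?K) s) * poly Bh s
        - (s - \<sigma>0) * ((s - \<sigma>0) ^ ?\<nu> * poly ?K s) * poly (pderiv Bh) s"
      by (simp add: algebra_simps)
    also have "(s - \<sigma>0) ^ ?\<nu> * poly ?K s = poly (Phi p0) s"
      by (subst Phi_factor[of \<sigma>0]) simp
    also have "(s - \<sigma>0) ^ ?\<nu> * poly (cleared1 \<sigma>0 ?\<nu> ?K) s * poly Bh s - (s - \<sigma>0) * poly (Phi p0) s * poly (pderiv Bh) s =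
       (s - \<sigma>0) * (poly (pderiv (Phi p0)) s * poly Bh s - poly (Phi p0) s * poly (pderiv Bh) s)"
      unfolding D[symmetric] by (simp add: algebra_simps)
    finally show ?thesis using 0 by simp
  qed
  then have "poly ([:- \<sigma>0, 1:] ^ ?\<nu> * (cleared1 \<sigma>0 ?\<nu> ?K * Bh - [:- \<sigma>0, 1:] * ?K * pderiv Bh)) s = 0" for s
    by (simp add: poly_mult poly_power del: poly_diff mult_pCons_left)
  then have "[:- \<sigma>0, 1:] ^ ?\<nu> * (cleared1 \<sigma>0 ?\<nu> ?K * Bh - [:- \<sigma>0, 1:] * ?K * pderiv Bh) = 0"
    using poly_all_0_iff_0 by blast
  then have "cleared1 \<sigma>0 ?\<nu> ?K * Bh - [:- \<sigma>0, 1:] * ?K * pderiv Bh = 0"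
    by (simp del: mult_pCons_left)
  then have "poly (cleared1 \<sigma>0 ?\<nu> ?K * Bh - [:- \<sigma>0, 1:] * ?K * pderiv Bh) \<sigma>0 = 0"
    by simp
  then show False
    using mult_pos[OF root0'] poly_cofac[of \<sigma>0] Bh_root[OF root0'] by (simp add: cleared_at)
qed

text \<open>Since N p t = N p s - n (s - t), each quotient N p t/(s - t) is affine in 1/(s - t). The
  sums thus reduce to power sums over the fibre, hence to the Taylor data of \<open>Phi p\<close> at
  s, with \<open>v\<close> as the additional summand of \<sigma>0.\<close>

lemma inner_eq:
  assumes p: "p \<in> good" and card: "card (roots p) = m" and s: "s \<in> roots p"
  defines "n \<equiv> p - \<kappa>"
  defines "d1 \<equiv> poly (pderiv (Phi p)) s" and "d2 \<equiv> poly (pderiv (pderiv (Phi p))) s"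
    and "d3 \<equiv> poly (pderiv (pderiv (pderiv (Phi p)))) s" and "v \<equiv> 1 / (s - \<sigma>0)"
  shows "d1 \<noteq> 0" "inner p s = of_nat m * (of_nat m - 1) / 2 * n\<^sup>2 - (of_nat m - 1) * n * N p s * (d2 / (2 * d1) + v) +
      (N p s)\<^sup>2 * (d3 / (6 * d1) + d2 / (2 * d1) * v)"
proof -
  have lead: "coeff (Phi p) m \<noteq> 0" and pp0: "p \<noteq> p0" using p by (auto simp: good_def)
  have s\<sigma>: "s \<noteq> \<sigma>0" using s \<sigma>0_not_root[OF pp0] by auto
  let ?Z = "roots p - {s}"
  let ?u = "\<lambda>t. 1 / (s - t)"
  have cd: "card {z. poly (Phi p) z = 0} = degree (Phi p)"
    using card degree_Phi[OF lead] by (simp add: roots_def)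
  have s0: "poly (Phi p) s = 0" using s by (simp add: roots_def)
  note R = poly_simple_roots_derivs[OF cd Phi_nonzero s0, folded roots_def d1_def d2_def d3_def]
  show d1: "d1 \<noteq> 0" by (rule R(1))
  define U1 where "U1 = sum ?u ?Z"
  define U2 where "U2 = (\<Sum>t\<in>?Z. (?u t)\<^sup>2)"
  have e1: "d2 / (2 * d1) = U1" and e2: "d3 / (6 * d1) = (U1\<^sup>2 - U2) / 2"
    using R d1 by (simp_all add: U1_def U2_def)
  have fin: "finite ?Z" using finite_roots[OF lead] by simp
  have O: "insert \<sigma>0 (roots p) - {s} = insert \<sigma>0 ?Z" using s\<sigma> by auto
  have nin: "\<sigma>0 \<notin> ?Z" using \<sigma>0_not_root[OF pp0] by auto
  have cZ: "of_nat (card ?Z) = (of_nat m - 1 :: complex)"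
    using card s finite_roots[OF lead] m2 by (simp add: of_nat_diff)
  have x: "N p t / (s - t) = N p s * ?u t - n" if "t \<noteq> s" for t
    using that by (simp add: N_def n_def divide_simps) (simp add: algebra_simps)
  have S1: "(\<Sum>t\<in>insert \<sigma>0 ?Z. N p t / (s - t)) = N p s * (v + U1) - of_nat m * n"
  proof -
    have "(\<Sum>t\<in>insert \<sigma>0 ?Z. N p t / (s - t)) = (\<Sum>t\<in>insert \<sigma>0 ?Z. N p s * ?u t - n)"
      using s\<sigma> by (intro sum.cong refl x) auto
    also have "\<dots> = N p s * (\<Sum>t\<in>insert \<sigma>0 ?Z. ?u t) - of_nat (card (insert \<sigma>0 ?Z)) * n"
      by (simp only: sum_subtractf sum_distrib_left sum_constant)
    also have "(\<Sum>t\<in>insert \<sigma>0 ?Z. ?u t) = v + U1"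
      using fin nin by (simp add: U1_def v_def)
    also have "of_nat (card (insert \<sigma>0 ?Z)) = (of_nat m :: complex)"
      using fin nin cZ by simp
    finally show ?thesis .
  qed
  have S2: "(\<Sum>t\<in>insert \<sigma>0 ?Z. (N p t / (s - t))\<^sup>2) =
      (N p s)\<^sup>2 * (v\<^sup>2 + U2) - 2 * n * N p s * (v + U1) + of_nat m * n\<^sup>2"
  proof -
    have "(\<Sum>t\<in>insert \<sigma>0 ?Z. (N p t / (s - t))\<^sup>2) = (\<Sum>t\<in>insert \<sigma>0 ?Z. (N p s * ?u t - n)\<^sup>2)"
      using s\<sigma> by (intro sum.cong refl) (subst x, auto)
    also have "\<dots> = (\<Sum>t\<in>insert \<sigma>0 ?Z. (N p s)\<^sup>2 * (?u t)\<^sup>2 - 2 * n * N p s * ?u t + n\<^sup>2)"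
      by (intro sum.cong refl) algebra
    also have "\<dots> = (N p s)\<^sup>2 * (\<Sum>t\<in>insert \<sigma>0 ?Z. (?u t)\<^sup>2) - 2 * n * N p s * (\<Sum>t\<in>insert \<sigma>0 ?Z. ?u t)
        + of_nat (card (insert \<sigma>0 ?Z)) * n\<^sup>2"
      by (simp only: sum.distrib sum_subtractf sum_distrib_left sum_constant)
    also have "(\<Sum>t\<in>insert \<sigma>0 ?Z. (?u t)\<^sup>2) = v\<^sup>2 + U2"
      using fin nin by (simp add: U2_def v_def)
    also have "(\<Sum>t\<in>insert \<sigma>0 ?Z. ?u t) = v + U1"
      using fin nin by (simp add: U1_def v_def)
    also have "of_nat (card (insert \<sigma>0 ?Z)) = (of_nat m :: complex)"
      using fin nin cZ by simp
    finally show ?thesis .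
  qed
  show "inner p s = of_nat m * (of_nat m - 1) / 2 * n\<^sup>2 - (of_nat m - 1) * n * N p s * (d2 / (2 * d1) + v) +
      (N p s)\<^sup>2 * (d3 / (6 * d1) + d2 / (2 * d1) * v)"
    unfolding inner_def O S1 S2 e1 e2 by (simp add: field_simps power2_eq_square)
qed

text \<open>Regular substitutes for the derivatives of \<open>Phi (G s)\<close> at s:
  \<open>E1\<close>, \<open>E2\<close>, \<open>E3\<close> are these derivatives times (s - c), (s -
  c)^2, (s - c)^3, divided by (s - c)^\<nu>. The subtracted term comes from G s - p0, which is -(s -
  c)^\<nu> times \<open>cofac c\<close> over \<open>Bh\<close>.\<close>

definition E1 :: "complex \<Rightarrow> complex \<Rightarrow> complex" where
  "E1 c s = poly (cleared1 c (mult c) (cofac c)) s - (s - c) * poly (cofac c) s * poly (pderiv Bh) s / poly Bh s"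

definition E2 :: "complex \<Rightarrow> complex \<Rightarrow> complex" where
  "E2 c s = poly (cleared2 c (mult c) (cofac c)) s - (s - c)\<^sup>2 * poly (cofac c) s * poly (pderiv (pderiv Bh)) s / poly Bh s"

definition E3 :: "complex \<Rightarrow> complex \<Rightarrow> complex" where
  "E3 c s = poly (cleared3 c (mult c) (cofac c)) s
     - (s - c) ^ 3 * poly (cofac c) s * poly (pderiv (pderiv (pderiv Bh))) s / poly Bh s"

text \<open>Makes 1/(s - \<sigma>0) equal to \<open>theta c s\<close> / (s - c). For c = \<sigma>0
  the constant is set by hand, since the quotient 0/0 would evaluate to 0 at the centre.\<close>

definition theta :: "complex \<Rightarrow> complex \<Rightarrow> complex" where
  "theta c s = (if c = \<sigma>0 then 1 else (s - c) / (s - \<sigma>0))"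

text \<open>The numerator of \<open>inner\<close> over \<open>(s - c)\<^sup>2\<close>, with \<open>p\<close> eliminated by \<open>p = G s\<close>: a holomorphic function
  of \<open>s\<close> near the point \<open>c\<close> of the fibre.\<close>

definition H :: "complex \<Rightarrow> complex \<Rightarrow> complex" where
  "H c s = of_nat m * (of_nat m - 1) / 2 * (G s - \<kappa>)\<^sup>2 * (s - c)\<^sup>2
     - (of_nat m - 1) * (G s - \<kappa>) * N (G s) s * (s - c) * (E2 c s / (2 * E1 c s) + theta c s)
     + (N (G s) s)\<^sup>2 * (E3 c s / (6 * E1 c s) + E2 c s / (2 * E1 c s) * theta c s)"

lemma E_derivs:
  assumes B: "poly Bh s \<noteq> 0"
  shows "(s - c) * poly (pderiv (Phi (G s))) s = (s - c) ^ mult c * E1 c s"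
    "(s - c)\<^sup>2 * poly (pderiv (pderiv (Phi (G s)))) s = (s - c) ^ mult c * E2 c s"
    "(s - c) ^ 3 * poly (pderiv (pderiv (pderiv (Phi (G s))))) s = (s - c) ^ mult c * E3 c s"
proof -
  have "poly (Phi (G s)) s = 0" using roots_iff[of s "G s"] B by (simp add: roots_def)
  then have "poly (Phi p0) s = - (G s - p0) * poly Bh s"
    by (simp add: poly_Phi algebra_simps add_eq_0_iff)
  moreover have "poly (Phi p0) s = (s - c) ^ mult c * poly (cofac c) s"
    by (subst Phi_factor[of c]) simp
  ultimately have q: "G s - p0 = - ((s - c) ^ mult c * poly (cofac c) s / poly Bh s)"
    using B by (simp add: field_simps)
  have P: "Phi (G s) = Phi p0 + smult (G s - p0) Bh"
    by (simp add: Phi_def smult_diff_left)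
  note D = cleared_derivs[of s c "mult c" "cofac c", folded Phi_factor]
  show "(s - c) * poly (pderiv (Phi (G s))) s = (s - c) ^ mult c * E1 c s"
    "(s - c)\<^sup>2 * poly (pderiv (pderiv (Phi (G s)))) s = (s - c) ^ mult c * E2 c s"
    "(s - c) ^ 3 * poly (pderiv (pderiv (pderiv (Phi (G s))))) s = (s - c) ^ mult c * E3 c s"
    unfolding P pderiv_add pderiv_smult poly_add poly_smult distrib_left D q E1_def E2_def E3_def
    by (simp_all add: algebra_simps)
qed

lemma E1_nonzero:
  assumes "poly Bh s \<noteq> 0" "poly wronskian s \<noteq> 0" "s \<noteq> c"
  shows "E1 c s \<noteq> 0"
proof -
  have "poly (Phi (G s)) s = 0" using roots_iff[of s "G s"] assms by (simp add: roots_def)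
  then have "poly (pderiv (Phi (G s))) s \<noteq> 0" using wronskian_Phi[of s "G s"] assms by auto
  then show ?thesis using E_derivs(1)[OF assms(1), of c] assms(3) by auto
qed

lemma inner_eq_H:
  assumes p: "p \<in> good" and card: "card (roots p) = m" and s: "s \<in> roots p" "s \<noteq> c"
  shows "inner p s = H c s / (s - c)\<^sup>2"
proof -
  have B: "poly Bh s \<noteq> 0" and G: "G s = p" using roots_iff s by auto
  note I = inner_eq[OF p card s(1)]
  note E = E_derivs[OF B, of c, unfolded G]
  let ?u = "s - c" and ?d1 = "poly (pderiv (Phi p)) s" and ?d2 = "poly (pderiv (pderiv (Phi p))) s"
    and ?d3 = "poly (pderiv (pderiv (pderiv (Phi p)))) s"
  have clear: "a - b * (x / u + t / u) + k * (y / u\<^sup>2 + x / u * (t / u)) =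
      (a * u\<^sup>2 - b * u * (x + t) + k * (y + x * t)) / u\<^sup>2" if "u \<noteq> 0" for a b k x y t u :: complex
    using that by (simp add: field_simps power2_eq_square)
  have u: "?u \<noteq> 0" and uk: "?u ^ mult c \<noteq> 0" using s by auto
  have E1: "E1 c s \<noteq> 0" using E(1) I(1) u by auto
  have d: "?d1 = ?u ^ mult c * E1 c s / ?u" "?d2 = ?u ^ mult c * E2 c s / ?u\<^sup>2" "?d3 = ?u ^ mult c * E3 c s / ?u ^ 3"
    using E u by (simp_all add: eq_divide_eq mult.commute)
  have r2: "?d2 / (2 * ?d1) = E2 c s / (2 * E1 c s) / ?u" and r3: "?d3 / (6 * ?d1) = E3 c s / (6 * E1 c s) / ?u\<^sup>2"
    unfolding d using u uk E1 by (simp_all add: divide_simps power2_eq_square power3_eq_cube)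
  have "s \<noteq> \<sigma>0" using s \<sigma>0_not_root[of p] p by (auto simp: good_def)
  then have th: "1 / (s - \<sigma>0) = theta c s / ?u"
    using u by (auto simp: theta_def)
  show ?thesis
    unfolding I(2) r2 r3 th H_def G by (rule clear[OF u])
qed

text \<open>Division by G' is what a sum over the fibre needs to be the trace of a 1-form under p =
  G(s).\<close>

lemma vel_eq:
  assumes "s \<in> roots p" "p \<noteq> p0" "poly (pderiv (Phi p)) s \<noteq> 0"
  shows "vel p s = 1 / deriv G s"
proof -
  have B: "poly Bh s \<noteq> 0" using roots_iff assms by auto
  have "s \<noteq> \<sigma>0" using \<sigma>0_not_root assms by auto
  moreover have "poly wronskian s = poly (pderiv (Phi p)) s * poly Bh s"
    using wronskian_Phi[of s p] assms(1) by (simp add: roots_def)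
  ultimately show ?thesis
    using DERIV_imp_deriv[OF G_deriv[OF B]] B assms(3) by (simp add: vel_def power2_eq_square)
qed

subsection \<open>The residue at the critical value\<close>

lemma deriv_G_zero:
  assumes "c \<in> roots p0" "mult c \<ge> 2"
  shows "deriv G c = 0"
proof -
  have B: "poly Bh c \<noteq> 0" using roots_iff assms(1) by blast
  obtain n where n: "mult c = Suc (Suc n)" using assms(2) by (metis Suc_le_D numeral_2_eq_2 Suc_le_mono)
  have "poly (pderiv (Phi p0)) c = 0"
    by (subst Phi_factor[of c]) (simp add: n pderiv_mult del: mult_pCons_left mult_pCons_right)
  then have "poly wronskian c = 0"
    using wronskian_Phi[of c p0] assms(1) by (simp add: roots_def)
  then show ?thesis using DERIV_imp_deriv[OF G_deriv[OF B]] by simp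
qed

lemma E1_at: "c \<in> roots p0 \<Longrightarrow> E1 c c \<noteq> 0"
  using mult_pos[of c] poly_cofac[of c] by (simp add: E1_def cleared_at)

text \<open>The second and third derivatives of \<open>Bh\<close> carry the factors (s - c)^2 and (s
  - c)^3 and do not reach first order. So the logarithmic derivatives k of the cofactor and b of
  \<open>Bh\<close> suffice.\<close>

lemma ratio_derivs:
  assumes c: "c \<in> roots p0"
  defines "\<nu> \<equiv> of_nat (mult c) :: complex" and "k \<equiv> poly (pderiv (cofac c)) c / poly (cofac c) c"
    and "b \<equiv> poly (pderiv Bh) c / poly Bh c"
  shows "E2 c c / (2 * E1 c c) = (\<nu> - 1) / 2" "E3 c c / (6 * E1 c c) = (\<nu> - 1) * (\<nu> - 2) / 6"
    and "((\<lambda>s. E2 c s / (2 * E1 c s)) has_field_derivative ((\<nu> + 1) * k + (\<nu> - 1) * b) / (2 * \<nu>)) (at c)"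
    and "((\<lambda>s. E3 c s / (6 * E1 c s)) has_field_derivative
        (\<nu> - 1) * (2 * (\<nu> + 1) * k + (\<nu> - 2) * b) / (6 * \<nu>)) (at c)"
proof -
  have B: "poly Bh c \<noteq> 0" using roots_iff c by blast
  have \<nu>: "\<nu> \<noteq> 0" using mult_pos[OF c] by (simp add: \<nu>_def)
  let ?K = "poly (cofac c) c"
  have K: "?K \<noteq> 0" by (rule poly_cofac)
  have K': "poly (pderiv (cofac c)) c = k * ?K" using K by (simp add: k_def)
  have v: "E1 c c = \<nu> * ?K" "E2 c c = (\<nu> - 1) * \<nu> * ?K" "E3 c c = (\<nu> - 2) * (\<nu> - 1) * \<nu> * ?K"
    by (simp_all add: E1_def E2_def E3_def cleared_at \<nu>_def)
  show "E2 c c / (2 * E1 c c) = (\<nu> - 1) / 2" "E3 c c / (6 * E1 c c) = (\<nu> - 1) * (\<nu> - 2) / 6"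
    using \<nu> K by (simp_all add: v)
  have d1: "(E1 c has_field_derivative ((\<nu> + 1) * k - b) * ?K) (at c)"
    unfolding E1_def using B
    by (auto intro!: derivative_eq_intros poly_DERIV simp: cleared_at K' \<nu>_def[symmetric] b_def)
      (simp add: field_simps)
  have d2: "(E2 c has_field_derivative \<nu> * (\<nu> + 1) * k * ?K) (at c)"
    unfolding E2_def using B
    by (auto intro!: derivative_eq_intros poly_DERIV simp: cleared_at K' \<nu>_def[symmetric])
  have d3: "(E3 c has_field_derivative (\<nu> - 1) * \<nu> * (\<nu> + 1) * k * ?K) (at c)"
    unfolding E3_def using B
    by (auto intro!: derivative_eq_intros poly_DERIV simp: cleared_at K' \<nu>_def[symmetric])
  have q: "((\<lambda>s. f s / (a * E1 c s)) has_field_derivative (f' * \<nu> - f c * ((\<nu> + 1) * k - b)) / (a * \<nu>\<^sup>2 * ?K)) (at c)"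
    if "(f has_field_derivative f') (at c)" "a \<noteq> 0" for f f' a
  proof -
    have "((\<lambda>s. f s / (a * E1 c s)) has_field_derivative
        (f' * (a * E1 c c) - f c * (a * (((\<nu> + 1) * k - b) * ?K))) / ((a * E1 c c) * (a * E1 c c))) (at c)"
      using that \<nu> K by (intro DERIV_divide DERIV_cmult d1) (auto simp: v)
    moreover have "(f' * (a * E1 c c) - f c * (a * (((\<nu> + 1) * k - b) * ?K))) / ((a * E1 c c) * (a * E1 c c)) =
        (a * ?K * (f' * \<nu> - f c * ((\<nu> + 1) * k - b))) / (a * ?K * (a * \<nu>\<^sup>2 * ?K))"
      by (simp add: v algebra_simps power2_eq_square)
    ultimately show ?thesis using that(2) K by simp
  qed
  have "(\<nu> * (\<nu> + 1) * k * ?K * \<nu> - E2 c c * ((\<nu> + 1) * k - b)) / (2 * \<nu>\<^sup>2 * ?K) =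
     (\<nu> * ?K * ((\<nu> + 1) * k + (\<nu> - 1) * b)) / (\<nu> * ?K * (2 * \<nu>))"
    by (simp add: v algebra_simps power2_eq_square)
  then show "((\<lambda>s. E2 c s / (2 * E1 c s)) has_field_derivative ((\<nu> + 1) * k + (\<nu> - 1) * b) / (2 * \<nu>)) (at c)"
    using q[OF d2, of 2] \<nu> K by simp
  have "((\<nu> - 1) * \<nu> * (\<nu> + 1) * k * ?K * \<nu> - E3 c c * ((\<nu> + 1) * k - b)) / (6 * \<nu>\<^sup>2 * ?K) =
     (\<nu> * ?K * ((\<nu> - 1) * (2 * (\<nu> + 1) * k + (\<nu> - 2) * b))) / (\<nu> * ?K * (6 * \<nu>))"
    by (simp add: v algebra_simps power2_eq_square)
  then show "((\<lambda>s. E3 c s / (6 * E1 c s)) has_field_derivative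
        (\<nu> - 1) * (2 * (\<nu> + 1) * k + (\<nu> - 2) * b) / (6 * \<nu>)) (at c)"
    using q[OF d3, of 6] \<nu> K by simp
qed

lemma theta_at: "theta c c = (if c = \<sigma>0 then 1 else 0)"
  by (simp add: theta_def)

lemma theta_deriv:
  "(theta c has_field_derivative (if c = \<sigma>0 then 0 else 1 / (c - \<sigma>0))) (at c)"
proof (cases "c = \<sigma>0")
  case False
  have "((\<lambda>s. (s - c) / (s - \<sigma>0)) has_field_derivative 1 / (c - \<sigma>0)) (at c)"
    using False by (auto intro!: derivative_eq_intros)
  then show ?thesis using False by (simp add: theta_def[abs_def])
qed (simp add: theta_def[abs_def])

lemma H_deriv:
  assumes c: "c \<in> roots p0"
  defines "\<nu> \<equiv> of_nat (mult c) :: complex" and "k \<equiv> poly (pderiv (cofac c)) c / poly (cofac c) c"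
    and "b \<equiv> poly (pderiv Bh) c / poly Bh c" and "n \<equiv> p0 - \<kappa>" and "N0 \<equiv> N p0 c" and "\<theta> \<equiv> theta c c"
  shows "H c c * deriv G c = 0"
    and "6 * deriv (H c) c = - 3 * (of_nat m - 1) * n * N0 * (\<nu> - 1 + 2 * \<theta>)
      + 2 * N0 * n * ((\<nu> - 1) * (\<nu> - 2 + 3 * \<theta>))
      + N0\<^sup>2 * ((\<nu> - 1) * (2 * (\<nu> + 1) * k + (\<nu> - 2) * b) / \<nu> + 3 * ((\<nu> + 1) * k + (\<nu> - 1) * b) / \<nu> * \<theta>
        + 3 * (\<nu> - 1) * (if c = \<sigma>0 then 0 else 1 / (c - \<sigma>0)))"
proof -
  have B: "poly Bh c \<noteq> 0" and G: "G c = p0" using roots_iff c by auto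
  have \<nu>0: "\<nu> \<noteq> 0" using mult_pos[OF c] by (simp add: \<nu>_def)
  note R = ratio_derivs[OF c, folded \<nu>_def k_def b_def]
  \<comment> \<open>H(c) is N0^2 times \<open>e2\<close>, which contains the factor \<nu> - 1: at an
    unramified point \<open>e2\<close> vanishes, at a ramified one the derivative of G does. The
    same product disposes of the summand c G'(c) in the derivative of N.\<close>
  define e2 where "e2 = (\<nu> - 1) * (\<nu> - 2) / 6 + (\<nu> - 1) / 2 * \<theta>"
  have "e2 * deriv G c = 0"
  proof (cases "mult c = 1")
    case True
    then show ?thesis by (simp add: e2_def \<nu>_def)
  next
    case False
    then have "mult c \<ge> 2" using mult_pos[OF c] by simp
    then show ?thesis using deriv_G_zero[OF c] by simp
  qed
  note eG = this
  have "H c c = N0\<^sup>2 * e2"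
    by (simp add: H_def G R(1,2) e2_def \<theta>_def N0_def)
  then show "H c c * deriv G c = 0" using eG by (simp add: mult.assoc)
  have dG: "(G has_field_derivative deriv G c) (at c)"
    using G_deriv[OF B] DERIV_imp_deriv by fastforce
  let ?t = "if c = \<sigma>0 then 0 else 1 / (c - \<sigma>0)"
  have dN: "((\<lambda>s. N (G s) s) has_field_derivative n + c * deriv G c) (at c)"
    unfolding N_def n_def by (auto intro!: derivative_eq_intros dG simp: G)
  let ?r2' = "((\<nu> + 1) * k + (\<nu> - 1) * b) / (2 * \<nu>)" and ?r3' = "(\<nu> - 1) * (2 * (\<nu> + 1) * k + (\<nu> - 2) * b) / (6 * \<nu>)"
  have "(H c has_field_derivative
      - ((of_nat m - 1) * n * N0 * ((\<nu> - 1) / 2 + \<theta>)) + 2 * N0 * (n + c * deriv G c) * e2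
      + N0\<^sup>2 * (?r3' + ?r2' * \<theta> + (\<nu> - 1) / 2 * ?t)) (at c)"
    unfolding H_def
    by (rule derivative_eq_intros dN dG R(3,4) theta_deriv refl)+
      (simp add: G R(1,2) \<theta>_def[symmetric] N0_def[symmetric] n_def[symmetric] e2_def)
  then have d: "deriv (H c) c = - ((of_nat m - 1) * n * N0 * ((\<nu> - 1) / 2 + \<theta>)) + 2 * N0 * (n + c * deriv G c) * e2
      + N0\<^sup>2 * (?r3' + ?r2' * \<theta> + (\<nu> - 1) / 2 * ?t)"
    by (rule DERIV_imp_deriv)
  have "2 * N0 * (n + c * deriv G c) * e2 = 2 * N0 * n * e2 + 2 * N0 * c * (e2 * deriv G c)"
    by (simp add: algebra_simps)
  then have d: "deriv (H c) c = - ((of_nat m - 1) * n * N0 * ((\<nu> - 1) / 2 + \<theta>)) + 2 * N0 * n * e2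
      + N0\<^sup>2 * (?r3' + ?r2' * \<theta> + (\<nu> - 1) / 2 * ?t)"
    using d eG by simp
  have "6 * (- ((of_nat m - 1) * n * N0 * ((\<nu> - 1) / 2 + \<theta>))) = - 3 * (of_nat m - 1) * n * N0 * (\<nu> - 1 + 2 * \<theta>)"
    by (simp add: field_simps)
  note m6 = this
  have e6: "6 * e2 = (\<nu> - 1) * (\<nu> - 2 + 3 * \<theta>)"
    by (simp add: e2_def field_simps)
  have r6: "6 * (?r3' + ?r2' * \<theta> + (\<nu> - 1) / 2 * ?t) =
     (\<nu> - 1) * (2 * (\<nu> + 1) * k + (\<nu> - 2) * b) / \<nu> + 3 * ((\<nu> + 1) * k + (\<nu> - 1) * b) / \<nu> * \<theta> + 3 * (\<nu> - 1) * ?t"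
  proof -
    have "6 * (x / (6 * \<nu>) + y / (2 * \<nu>) * \<theta> + z / 2 * t) = x / \<nu> + 3 * y / \<nu> * \<theta> + 3 * z * t" for x y z t
      using \<nu>0 by (simp add: field_simps)
    then show ?thesis .
  qed
  have "6 * deriv (H c) c = 6 * (- ((of_nat m - 1) * n * N0 * ((\<nu> - 1) / 2 + \<theta>))) + 2 * N0 * n * (6 * e2)
      + N0\<^sup>2 * (6 * (?r3' + ?r2' * \<theta> + (\<nu> - 1) / 2 * ?t))"
    unfolding d by algebra
  then show "6 * deriv (H c) c = - 3 * (of_nat m - 1) * n * N0 * (\<nu> - 1 + 2 * \<theta>)
      + 2 * N0 * n * ((\<nu> - 1) * (\<nu> - 2 + 3 * \<theta>))
      + N0\<^sup>2 * ((\<nu> - 1) * (2 * (\<nu> + 1) * k + (\<nu> - 2) * b) / \<nu> + 3 * ((\<nu> + 1) * k + (\<nu> - 1) * b) / \<nu> * \<theta>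
        + 3 * (\<nu> - 1) * ?t)"
    unfolding m6 e6 r6 .
qed

text \<open>The case \<theta> = 1, arranged so that the bracket is \<open>chart_quotient\<close>
  with weights \<nu> - 1, 2 \<nu> + 1 and l = m - \<nu>.\<close>

lemma residue_at_line:
  defines "\<nu> \<equiv> of_nat (mult \<sigma>0) :: complex" and "k \<equiv> poly (pderiv (cofac \<sigma>0)) \<sigma>0 / poly (cofac \<sigma>0) \<sigma>0"
    and "b \<equiv> poly (pderiv Bh) \<sigma>0 / poly Bh \<sigma>0"
  shows "6 * deriv (H \<sigma>0) \<sigma>0 = (1 + 1 / \<nu>) * (N p0 \<sigma>0 *
     ((\<nu> - 1) * (N p0 \<sigma>0 * b - (p0 - \<kappa>) * of_nat m) +
      (2 * \<nu> + 1) * (N p0 \<sigma>0 * k - (p0 - \<kappa>) * (of_nat m - \<nu>))))"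
proof -
  have \<nu>: "\<nu> \<noteq> 0" using mult_pos[OF root0'] by (simp add: \<nu>_def)
  show ?thesis
  proof -
    define w where "w = 1 / \<nu>"
    have w: "\<nu> * w = 1" and div: "x / \<nu> = x * w" for x
      using \<nu> by (simp_all add: w_def)
    show ?thesis
      unfolding H_deriv(2)[OF root0', folded \<nu>_def k_def b_def] theta_at div if_True simp_thms
      using w by algebra
  qed
qed

text \<open>The case \<theta> = 0. In the term with 1/(c - \<sigma>0), one factor N p0 c is replaced
  by N p0 \<sigma>0 + (p0 - \<kappa>)(c - \<sigma>0); the second part joins the terms with p0 -
  \<kappa>.\<close>

lemma residue_off_line:
  assumes c: "c \<in> roots p0" "c \<noteq> \<sigma>0"
  defines "\<nu> \<equiv> of_nat (mult c) :: complex" and "k \<equiv> poly (pderiv (cofac c)) c / poly (cofac c) c"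
    and "b \<equiv> poly (pderiv Bh) c / poly Bh c"
  shows "6 * deriv (H c) c = (1 - 1 / \<nu>) * (N p0 c *
     ((\<nu> - 2) * (N p0 c * b - (p0 - \<kappa>) * of_nat m) +
      2 * (\<nu> + 1) * (N p0 c * k - (p0 - \<kappa>) * (of_nat m - \<nu>)) + 3 * \<nu> * N p0 \<sigma>0 / (c - \<sigma>0)))"
proof -
  have \<nu>: "\<nu> \<noteq> 0" using mult_pos[OF c(1)] by (simp add: \<nu>_def)
  define w v where "w = 1 / \<nu>" and "v = 1 / (c - \<sigma>0)"
  have w: "\<nu> * w = 1" and div: "x / \<nu> = x * w" for x
    using \<nu> by (simp_all add: w_def)
  have v: "(c - \<sigma>0) * v = 1" and divv: "x / (c - \<sigma>0) = x * v" for x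
    using c(2) by (simp_all add: v_def)
  have N: "N p0 \<sigma>0 = N p0 c - (p0 - \<kappa>) * (c - \<sigma>0)" by (simp add: N_def algebra_simps)
  show ?thesis
    unfolding H_deriv(2)[OF c(1), folded \<nu>_def k_def b_def] theta_at N div divv if_not_P[OF c(2)]
    using w v by algebra
qed

section \<open>The expansion of T at p0\<close>

lemma separating_radius:
  obtains r where "r > 0"
    "\<And>c z. c \<in> roots p0 \<Longrightarrow> z \<in> roots p0 \<union> {z. poly Bh z = 0} \<union> {z. poly wronskian z = 0} \<Longrightarrow> z \<noteq> c \<Longrightarrow> 2 * r \<le> dist c z"
proof -
  have "Bh \<noteq> 0" using Bh_root[OF root0'] by auto
  \<comment> \<open>Keeping away from the zeros of \<open>Bh\<close> and \<open>wronskian\<close>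
    makes G holomorphic on the discs, with nonzero derivative except possibly at the
    centres.\<close>
  then have fin: "finite (roots p0 \<union> {z. poly Bh z = 0} \<union> {z. poly wronskian z = 0})" (is "finite ?Z")
    using finite_roots[OF lead_Phi_p0] wronskian_nonzero by (auto intro: poly_roots_finite)
  let ?D = "insert 1 ((\<lambda>(c, z). dist c z) ` {(c, z) \<in> roots p0 \<times> ?Z. z \<noteq> c})"
  have "finite {(c, z) \<in> roots p0 \<times> ?Z. z \<noteq> c}"
    by (rule finite_subset[of _ "roots p0 \<times> ?Z"]) (use fin in auto)
  then have D: "finite ?D" by simp
  show ?thesis
  proof (rule that[of "Min ?D / 2"])
    show "Min ?D / 2 > 0" using D by (auto simp: Min_gr_iff)
    fix c z assume "c \<in> roots p0" "z \<in> ?Z" "z \<noteq> c"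
    then have "dist c z \<in> ?D" by (auto intro!: image_eqI[of _ _ "(c, z)"])
    then show "2 * (Min ?D / 2) \<le> dist c z" using D by simp
  qed
qed

lemma trace_near_root:
  assumes c: "c \<in> roots p0" and r: "0 < r" "r < r0"
    and off: "\<And>z. z \<in> ball c r0 \<Longrightarrow> z \<noteq> c \<Longrightarrow> z \<notin> roots p0"
      "\<And>z. z \<in> ball c r0 \<Longrightarrow> z \<noteq> c \<Longrightarrow> poly wronskian z \<noteq> 0"
    and B: "\<And>z. z \<in> ball c r0 \<Longrightarrow> poly Bh z \<noteq> 0"
  shows "\<exists>\<epsilon> \<tau>. \<epsilon> > 0 \<and> \<tau> holomorphic_on ball p0 \<epsilon> \<and> (\<forall>p\<in>ball p0 \<epsilon> - {p0}.
       (\<Sum>z | z \<in> ball c r \<and> G z = p. H c z / (z - c)\<^sup>2 / deriv G z) = \<tau> p + deriv (H c) c / (p - p0))"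
proof -
  have Ghol: "G holomorphic_on ball c r0"
    unfolding G_def[abs_def] using B by (intro holomorphic_intros) auto
  have E1: "E1 c z \<noteq> 0" if "z \<in> ball c r0" for z
    using E1_at[OF c] E1_nonzero[of z c] off[OF that] B[OF that] by (cases "z = c") auto
  have "theta c holomorphic_on ball c r0"
  proof (cases "c = \<sigma>0")
    case False
    then have "\<sigma>0 \<notin> ball c r0" using off(1)[of \<sigma>0] root0' by auto
    then show ?thesis using False unfolding theta_def[abs_def] by (auto intro!: holomorphic_intros)
  qed (simp add: theta_def[abs_def])
  note hol = this
  have holE: "E1 c holomorphic_on ball c r0" "E2 c holomorphic_on ball c r0" "E3 c holomorphic_on ball c r0"
    unfolding E1_def[abs_def] E2_def[abs_def] E3_def[abs_def] using B
    by (auto intro!: holomorphic_intros)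
  have Hhol: "H c holomorphic_on ball c r0"
    unfolding H_def[abs_def] N_def using E1
    by (intro holomorphic_on_add holomorphic_on_diff holomorphic_on_mult holomorphic_on_divide
        holomorphic_on_power holomorphic_on_const holomorphic_on_ident Ghol hol holE) auto
  have Gc: "G c = p0" using roots_iff c by blast
  have Gz: "G z \<noteq> p0" if "z \<in> ball c r0" "z \<noteq> c" for z
    using off(1)[OF that] B[OF that(1)] roots_iff[of z p0] by simp
  have G'z: "deriv G z \<noteq> 0" if "z \<in> ball c r0" "z \<noteq> c" for z
    using DERIV_imp_deriv[OF G_deriv[OF B[OF that(1)]]] off(2)[OF that] B[OF that(1)] by simp
  have fin: "finite {z \<in> ball c r0. G z = p}" for p
  proof (rule finite_subset)
    show "{z \<in> ball c r0. G z = p} \<subseteq> {z. poly (Phi p) z = 0}"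
      using B roots_iff[of _ p] by (auto simp: roots_def)
  qed (rule poly_roots_finite[OF Phi_nonzero])
  show ?thesis
  proof (rule local_trace_double_pole[OF r Ghol Hhol Gc Gz G'z fin H_deriv(1)[OF c]])
    fix \<epsilon> \<tau>
    assume "\<epsilon> > 0" "\<tau> holomorphic_on ball p0 \<epsilon>" "\<forall>p\<in>ball p0 \<epsilon> - {p0}.
       (\<Sum>z | z \<in> ball c r \<and> G z = p. H c z / (z - c)\<^sup>2 / deriv G z) = \<tau> p + deriv (H c) c / (p - p0)"
    then show ?thesis by (intro exI[of _ \<epsilon>] exI[of _ \<tau>] conjI)
  qed
qed

theorem T_expansion:
  obtains \<epsilon> \<tau> where "\<epsilon> > 0" "\<tau> holomorphic_on ball p0 \<epsilon>"
    "\<forall>p\<in>ball p0 \<epsilon> - {p0}. p \<in> good \<and> card (roots p) = m \<and>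
       T p = \<tau> p + (\<Sum>c\<in>roots p0. deriv (H c) c) / (p - p0)"
proof -
  obtain r0 where r0: "r0 > 0" and sep: "\<And>c z. c \<in> roots p0 \<Longrightarrow>
      z \<in> roots p0 \<union> {z. poly Bh z = 0} \<union> {z. poly wronskian z = 0} \<Longrightarrow> z \<noteq> c \<Longrightarrow> 2 * r0 \<le> dist c z"
    using separating_radius by blast
  have off: "z \<notin> roots p0" "poly Bh z \<noteq> 0" "poly wronskian z \<noteq> 0" if "c \<in> roots p0" "z \<in> ball c r0" "z \<noteq> c" for c z
    using sep[OF that(1), of z] that r0 by auto
  have B: "poly Bh z \<noteq> 0" if "c \<in> roots p0" "z \<in> ball c r0" for c z
    using off(2)[OF that] Bh_root[OF that(1)] by auto
  define r where "r = r0 / 2"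
  have r: "0 < r" "r < r0" using r0 by (auto simp: r_def)
  define P where "P c \<epsilon> \<tau> \<longleftrightarrow> \<epsilon> > 0 \<and> \<tau> holomorphic_on ball p0 \<epsilon> \<and> (\<forall>p\<in>ball p0 \<epsilon> - {p0}.
       (\<Sum>z | z \<in> ball c r \<and> G z = p. H c z / (z - c)\<^sup>2 / deriv G z) = \<tau> p + deriv (H c) c / (p - p0))"
    for c \<epsilon> \<tau>
  have "\<forall>c\<in>roots p0. \<exists>\<epsilon> \<tau>. P c \<epsilon> \<tau>"
  proof
    fix c assume c: "c \<in> roots p0"
    show "\<exists>\<epsilon> \<tau>. P c \<epsilon> \<tau>"
      unfolding P_def by (rule trace_near_root[OF c r off(1)[OF c] off(3)[OF c] B[OF c]])
  qed
  then obtain \<epsilon> \<tau> where P: "\<And>c. c \<in> roots p0 \<Longrightarrow> P c (\<epsilon> c) (\<tau> c)"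
    by metis
  have \<epsilon>\<tau>: "\<epsilon> c > 0" "\<tau> c holomorphic_on ball p0 (\<epsilon> c)"
    "\<And>p. p \<in> ball p0 (\<epsilon> c) - {p0} \<Longrightarrow>
       (\<Sum>z | z \<in> ball c r \<and> G z = p. H c z / (z - c)\<^sup>2 / deriv G z) = \<tau> c p + deriv (H c) c / (p - p0)"
    if "c \<in> roots p0" for c
    using P[OF that] unfolding P_def by simp_all
  have "p0 \<in> {p. coeff (Phi p) m \<noteq> 0}" using lead_Phi_p0 by simp
  from openE[OF open_lead this]
  obtain e1 where e1: "e1 > 0" "ball p0 e1 \<subseteq> {p. coeff (Phi p) m \<noteq> 0}" .
  obtain M where M: "M > 0" "\<And>s. (\<And>c. poly (Phi p0) c = 0 \<Longrightarrow> r \<le> dist c s) \<Longrightarrow> norm (poly Bh s) \<le> M * norm (poly (Phi p0) s)"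
    using poly_bounded_away_from_roots[of "Phi p0" Bh r] Phi_nonzero degB degree_Phi[OF lead_Phi_p0] r by auto
  have fin: "finite (roots p0)" by (rule finite_roots[OF lead_Phi_p0])
  define e where "e = Min (insert e1 (insert (1 / M) (\<epsilon> ` roots p0)))"
  have e: "e > 0" "e \<le> e1" "e \<le> 1 / M" "\<And>c. c \<in> roots p0 \<Longrightarrow> e \<le> \<epsilon> c"
  proof -
    let ?S = "insert e1 (insert (1 / M) (\<epsilon> ` roots p0))"
    have fS: "finite ?S" using fin by simp
    have le: "e \<le> x" if "x \<in> ?S" for x
      unfolding e_def using fS that by (rule Min_le)
    show "e \<le> e1" "e \<le> 1 / M" "\<And>c. c \<in> roots p0 \<Longrightarrow> e \<le> \<epsilon> c"
      by (rule le, simp)+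
    have "e \<in> ?S" unfolding e_def using fS by (intro Min_in) auto
    then show "e > 0" using e1(1) M(1) \<epsilon>\<tau>(1) by auto
  qed
  show ?thesis
  proof (rule that[of e "\<lambda>p. \<Sum>c\<in>roots p0. \<tau> c p"])
    show "e > 0" by (rule e)
    show "(\<lambda>p. \<Sum>c\<in>roots p0. \<tau> c p) holomorphic_on ball p0 e"
      by (intro holomorphic_on_sum holomorphic_on_subset[OF \<epsilon>\<tau>(2)]) (simp_all add: subset_ball e(4))
    show "\<forall>p\<in>ball p0 e - {p0}. p \<in> good \<and> card (roots p) = m \<and>
       T p = (\<Sum>c\<in>roots p0. \<tau> c p) + (\<Sum>c\<in>roots p0. deriv (H c) c) / (p - p0)"
    proof
      fix p assume "p \<in> ball p0 e - {p0}"
      then have p: "p \<in> ball p0 e" "p \<noteq> p0" by auto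
      have "p \<in> ball p0 e1" using p(1) e(2) by simp
      then have lead: "coeff (Phi p) m \<noteq> 0" using e1(2) by blast
      then have good: "p \<in> good" using p by (simp add: good_def)
      \<comment> \<open>A root s of \<open>Phi p\<close> satisfies Phi p0 (s) = -(p - p0) Bh(s). If
        s were far from the whole fibre over p0, the bound M would force the distance of p and p0 to
        be at least 1/M. This also prevents roots from escaping to infinity.\<close>
      have near: "\<exists>c\<in>roots p0. s \<in> ball c r" if s: "s \<in> roots p" for s
      proof (rule ccontr)
        assume "\<not> (\<exists>c\<in>roots p0. s \<in> ball c r)"
        then have le: "norm (poly Bh s) \<le> M * norm (poly (Phi p0) s)"
          by (intro M(2)) (auto simp: roots_def not_less)
        have "poly (Phi p0) s = - (p - p0) * poly Bh s"
          using s by (simp add: roots_def poly_Phi algebra_simps add_eq_0_iff)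
        then have "norm (poly (Phi p0) s) = dist p0 p * norm (poly Bh s)"
          by (simp add: norm_mult dist_norm norm_minus_commute)
        with le have "1 * norm (poly Bh s) \<le> (M * dist p0 p) * norm (poly Bh s)" by simp
        then have "1 \<le> M * dist p0 p"
          using Bh_root[OF s] by (subst (asm) mult_le_cancel_right) auto
        moreover have "dist p0 p < 1 / M" using p e(3) by simp
        ultimately show False using M(1) by (simp add: field_simps)
      qed
      let ?Z = "\<lambda>c. {z. z \<in> ball c r \<and> G z = p}"
      have union: "roots p = (\<Union>c\<in>roots p0. ?Z c)"
      proof
        show "roots p \<subseteq> (\<Union>c\<in>roots p0. ?Z c)" using near roots_iff by blast
        show "(\<Union>c\<in>roots p0. ?Z c) \<subseteq> roots p"
        proof
          fix z assume "z \<in> (\<Union>c\<in>roots p0. ?Z c)"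
          then obtain c where "c \<in> roots p0" "z \<in> ball c r" "G z = p" by auto
          then show "z \<in> roots p" using B[of c z] r roots_iff[of z p] by auto
        qed
      qed
      have simple: "poly (pderiv (Phi p)) s \<noteq> 0" if s: "s \<in> roots p" for s
      proof -
        obtain c where c: "c \<in> roots p0" "s \<in> ball c r" using near[OF s] by blast
        moreover have "s \<noteq> c" using c(1) s p(2) roots_disjoint by metis
        ultimately have "poly wronskian s \<noteq> 0" using off(3)[of c s] r by auto
        then show ?thesis using wronskian_Phi[of s p] s by (auto simp: roots_def)
      qed
      have card: "card (roots p) = m"
        using poly_simple_roots_card[OF Phi_nonzero, of p] simple degree_Phi[OF lead] by (simp add: roots_def)
      have "T p = (\<Sum>c\<in>roots p0. \<Sum>s\<in>?Z c. vel p s * inner p s)"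
        unfolding T_def union
      proof (rule sum.UNION_disjoint)
        show "\<forall>c\<in>roots p0. finite (?Z c)"
        proof
          fix c assume "c \<in> roots p0"
          then have "?Z c \<subseteq> roots p" unfolding union by (rule UN_upper)
          then show "finite (?Z c)" using finite_roots[OF lead] by (rule finite_subset)
        qed
        show "\<forall>c\<in>roots p0. \<forall>c'\<in>roots p0. c \<noteq> c' \<longrightarrow> ?Z c \<inter> ?Z c' = {}"
        proof (intro ballI impI, rule ccontr)
          fix c c' assume c: "c \<in> roots p0" "c' \<in> roots p0" "c \<noteq> c'" and "?Z c \<inter> ?Z c' \<noteq> {}"
          then obtain z where "dist c z < r" "dist c' z < r" by auto
          then have "dist c c' < 2 * r0"
            using dist_triangle2[of c c' z] r by simp
          then show False using sep[of c c'] c by auto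
        qed
      qed (rule fin)
      also have "\<dots> = (\<Sum>c\<in>roots p0. \<Sum>s\<in>?Z c. H c s / (s - c)\<^sup>2 / deriv G s)"
      proof (intro sum.cong refl)
        fix c s assume c: "c \<in> roots p0" and s: "s \<in> ?Z c"
        then have sp: "s \<in> roots p" using union by blast
        moreover have "s \<noteq> c" using c sp p(2) roots_disjoint by metis
        ultimately show "vel p s * inner p s = H c s / (s - c)\<^sup>2 / deriv G s"
          using vel_eq[OF sp p(2) simple[OF sp]] inner_eq_H[OF good card sp, of c] by simp
      qed
      also have "\<dots> = (\<Sum>c\<in>roots p0. \<tau> c p + deriv (H c) c / (p - p0))"
      proof (intro sum.cong refl)
        fix c assume c: "c \<in> roots p0"
        have "p \<in> ball p0 (\<epsilon> c) - {p0}" using p e(4)[OF c] by auto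
        then show "(\<Sum>s\<in>?Z c. H c s / (s - c)\<^sup>2 / deriv G s) = \<tau> c p + deriv (H c) c / (p - p0)"
          by (rule \<epsilon>\<tau>(3)[OF c])
      qed
      finally show "p \<in> good \<and> card (roots p) = m \<and>
         T p = (\<Sum>c\<in>roots p0. \<tau> c p) + (\<Sum>c\<in>roots p0. deriv (H c) c) / (p - p0)"
        using good card by (simp add: sum.distrib sum_divide_distrib)
    qed
  qed
qed

subsection \<open>Holomorphy of the curvature\<close>

text \<open>A zero of \<open>N p\<close> in the fibre over p is a fixed point of the Gauss map,
  hence a root of the nonzero polynomial in \<open>nonfix\<close>; moreover s determines p =
  \<kappa> - 1/s. So only finitely many p are excluded. One of them is p0 if the line is invariant,
  whence the punctured disc.\<close>

lemma N_nonzero_near: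
  obtains \<epsilon> where "\<epsilon> > 0"
    "\<forall>p\<in>ball p0 \<epsilon> - {p0}. \<forall>s\<in>insert \<sigma>0 (roots p). N p s \<noteq> 0"
proof -
  let ?Z = "[:0, 1:] * Ah + [:- 1, \<kappa>:] * Bh"
  have "finite ((\<lambda>s. \<kappa> - 1 / s) ` insert \<sigma>0 {s. poly ?Z s = 0})"
    using poly_roots_finite[OF nonfix] by simp
  from finite_set_avoid[OF this, of p0]
  obtain \<epsilon> where \<epsilon>: "\<epsilon> > 0"
    "\<forall>p\<in>(\<lambda>s. \<kappa> - 1 / s) ` insert \<sigma>0 {s. poly ?Z s = 0}. p \<noteq> p0 \<longrightarrow> \<epsilon> \<le> dist p0 p"
    by blast
  have "N p s \<noteq> 0" if p: "p \<in> ball p0 \<epsilon> - {p0}" and s: "s \<in> insert \<sigma>0 (roots p)" for p s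
  proof
    assume N0: "N p s = 0"
    then have "s \<noteq> 0" by (auto simp: N_def)
    with N0 have ps: "p * s = \<kappa> * s - 1" and pk: "p = \<kappa> - 1 / s"
      by (simp_all add: N_def field_simps add_eq_0_iff)
    have "s \<in> insert \<sigma>0 {s. poly ?Z s = 0}"
    proof (cases "s = \<sigma>0")
      case False
      then have "poly Ah s = - p * poly Bh s"
        using s by (simp add: roots_def poly_Phi eq_neg_iff_add_eq_0)
      then have "poly ?Z s = (\<kappa> * s - 1 - p * s) * poly Bh s"
        by (simp add: algebra_simps)
      then show ?thesis using ps by simp
    qed simp
    then have "p \<in> (\<lambda>s. \<kappa> - 1 / s) ` insert \<sigma>0 {s. poly ?Z s = 0}" using pk by blast
    then have "\<epsilon> \<le> dist p0 p" using \<epsilon>(2) p by blast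
    then show False using p by simp
  qed
  then show ?thesis using that[OF \<epsilon>(1)] by blast
qed

section \<open>Local webs beside the line p = p0, and the polar part of the curvature\<close>

lemma local_root:
  assumes s: "s \<in> roots p" and d: "poly wronskian s \<noteq> 0"
  obtains e g where "e > 0" "g holomorphic_on ball p e" "g p = s" "\<forall>u\<in>ball p e. g u \<in> roots u"
proof -
  have B: "poly Bh s \<noteq> 0" and G: "G s = p" using roots_iff s by auto
  let ?S = "{z. poly Bh z \<noteq> 0}"
  have "open ?S"
  proof -
    have "continuous_on UNIV (poly Bh)" by (intro continuous_intros)
    from open_vimage[OF _ this, of "- {0}"] show ?thesis by (auto simp: vimage_def)
  qed
  moreover have holG: "G holomorphic_on ?S"
    unfolding G_def[abs_def] by (intro holomorphic_intros) auto
  moreover have "deriv G s \<noteq> 0"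
    using DERIV_imp_deriv[OF G_deriv[OF B]] B d by simp
  ultimately obtain r where r: "r > 0" "ball s r \<subseteq> ?S" "open (G ` ball s r)" "inj_on G (ball s r)"
    using has_complex_derivative_locally_invertible[of G ?S s thesis] B by simp
  have "\<exists>g. g holomorphic_on G ` ball s r \<and> (\<forall>z\<in>ball s r. g (G z) = z)"
  proof (rule holomorphic_has_inverse[OF holomorphic_on_subset[OF holG r(2)] open_ball r(4)])
    fix g assume "g holomorphic_on G ` ball s r" "\<And>z. z \<in> ball s r \<Longrightarrow> g (G z) = z"
    then show ?thesis by (intro exI[of _ g]) simp
  qed
  then obtain g where g: "g holomorphic_on G ` ball s r" "\<And>z. z \<in> ball s r \<Longrightarrow> g (G z) = z"
    by auto
  have "p \<in> G ` ball s r" using G r(1) by force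
  from openE[OF r(3) this] obtain e where e: "0 < e" "ball p e \<subseteq> G ` ball s r" .
  have "g p = s" using g(2)[of s] G r(1) by simp
  moreover have "g u \<in> roots u" if u: "u \<in> ball p e" for u
  proof -
    obtain z where z: "z \<in> ball s r" "u = G z" using e(2) u by blast
    have "poly Bh z \<noteq> 0" using r(2) z(1) by blast
    then have "z \<in> roots u" using roots_iff[of z u] z(2) by simp
    then show ?thesis using g(2)[OF z(1)] z(2) by simp
  qed
  ultimately show ?thesis
    using that[OF e(1) holomorphic_on_subset[OF g(1) e(2)]] by blast
qed

lemma coord_inverse:
  assumes "N p s \<noteq> 0" "q \<noteq> 0"
  shows "q + (\<kappa> - p) * (q * s / N p s) \<noteq> 0" "coord (p, q) (q * s / N p s) = s"
proof -
  have e: "q + (\<kappa> - p) * (q * s / N p s) = q / N p s"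
    using assms(1) by (simp add: N_def field_simps)
  then show "q + (\<kappa> - p) * (q * s / N p s) \<noteq> 0" using assms by simp
  show "coord (p, q) (q * s / N p s) = s"
    unfolding coord_def fst_conv snd_conv e using assms by simp
qed

lemma holomorphic2_on_homogeneous:
  assumes "open W" "f holomorphic_on W"
  shows "holomorphic2_on (\<lambda>z. snd z * f (fst z)) (W \<times> Q)"
  unfolding holomorphic2_on_def
proof
  fix z :: "complex \<times> complex" assume "z \<in> W \<times> Q"
  then have "fst z \<in> W" by auto
  then have "(f has_field_derivative deriv f (fst z)) (at (fst z))"
    using assms holomorphic_derivI by blast
  then have "(f has_derivative (\<lambda>h. deriv f (fst z) * h)) (at (fst z))"
    by (simp add: has_field_derivative_def)
  from has_derivative_compose[OF has_derivative_fst[OF has_derivative_ident] this]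
  have "((\<lambda>z. f (fst z)) has_derivative (\<lambda>h. deriv f (fst z) * fst h)) (at z)" .
  from has_derivative_mult[OF has_derivative_snd[OF has_derivative_ident] this]
  have "((\<lambda>z. snd z * f (fst z)) has_derivative (\<lambda>h. snd z * (deriv f (fst z) * fst h) + snd h * f (fst z))) (at z)" .
  moreover have "(\<lambda>h. snd z * (deriv f (fst z) * fst h) + snd h * f (fst z)) =
      (\<lambda>(h, k). (snd z * deriv f (fst z)) * h + f (fst z) * k)"
    by (auto simp: algebra_simps)
  ultimately have "((\<lambda>z. snd z * f (fst z)) has_derivative
      (\<lambda>(h, k). (snd z * deriv f (fst z)) * h + f (fst z) * k)) (at z)" by simp
  then show "\<exists>a b. ((\<lambda>z. snd z * f (fst z)) has_derivative (\<lambda>(h, k). a * h + b * k)) (at z)"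
    by (intro exI)
qed

text \<open>Guards against a vacuous criterion: it provides points near the line at which the
  curvature has a value, so that a holomorphic extension is really constrained.\<close>

lemma web_exists:
  assumes p: "p \<in> good" and card: "card (roots p) = m" and N: "\<forall>s\<in>insert \<sigma>0 (roots p). N p s \<noteq> 0"
    and q: "q \<noteq> 0"
  obtains U \<xi> where "(p, q) \<in> U" "web_slopes F (Suc m) U \<xi>"
proof -
  have lead: "coeff (Phi p) m \<noteq> 0" using p by (simp add: good_def)
  obtain rt where rt: "bij_betw rt {0..<m} (roots p)"
    using ex_bij_betw_nat_finite[OF finite_roots[OF lead]] card by auto
  define P where "P i e g \<longleftrightarrow> e > 0 \<and> g holomorphic_on ball p e \<and> g p = rt i \<and> (\<forall>u\<in>ball p e. g u \<in> roots u)"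
    for i e g
  have "\<exists>e g. P i e g" if "i < m" for i
  proof -
    have s: "rt i \<in> roots p" using rt that by (auto simp: bij_betw_def)
    have "poly (pderiv (Phi p)) (rt i) \<noteq> 0"
      using poly_simple_roots_derivs(1)[of "Phi p" "rt i"] card degree_Phi[OF lead] Phi_nonzero s
      by (simp add: roots_def)
    then have w: "poly wronskian (rt i) \<noteq> 0"
      using wronskian_Phi[of "rt i" p] s Bh_root[OF s] by (simp add: roots_def)
    show ?thesis
    proof (rule local_root[OF s w])
      fix e g assume "e > 0" "g holomorphic_on ball p e" "g p = rt i" "\<forall>u\<in>ball p e. g u \<in> roots u"
      then show ?thesis unfolding P_def by (intro exI[of _ e] exI[of _ g] conjI)
    qed
  qed
  then obtain e g where P: "\<And>i. i < m \<Longrightarrow> P i (e i) (g i)" by metis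
  \<comment> \<open>The indices below m are local branches of the fibre; index m is the constant
    direction of the line.\<close>
  define s where "s i = (if i < m then g i else (\<lambda>_. \<sigma>0))" for i
  define e0 where "e0 = Min (insert 1 (e ` {..<m}))"
  have e0: "e0 > 0" "\<And>i. i < m \<Longrightarrow> e0 \<le> e i"
  proof -
    let ?S = "insert 1 (e ` {..<m})"
    have "e0 \<in> ?S" unfolding e0_def by (intro Min_in) auto
    then show "e0 > 0" using P by (auto simp: P_def)
    show "e0 \<le> e i" if "i < m" for i
      unfolding e0_def using that by (intro Min_le) auto
  qed
  have shol: "s i holomorphic_on ball p e0" for i
  proof (cases "i < m")
    case True
    have "g i holomorphic_on ball p (e i)" using P[OF True] by (simp add: P_def)
    then show ?thesis using True e0(2)[OF True]
      by (auto simp: s_def intro: holomorphic_on_subset subset_ball)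
  qed (simp add: s_def)
  have sp: "inj_on (\<lambda>i. s i p) {..<Suc m}" "\<And>i. s i p \<in> insert \<sigma>0 (roots p)"
  proof -
    have *: "s i p = (if i < m then rt i else \<sigma>0)" for i
      using P by (auto simp: s_def P_def)
    show "s i p \<in> insert \<sigma>0 (roots p)" for i
      using rt by (auto simp: * bij_betw_def)
    have "\<sigma>0 \<notin> roots p" using p \<sigma>0_not_root by (auto simp: good_def)
    then have ne: "rt i \<noteq> \<sigma>0" if "i < m" for i using rt that by (auto simp: bij_betw_def)
    have inj: "rt i = rt j \<Longrightarrow> i = j" if "i < m" "j < m" for i j
      using rt that by (auto simp: bij_betw_def inj_on_def)
    show "inj_on (\<lambda>i. s i p) {..<Suc m}"
      by (rule inj_onI) (auto simp: * less_Suc_eq ne ne[symmetric] inj split: if_splits)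
  qed
  have slim: "(s i \<longlongrightarrow> s i p) (nhds p)" for i
  proof -
    have "isCont (s i) p"
      using holomorphic_on_imp_continuous_on[OF shol[of i]] e0(1) by (simp add: continuous_on_eq_continuous_at)
    then show ?thesis by (simp add: isCont_def tendsto_at_iff_tendsto_nhds)
  qed
  have "\<forall>\<^sub>F u in nhds p. u \<in> ball p e0 \<inter> good"
    using e0(1) p open_good by (intro eventually_nhds_in_open) auto
  moreover have "\<forall>\<^sub>F u in nhds p. \<forall>i\<in>{..<Suc m}. N u (s i u) \<noteq> 0"
  proof (intro eventually_ball_finite ballI)
    fix i
    have "((\<lambda>u. N u (s i u)) \<longlongrightarrow> N p (s i p)) (nhds p)"
      unfolding N_def by (intro tendsto_intros slim filterlim_ident)
    then show "\<forall>\<^sub>F u in nhds p. N u (s i u) \<noteq> 0"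
      using N sp(2)[of i] by (intro tendsto_imp_eventually_ne) auto
  qed simp
  moreover have "\<forall>\<^sub>F u in nhds p. \<forall>i\<in>{..<Suc m}. \<forall>j\<in>{..<Suc m} - {i}. s i u \<noteq> s j u"
  proof (intro eventually_ball_finite ballI)
    fix i j assume "i \<in> {..<Suc m}" "j \<in> {..<Suc m} - {i}"
    then have "s i p - s j p \<noteq> 0" using inj_onD[OF sp(1), of i j] by auto
    moreover have "((\<lambda>u. s i u - s j u) \<longlongrightarrow> s i p - s j p) (nhds p)"
      by (intro tendsto_intros slim)
    ultimately have "\<forall>\<^sub>F u in nhds p. s i u - s j u \<noteq> 0"
      by (intro tendsto_imp_eventually_ne)
    then show "\<forall>\<^sub>F u in nhds p. s i u \<noteq> s j u" by simp
  qed auto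
  ultimately have "\<forall>\<^sub>F u in nhds p. u \<in> ball p e0 \<inter> good \<and> (\<forall>i\<in>{..<Suc m}. N u (s i u) \<noteq> 0) \<and>
      (\<forall>i\<in>{..<Suc m}. \<forall>j\<in>{..<Suc m} - {i}. s i u \<noteq> s j u)"
    by eventually_elim blast
  then obtain W where W: "open W" "p \<in> W" and
    W': "\<And>u. u \<in> W \<Longrightarrow> u \<in> ball p e0" "\<And>u. u \<in> W \<Longrightarrow> u \<in> good"
      "\<And>u i. u \<in> W \<Longrightarrow> i \<in> {..<Suc m} \<Longrightarrow> N u (s i u) \<noteq> 0"
      "\<And>u i j. u \<in> W \<Longrightarrow> i \<in> {..<Suc m} \<Longrightarrow> j \<in> {..<Suc m} - {i} \<Longrightarrow> s i u \<noteq> s j u"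
    unfolding eventually_nhds by blast
  define \<xi> where "\<xi> i = (\<lambda>z. snd z * (s i (fst z) / N (fst z) (s i (fst z))))" for i
  have roots: "(\<lambda>i. s i u) ` {..<Suc m} = insert \<sigma>0 (roots u)" if u: "u \<in> W" for u
  proof (rule card_subset_eq)
    have lead: "coeff (Phi u) m \<noteq> 0" using W'(2)[OF u] by (simp add: good_def)
    show "finite (insert \<sigma>0 (roots u))" using finite_roots[OF lead] by simp
    show "(\<lambda>i. s i u) ` {..<Suc m} \<subseteq> insert \<sigma>0 (roots u)"
    proof
      fix x assume "x \<in> (\<lambda>i. s i u) ` {..<Suc m}"
      then obtain i where "x = s i u" by auto
      moreover have "g i u \<in> roots u" if "i < m"
      proof -
        have "u \<in> ball p (e i)" using W'(1)[OF u] e0(2)[OF that] by simp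
        then show ?thesis using P[OF that] by (simp add: P_def)
      qed
      ultimately show "x \<in> insert \<sigma>0 (roots u)" by (auto simp: s_def)
    qed
    then have "card ((\<lambda>i. s i u) ` {..<Suc m}) \<le> card (insert \<sigma>0 (roots u))"
      using finite_roots[OF lead] by (intro card_mono) auto
    moreover have "card ((\<lambda>i. s i u) ` {..<Suc m}) = Suc m"
    proof -
      have "inj_on (\<lambda>i. s i u) {..<Suc m}"
        by (rule inj_onI) (metis W'(4)[OF u] DiffI singletonD)
      then show ?thesis by (simp add: card_image)
    qed
    moreover have "card (insert \<sigma>0 (roots u)) \<le> Suc (card (roots u))"
      by (rule card_insert_le_m1[THEN order.trans]) (auto simp: card_insert_if finite_roots[OF lead])
    ultimately show "card ((\<lambda>i. s i u) ` {..<Suc m}) = card (insert \<sigma>0 (roots u))"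
      using card_roots[OF lead] by simp
  qed
  have web: "web_slopes F (Suc m) (W \<times> (- {0})) \<xi>"
    unfolding web_slopes_def
  proof (intro conjI allI impI ballI)
    show "open (W \<times> (- {0 :: complex}))" using W(1) by (intro open_Times) auto
    show "holomorphic2_on (\<xi> i) (W \<times> - {0})" if "i < Suc m" for i
      unfolding \<xi>_def
    proof (rule holomorphic2_on_homogeneous[OF W(1)])
      have "s i holomorphic_on W" using shol W'(1) by (meson holomorphic_on_subset subsetI)
      then show "(\<lambda>u. s i u / N u (s i u)) holomorphic_on W"
        using W'(3) that unfolding N_def by (intro holomorphic_intros) auto
    qed
    fix z :: "complex \<times> complex" assume z: "z \<in> W \<times> - {0}"
    obtain u v where uv: "z = (u, v)" "u \<in> W" "v \<noteq> 0" using z by auto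
    have xi: "\<xi> i (u, v) = v * s i u / N u (s i u)" for i by (simp add: \<xi>_def)
    have co: "coord z (\<xi> i z) = s i u" and co': "v + (\<kappa> - u) * \<xi> i z \<noteq> 0" if "i \<in> {..<Suc m}" for i
      unfolding uv(1) xi using coord_inverse[OF W'(3)[OF uv(2) that] uv(3)] by simp_all
    show "inj_on (\<lambda>i. \<xi> i z) {..<Suc m}"
      by (rule inj_onI) (metis co W'(4)[OF uv(2)] DiffI singletonD)
    have lead: "coeff (Phi (fst z)) m \<noteq> 0" using W'(2)[OF uv(2)] by (simp add: good_def uv)
    show "{x. F z x = 0} = (\<lambda>i. \<xi> i z) ` {..<Suc m}"
    proof (intro equalityI subsetI)
      fix x assume "x \<in> {x. F z x = 0}"
      then have x: "F z x = 0" by simp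
      have "snd z \<noteq> 0" using uv by simp
      note C = coord_zero[OF x this lead]
      have "coord z x \<in> (\<lambda>i. s i u) ` {..<Suc m}" using C(2) roots[OF uv(2)] by (simp add: uv)
      then obtain i where i: "i \<in> {..<Suc m}" "coord z x = s i u" by blast
      have "x = \<xi> i z" using C(4) i(2) by (simp add: uv xi)
      then show "x \<in> (\<lambda>i. \<xi> i z) ` {..<Suc m}" using i(1) by blast
    next
      fix x assume "x \<in> (\<lambda>i. \<xi> i z) ` {..<Suc m}"
      then obtain i where i: "i \<in> {..<Suc m}" "x = \<xi> i z" by blast
      have "s i u \<in> insert \<sigma>0 (roots u)" using roots[OF uv(2)] i(1) by blast
      moreover have t: "v + (\<kappa> - u) * x \<noteq> 0" using co'[OF i(1)] i(2) by simp
      moreover have "x / (v + (\<kappa> - u) * x) = s i u"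
        unfolding i(2) using co[OF i(1)] unfolding uv(1) coord_def fst_conv snd_conv .
      ultimately have "F (u, v) x = 0"
        using F_iff[OF t] by (simp add: roots_def Phi_def)
      then show "x \<in> {x. F z x = 0}" by (simp add: uv)
    qed
  qed
  have "(p, q) \<in> W \<times> - {0}" using W(2) q by simp
  then show ?thesis using web by (rule that)
qed

text \<open>Over p0 the direction of the line belongs to the fibre, so at most m slopes are
  available. Hence the curvature prescribes no value of the extension on the line itself.\<close>

lemma no_web_on_line:
  assumes web: "web_slopes F (Suc m) U \<xi>" and w: "(p0, q) \<in> U" "q \<noteq> 0"
  shows False
proof -
  have inj: "inj_on (\<lambda>i. \<xi> i (p0, q)) {..<Suc m}"
    and Z: "{x. F (p0, q) x = 0} = (\<lambda>i. \<xi> i (p0, q)) ` {..<Suc m}"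
    using web w(1) unfolding web_slopes_def by blast+
  have C: "coord (p0, q) (\<xi> i (p0, q)) \<in> roots p0"
    "\<xi> i (p0, q) = q * coord (p0, q) (\<xi> i (p0, q)) / N p0 (coord (p0, q) (\<xi> i (p0, q)))" if "i \<in> {..<Suc m}" for i
  proof -
    have "F (p0, q) (\<xi> i (p0, q)) = 0" using Z that by blast
    from coord_zero(2,4)[OF this] show "coord (p0, q) (\<xi> i (p0, q)) \<in> roots p0"
      "\<xi> i (p0, q) = q * coord (p0, q) (\<xi> i (p0, q)) / N p0 (coord (p0, q) (\<xi> i (p0, q)))"
      using w lead_Phi_p0 root0' by auto
  qed
  have inj': "inj_on (\<lambda>i. coord (p0, q) (\<xi> i (p0, q))) {..<Suc m}"
    by (rule inj_onI) (metis C(2) inj_onD[OF inj])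
  have "Suc m \<le> card (roots p0)"
    using card_inj_on_le[OF inj', of "roots p0"] C(1) finite_roots[OF lead_Phi_p0] by auto
  then show False using card_roots[OF lead_Phi_p0] by simp
qed

definition rho :: complex where "rho = (\<Sum>c\<in>roots p0. deriv (H c) c)"

theorem curvature_holomorphic_at_iff:
  assumes q: "q \<noteq> 0"
  shows "curvature_holomorphic_at F (Suc m) (p0, q) \<longleftrightarrow> rho = 0"
proof -
  have "\<exists>e1 \<tau>. e1 > 0 \<and> \<tau> holomorphic_on ball p0 e1 \<and>
      (\<forall>p\<in>ball p0 e1 - {p0}. p \<in> good \<and> card (roots p) = m \<and> T p = \<tau> p + rho / (p - p0))"
  proof (rule T_expansion)
    fix e \<tau> assume "e > 0" "\<tau> holomorphic_on ball p0 e" "\<forall>p\<in>ball p0 e - {p0}. p \<in> good \<and> card (roots p) = m \<and>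
       T p = \<tau> p + (\<Sum>c\<in>roots p0. deriv (H c) c) / (p - p0)"
    then show ?thesis unfolding rho_def by (intro exI[of _ e] exI[of _ \<tau>] conjI)
  qed
  then obtain e1 \<tau> where e1: "e1 > 0" "\<tau> holomorphic_on ball p0 e1"
    and T: "\<forall>p\<in>ball p0 e1 - {p0}. p \<in> good \<and> card (roots p) = m \<and> T p = \<tau> p + rho / (p - p0)"
    by (elim exE conjE)
  obtain e2 where e2: "e2 > 0" "\<forall>p\<in>ball p0 e2 - {p0}. \<forall>s\<in>insert \<sigma>0 (roots p). N p s \<noteq> 0"
    using N_nonzero_near .
  have T': "(T has_field_derivative deriv \<tau> p - rho / (p - p0)\<^sup>2) (at p)" if p: "p \<in> ball p0 e1 - {p0}" for p
  proof (rule has_field_derivative_transform_within_open[of _ _ _ "ball p0 e1 - {p0}"])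
    have "(\<tau> has_field_derivative deriv \<tau> p) (at p)"
      using p by (intro holomorphic_derivI[OF e1(2) open_ball]) simp
    then show "((\<lambda>p. \<tau> p + rho / (p - p0)) has_field_derivative deriv \<tau> p - rho / (p - p0)\<^sup>2) (at p)"
      using p by (auto intro!: derivative_eq_intros simp: power2_eq_square)
    show "\<tau> u + rho / (u - p0) = T u" if "u \<in> ball p0 e1 - {p0}" for u
      using bspec[OF T that] by simp
    show "open (ball p0 e1 - {p0})" by (intro open_Diff) auto
  qed (rule p)
  have K: "k = - (deriv \<tau> p - rho / (p - p0)\<^sup>2) / v"
    if "web_curvature_at F (Suc m) (p, v) k" "p \<in> ball p0 e1 - {p0}" "v \<noteq> 0" for p v k
  proof -
    from that(1) obtain U \<xi> where U: "(p, v) \<in> U" "web_slopes F (Suc m) U \<xi>"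
        "k = curvature (Suc m) (slope_form \<xi>) (p, v)"
      unfolding web_curvature_at_def by (elim exE conjE)
    have "T field_differentiable at p" using T'[OF that(2)] by (auto simp: field_differentiable_def)
    from web_curvature[OF U(2,1) that(3) _ this] show ?thesis
      using bspec[OF T that(2)] U(3) DERIV_imp_deriv[OF T'[OF that(2)]] by simp
  qed
  show ?thesis
  proof
    assume rho: "rho = 0"
    define h where "h z = (1 / snd z) * (- deriv \<tau> (fst z))" for z :: "complex \<times> complex"
    have "holomorphic2_on h (ball p0 e1 \<times> - {0})"
      unfolding holomorphic2_on_def
    proof
      fix z :: "complex \<times> complex" assume z: "z \<in> ball p0 e1 \<times> - {0}"
      define D where "D = deriv (deriv \<tau>) (fst z)"
      have "deriv \<tau> holomorphic_on ball p0 e1" using e1(2) by (intro holomorphic_deriv) auto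
      moreover have "fst z \<in> ball p0 e1" using z by auto
      ultimately have "(deriv \<tau> has_field_derivative D) (at (fst z))"
        unfolding D_def by (rule holomorphic_derivI[OF _ open_ball])
      then have "(deriv \<tau> has_derivative (\<lambda>h. D * h)) (at (fst z))"
        by (simp add: has_field_derivative_def)
      from has_derivative_compose[OF has_derivative_fst[OF has_derivative_ident] this]
      have d1: "((\<lambda>z. deriv \<tau> (fst z)) has_derivative (\<lambda>h. D * fst h)) (at z)" .
      have "snd z \<noteq> 0" using z by auto
      then have "((\<lambda>z. 1 / snd z * - deriv \<tau> (fst z)) has_derivative
          (\<lambda>(h, k). (- D / snd z) * h + (deriv \<tau> (fst z) / (snd z)\<^sup>2) * k)) (at z)"
        by (auto intro!: derivative_eq_intros d1 simp: fun_eq_iff power2_eq_square field_simps)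
      then show "\<exists>a b. (h has_derivative (\<lambda>(h, k). a * h + b * k)) (at z)"
        unfolding h_def[abs_def] by (intro exI)
    qed
    moreover have kh: "k = h w" if w: "w \<in> ball p0 e1 \<times> - {0}" and k: "web_curvature_at F (Suc m) w k" for w k
    proof -
      obtain p v where wpv: "w = (p, v)" by (cases w)
      with w have pv: "w = (p, v)" "p \<in> ball p0 e1" "v \<noteq> 0" by simp_all
      have "p \<noteq> p0"
      proof
        assume "p = p0"
        then show False using k no_web_on_line[of _ _ v] pv by (auto simp: web_curvature_at_def)
      qed
      then show ?thesis using K[of p v k] k pv rho by (simp add: h_def)
    qed
    moreover have "open (ball p0 e1 \<times> (- {0 :: complex}))" by (intro open_Times) auto
    moreover have "(p0, q) \<in> ball p0 e1 \<times> - {0}" using q e1(1) by simp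
    ultimately show "curvature_holomorphic_at F (Suc m) (p0, q)"
      unfolding curvature_holomorphic_at_def
      by (intro exI[of _ "ball p0 e1 \<times> - {0}"] exI[of _ h] conjI ballI allI impI)
  next
    assume "curvature_holomorphic_at F (Suc m) (p0, q)"
    then obtain U h where U: "open U" "(p0, q) \<in> U" "holomorphic2_on h U"
      and h: "\<And>w k. w \<in> U \<Longrightarrow> web_curvature_at F (Suc m) w k \<Longrightarrow> k = h w"
      unfolding curvature_holomorphic_at_def by auto
    obtain e3 where e3: "e3 > 0" "\<And>u. u \<in> ball p0 e3 \<Longrightarrow> (u, q) \<in> U"
      by (rule open_slices[OF U(1,2)]) (rule that; simp)
    define e where "e = min e1 (min e2 e3)"
    have e: "e > 0" "\<And>p. p \<in> ball p0 e \<Longrightarrow> p \<in> ball p0 e1" "\<And>p. p \<in> ball p0 e \<Longrightarrow> p \<in> ball p0 e2"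
      "\<And>p. p \<in> ball p0 e \<Longrightarrow> p \<in> ball p0 e3"
      using e1 e2 e3 by (auto simp: e_def)
    \<comment> \<open>The curvature is -(\<tau>' - rho/(p - p0)^2)/q beside the line. Clearing the
      denominators leaves rho as a constant, while the left-hand side tends to zero for p tending to
      p0.\<close>
    have hp: "(p - p0)\<^sup>2 * (q * h (p, q) + deriv \<tau> p) = rho" if p: "p \<in> ball p0 e" "p \<noteq> p0" for p
    proof -
      have p1: "p \<in> ball p0 e1 - {p0}" using e(2)[OF p(1)] p(2) by blast
      have "\<forall>s\<in>insert \<sigma>0 (roots p). N p s \<noteq> 0" using e2(2) e(3)[OF p(1)] p(2) by blast
      with bspec[OF T p1] obtain V \<xi> where "(p, q) \<in> V" "web_slopes F (Suc m) V \<xi>"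
        using web_exists[of p q] q by auto
      then have w: "web_curvature_at F (Suc m) (p, q) (curvature (Suc m) (slope_form \<xi>) (p, q))"
        unfolding web_curvature_at_def by (intro exI[of _ V] exI[of _ \<xi>]) simp
      have "h (p, q) = - (deriv \<tau> p - rho / (p - p0)\<^sup>2) / q"
        using K[OF w p1 q] h[OF e3(2)[OF e(4)[OF p(1)]] w] by simp
      then show ?thesis using p(2) q by (simp add: field_simps)
    qed
    have "isCont (\<lambda>p. h (p, q)) p0"
    proof -
      obtain a b where "(h has_derivative (\<lambda>(h, k). a * h + b * k)) (at (p0, q))"
        using U(2,3) unfolding holomorphic2_on_def by auto
      from DERIV_isCont[OF has_field_derivative_slices(1)[OF this]] show ?thesis .
    qed
    then have c1: "((\<lambda>p. h (p, q)) \<longlongrightarrow> h (p0, q)) (at p0)" by (simp add: isCont_def)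
    have "deriv \<tau> holomorphic_on ball p0 e1" using e1(2) by (intro holomorphic_deriv) auto
    then have c2: "(deriv \<tau> \<longlongrightarrow> deriv \<tau> p0) (at p0)"
      using holomorphic_on_imp_continuous_on[of "deriv \<tau>" "ball p0 e1"] e1(1)
      by (simp add: continuous_on_eq_continuous_at isCont_def)
    have "((\<lambda>p. (p - p0)\<^sup>2 * (q * h (p, q) + deriv \<tau> p)) \<longlongrightarrow> (p0 - p0)\<^sup>2 * (q * h (p0, q) + deriv \<tau> p0)) (at p0)"
      by (intro tendsto_intros c1 c2)
    moreover have "\<forall>\<^sub>F p in at p0. (p - p0)\<^sup>2 * (q * h (p, q) + deriv \<tau> p) = rho"
      unfolding eventually_at by (rule exI[of _ e]) (use e(1) hp in \<open>auto simp: dist_commute\<close>)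
    ultimately have "((\<lambda>_. rho) \<longlongrightarrow> 0) (at p0)"
      by (simp add: tendsto_cong)
    then show "rho = 0" by (simp add: tendsto_const_iff)
  qed
qed

text \<open>The point with q = 0, at which the local description fails, is put into the finite
  exceptional set; conversely some nonzero q avoids any given finite set.\<close>

corollary curvature_holomorphic_on_iff:
  "curvature_holomorphic_on F (Suc m) {(p, q). p = p0} \<longleftrightarrow> rho = 0"
proof
  assume "rho = 0"
  then have "\<forall>z\<in>{(p, q). p = p0} - {(p0, 0)}. curvature_holomorphic_at F (Suc m) z"
    using curvature_holomorphic_at_iff by auto
  then show "curvature_holomorphic_on F (Suc m) {(p, q). p = p0}"
    unfolding curvature_holomorphic_on_def by blast
next
  assume "curvature_holomorphic_on F (Suc m) {(p, q). p = p0}"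
  then obtain S where S: "finite S" "\<And>z. z \<in> {(p, q). p = p0} - S \<Longrightarrow> curvature_holomorphic_at F (Suc m) z"
    unfolding curvature_holomorphic_on_def by blast
  have "\<exists>q. q \<notin> insert 0 (snd ` S)"
    by (rule ex_new_if_finite) (use S(1) in \<open>auto simp: infinite_UNIV_char_0\<close>)
  then obtain q where "q \<notin> insert 0 (snd ` S)" by blast
  then have "q \<noteq> 0" "(p0, q) \<notin> S" by (auto intro: rev_image_eqI)
  then show "rho = 0" using S(2)[of "(p0, q)"] curvature_holomorphic_at_iff by blast
qed

end

subsection \<open>From forms to the chart\<close>

lemma ev_all_zero:
  assumes "\<And>x y. ev P x y = 0"
  shows "P = 0"
proof -
  have "poly (map_poly (\<lambda>f. poly f x) P) y = ev P x y" for x y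
    by (induction P) (simp_all add: ev_pCons map_poly_pCons)
  then have "map_poly (\<lambda>f. poly f x) P = 0" for x
    using assms poly_all_0_iff_0 by metis
  then have "poly (coeff P j) x = 0" for j x
    by (metis coeff_0 coeff_map_poly poly_0)
  then have "coeff P j = 0" for j
    using poly_all_0_iff_0 by blast
  then show ?thesis by (simp add: poly_eq_iff)
qed

lemma chart_nonzero:
  assumes hom: "homogeneous k P" and "P \<noteq> 0"
  shows "chart \<kappa> P \<noteq> 0"
proof
  assume 0: "chart \<kappa> P = 0"
  have *: "ev P x y = 0" if "\<kappa> * x - y \<noteq> 0" for x y
  proof -
    define t where "t = \<kappa> * x - y"
    have "t \<noteq> 0" using that by (simp add: t_def)
    then have "x = t * (x / t)" "y = t * (\<kappa> * (x / t) - 1)"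
      by (simp_all add: t_def field_simps)
    then have "ev P x y = t ^ k * poly (chart \<kappa> P) (x / t)"
      using ev_homogeneous[OF hom] by (metis poly_chart)
    then show ?thesis using 0 by simp
  qed
  \<comment> \<open>The chart says nothing about the direction (1, \<kappa>); multiplication by the
    linear form that vanishes there covers this direction too.\<close>
  have "root_form 1 \<kappa> * P = 0"
  proof (rule ev_all_zero)
    show "ev (root_form 1 \<kappa> * P) x y = 0" for x y
      using *[of x y] by (cases "\<kappa> * x = y") auto
  qed
  then show False using root_form_nonzero[of 1 \<kappa>] \<open>P \<noteq> 0\<close> by simp
qed

text \<open>If x A + y B = 0, then A = y C and B = -x C, so C is a unit by coprimality; but C has
  degree k - 1, which is positive, and vanishes at the origin. In degree one, A = y and B = -x is a
  counterexample.\<close>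

lemma radial_form_nonzero:
  assumes hom: "homogeneous k A" "homogeneous k B" and cop: "coprime A B" and k: "k \<ge> 2"
  shows "varX * A + varY * B \<noteq> 0"
proof
  assume 0: "varX * A + varY * B = 0"
  then have e: "x * ev A x y + y * ev B x y = 0" for x y
  proof -
    have "ev (varX * A + varY * B) x y = 0" unfolding 0 by simp
    then show ?thesis by simp
  qed
  have "root_form 1 0 dvd A"
    by (rule root_form_dvd[OF hom(1)]) (use e[of 1 0] in auto)
  then obtain C where C: "A = root_form 1 0 * C" by (elim dvdE)
  have "root_form 1 0 = varY" by (simp add: root_form_def cst_def varX_def varY_def)
  with C have C: "A = varY * C" by simp
  have "varY * (varX * C + B) = 0" using 0 by (simp add: C algebra_simps)
  moreover have "varY \<noteq> 0" by (simp add: varY_def)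
  ultimately have B: "B = - (varX * C)"
    by (simp add: eq_neg_iff_add_eq_0 add.commute)
  have "C dvd A" "C dvd B" by (simp_all add: C B)
  then have "C dvd 1" using cop coprime_common_divisor by blast
  then obtain E where E: "1 = C * E" by (elim dvdE)
  have A0: "A \<noteq> 0"
  proof
    assume "A = 0"
    then have "C = 0" using C \<open>varY \<noteq> 0\<close> by simp
    then show False using E by simp
  qed
  have hY: "homogeneous 1 varY"
    using homogeneous_root_form[of 1 0] \<open>root_form 1 0 = varY\<close> by simp
  have "homogeneous k (varY * C)" "C \<noteq> 0" using hom(1) C A0 by auto
  then have "homogeneous (k - 1) C"
    by (intro homogeneous_cofactor(2)[OF _ hY \<open>varY \<noteq> 0\<close>])
  then have "ev C (0 * 1) (0 * 1) = 0 ^ (k - 1) * ev C 1 1" by (rule ev_homogeneous)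
  then have "ev C 0 0 = 0" using k by (simp add: power_0_left)
  then show False using arg_cong[OF E, of "\<lambda>P. ev P 0 0"] by simp
qed

lemma leg_homogeneous:
  assumes hom: "homogeneous m A" "homogeneous m B" and "y = p * x - q" "x = t * u" "y = t * v"
  shows "leg \<alpha> \<beta> A B (p, q) x = t ^ Suc m * (\<alpha> * u + \<beta> * v) * (ev A u v + p * ev B u v)"
proof -
  have "leg \<alpha> \<beta> A B (p, q) x = (\<alpha> * x + \<beta> * y) * (ev A x y + p * ev B x y)"
    by (simp add: leg_def assms(3))
  then show ?thesis
    unfolding assms(4,5) by (simp add: ev_homogeneous[OF hom(1)] ev_homogeneous[OF hom(2)] algebra_simps)
qed

text \<open>At t (\<beta>, -\<alpha>) the tangent line of the leaf is y = p0 x - t w with w = p0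
  \<beta> + \<alpha>. If w is nonzero, these lines sweep out p = p0 without q = 0, which the closure
  restores. If w = 0, the line is invariant and p0 is its slope.\<close>

lemma D_ell_eq:
  assumes hom: "homogeneous m A" "homogeneous m B" and m: "m \<ge> 1" and \<alpha>\<beta>: "(\<alpha>, \<beta>) \<noteq> (0, 0)"
    and A: "ev A \<beta> (- \<alpha>) = - p0 * ev B \<beta> (- \<alpha>)" and B: "ev B \<beta> (- \<alpha>) \<noteq> 0"
  shows "D_ell \<alpha> \<beta> A B = {(p, q). p = p0}"
proof -
  have ell: "(x, y) \<in> ell \<alpha> \<beta> \<longleftrightarrow> (\<exists>t. x = t * \<beta> \<and> y = t * (- \<alpha>))" for x y
  proof
    assume "(x, y) \<in> ell \<alpha> \<beta>"
    then have e: "\<alpha> * x + \<beta> * y = 0" by (simp add: ell_def)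
    show "\<exists>t. x = t * \<beta> \<and> y = t * (- \<alpha>)"
    proof (cases "\<beta> = 0")
      case True
      then show ?thesis using e \<alpha>\<beta> by (intro exI[of _ "- y / \<alpha>"]) auto
    next
      case False
      then have "y = - (\<alpha> * x / \<beta>)" using e by (simp add: field_simps eq_neg_iff_add_eq_0 add.commute)
      then show ?thesis using False by (intro exI[of _ "x / \<beta>"]) auto
    qed
  qed (auto simp: ell_def)
  have hA: "ev A (t * \<beta>) (t * (- \<alpha>)) = t ^ m * (- p0 * ev B \<beta> (- \<alpha>))"
    and hB: "ev B (t * \<beta>) (t * (- \<alpha>)) = t ^ m * ev B \<beta> (- \<alpha>)" for t
    using ev_homogeneous[OF hom(1)] ev_homogeneous[OF hom(2)] A by metis+
  define w where "w = p0 * \<beta> + \<alpha>"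
  have inv: "ell_invariant \<alpha> \<beta> A B \<longleftrightarrow> w = 0"
  proof -
    have e: "ev A (t * \<beta>) (t * (- \<alpha>)) * \<beta> + ev B (t * \<beta>) (t * (- \<alpha>)) * (- \<alpha>) = - (t ^ m * ev B \<beta> (- \<alpha>) * w)" for t
      unfolding hA hB w_def by (simp add: algebra_simps)
    show ?thesis
    proof
      assume "ell_invariant \<alpha> \<beta> A B"
      moreover have "(1 * \<beta>, 1 * (- \<alpha>)) \<in> ell \<alpha> \<beta>" using ell by blast
      ultimately have "ev A (1 * \<beta>) (1 * (- \<alpha>)) * \<beta> + ev B (1 * \<beta>) (1 * (- \<alpha>)) * (- \<alpha>) = 0"
        unfolding ell_invariant_def by fast
      then show "w = 0" unfolding e using B by simp
    next
      assume "w = 0"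
      then show "ell_invariant \<alpha> \<beta> A B"
        unfolding ell_invariant_def using ell e by fastforce
    qed
  qed
  show ?thesis
  proof (cases "w = 0")
    case True
    then have "\<beta> \<noteq> 0" "- \<alpha> = p0 * \<beta>" using \<alpha>\<beta> by (auto simp: w_def add_eq_0_iff2)
    then have "{(p, q). - \<alpha> = p * \<beta> - q * 0} = {(p, q :: complex). p = p0}"
      by auto
    then show ?thesis using True inv by (simp add: D_ell_def)
  next
    case False
    have line: "{(x', y'). y' = p * x' - q} =
        {(x', y'). ev A (t * \<beta>) (t * (- \<alpha>)) * (x' - t * \<beta>) + ev B (t * \<beta>) (t * (- \<alpha>)) * (y' - t * (- \<alpha>)) = 0}
        \<longleftrightarrow> p = p0 \<and> q = t * w" if "t \<noteq> 0" for p q t :: complex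
    proof -
      have "ev A (t * \<beta>) (t * (- \<alpha>)) * (x' - t * \<beta>) + ev B (t * \<beta>) (t * (- \<alpha>)) * (y' - t * (- \<alpha>)) =
          (t ^ m * ev B \<beta> (- \<alpha>)) * (y' - (p0 * x' - t * w))" for x' y'
        unfolding hA hB w_def by (simp add: algebra_simps)
      then have "{(x', y'). ev A (t * \<beta>) (t * (- \<alpha>)) * (x' - t * \<beta>) + ev B (t * \<beta>) (t * (- \<alpha>)) * (y' - t * (- \<alpha>)) = 0} =
          {(x', y'). y' = p0 * x' - t * w}"
        using that B by auto
      moreover have "{(x' :: complex, y'). y' = p * x' - q} = {(x', y'). y' = p0 * x' - t * w} \<longleftrightarrow> p = p0 \<and> q = t * w"
      proof
        assume "{(x' :: complex, y'). y' = p * x' - q} = {(x', y'). y' = p0 * x' - t * w}"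
        then have *: "p * x - q = p0 * x - t * w" for x :: complex
          by (auto simp: set_eq_iff)
        from *[of 0] *[of 1] show "p = p0 \<and> q = t * w" by simp
      qed simp
      ultimately show ?thesis by simp
    qed
    have nz: "(ev A (t * \<beta>) (t * (- \<alpha>)), ev B (t * \<beta>) (t * (- \<alpha>))) \<noteq> (0, 0) \<longleftrightarrow> t \<noteq> 0" for t
      unfolding hA hB using B m by (auto simp: power_0_left)
    have "{(p, q). \<exists>(x, y)\<in>ell \<alpha> \<beta>. (ev A x y, ev B x y) \<noteq> (0, 0) \<and>
       {(x', y'). y' = p * x' - q} =
       {(x', y'). ev A x y * (x' - x) + ev B x y * (y' - y) = 0}} = {p0} \<times> - {0}" (is "?S = _")
    proof -
      have "(p, q) \<in> ?S \<longleftrightarrow> (\<exists>t. t \<noteq> 0 \<and> p = p0 \<and> q = t * w)" for p q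
      proof
        assume "(p, q) \<in> ?S"
        then obtain x y where xy: "(x, y) \<in> ell \<alpha> \<beta>" "(ev A x y, ev B x y) \<noteq> (0, 0)"
          "{(x', y'). y' = p * x' - q} = {(x', y'). ev A x y * (x' - x) + ev B x y * (y' - y) = 0}"
          by blast
        then obtain t where t: "x = t * \<beta>" "y = t * (- \<alpha>)" using ell by blast
        have "t \<noteq> 0" using xy(2) nz[of t] unfolding t by blast
        moreover have "p = p0 \<and> q = t * w" using xy(3) line[OF \<open>t \<noteq> 0\<close>] unfolding t by blast
        ultimately show "\<exists>t. t \<noteq> 0 \<and> p = p0 \<and> q = t * w" by blast
      next
        assume "\<exists>t. t \<noteq> 0 \<and> p = p0 \<and> q = t * w"
        then obtain t where t: "t \<noteq> 0" "p = p0 \<and> q = t * w" by blast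
        have "(t * \<beta>, t * (- \<alpha>)) \<in> ell \<alpha> \<beta>" using ell by blast
        moreover have "(ev A (t * \<beta>) (t * (- \<alpha>)), ev B (t * \<beta>) (t * (- \<alpha>))) \<noteq> (0, 0)" using nz t(1) by blast
        moreover note line[OF t(1), THEN iffD2, OF t(2)]
        ultimately show "(p, q) \<in> ?S" by blast
      qed
      moreover have "(\<exists>t. t \<noteq> 0 \<and> p = p0 \<and> q = t * w) \<longleftrightarrow> (p, q) \<in> {p0} \<times> - {0}" for p q
        using False by (auto intro: exI[of _ "q / w"])
      ultimately show ?thesis by (simp only: set_eq_iff split_paired_All simp_thms)
    qed
    then have "D_ell \<alpha> \<beta> A B = closure ({p0} \<times> - {0})"
      using False inv by (simp add: D_ell_def)
    also have "\<dots> = {(p, q). p = p0}"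
      by (auto simp: closure_Times closure_complement)
    finally show ?thesis .
  qed
qed

lemma gauss_eq_iff:
  assumes hom: "homogeneous k A" "homogeneous k B" and cop: "coprime A B" and "(x, y) \<noteq> (0, 0)"
  shows "gauss A B (pt y x) = pt p 1 \<longleftrightarrow> ev A x y + p * ev B x y = 0"
proof -
  have "(- ev A x y, ev B x y) \<noteq> (0, 0)"
    using coprime_no_common_zero[OF hom cop assms(4)] by auto
  then show ?thesis
    by (simp add: gauss_pt[OF hom] pt_eq_iff neg_eq_iff_add_eq_0)
qed

lemma leg_chart_leg:
  assumes hom: "homogeneous m A" "homogeneous m B" and cop: "coprime A B" and m: "m \<ge> 2"
    and p0: "ev A \<beta> (- \<alpha>) + p0 * ev B \<beta> (- \<alpha>) = 0"
    and lead: "ev A 1 \<kappa> + p0 * ev B 1 \<kappa> \<noteq> 0" and \<tau>: "\<kappa> * \<beta> + \<alpha> \<noteq> 0"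
  shows "leg_chart m (chart \<kappa> A) (chart \<kappa> B) \<kappa> (\<beta> / (\<kappa> * \<beta> + \<alpha>)) p0 (leg \<alpha> \<beta> A B)"
proof
  let ?\<tau> = "\<kappa> * \<beta> + \<alpha>" and ?A = "chart \<kappa> A" and ?B = "chart \<kappa> B"
  let ?\<sigma> = "\<beta> / ?\<tau>"
  show "m \<ge> 2" by (rule m)
  show "degree ?A \<le> m" "degree ?B \<le> m" by (rule degree_chart_le[OF hom(1)], rule degree_chart_le[OF hom(2)])
  show "coeff (?A + smult p0 ?B) m \<noteq> 0" using lead by (simp add: coeff_chart[OF hom(1)] coeff_chart[OF hom(2)])
  show "poly ?B s \<noteq> 0" if "poly ?A s = 0" for s
  proof -
    have "(s, \<kappa> * s - 1) \<noteq> (0, 0)" by auto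
    from coprime_no_common_zero[OF hom cop this] show ?thesis using that by (simp add: poly_chart)
  qed
  have \<sigma>: "\<beta> = ?\<tau> * ?\<sigma>" "- \<alpha> = ?\<tau> * (\<kappa> * ?\<sigma> - 1)"
    using \<tau> by (simp_all add: field_simps)
  have "?\<tau> ^ m * (ev A ?\<sigma> (\<kappa> * ?\<sigma> - 1) + p0 * ev B ?\<sigma> (\<kappa> * ?\<sigma> - 1)) = ev A \<beta> (- \<alpha>) + p0 * ev B \<beta> (- \<alpha>)"
    using ev_homogeneous[OF hom(1), of ?\<tau> ?\<sigma> "\<kappa> * ?\<sigma> - 1"] ev_homogeneous[OF hom(2), of ?\<tau> ?\<sigma> "\<kappa> * ?\<sigma> - 1"] \<sigma>
    by (simp only: distrib_left mult.left_commute)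
  then have "?\<tau> ^ m * (ev A ?\<sigma> (\<kappa> * ?\<sigma> - 1) + p0 * ev B ?\<sigma> (\<kappa> * ?\<sigma> - 1)) = 0"
    using p0 by simp
  then show "poly (?A + smult p0 ?B) ?\<sigma> = 0"
    using \<tau> by (simp add: poly_chart)
  have "homogeneous 1 varX" "homogeneous 1 varY"
    by (auto simp: homogeneous_def varX_def varY_def coeff_pCons split: nat.splits)
  then have "homogeneous (1 + m) (varX * A + varY * B)"
    using hom by (intro homogeneous_add homogeneous_mult)
  from chart_nonzero[OF this radial_form_nonzero[OF hom cop m]]
  have "chart \<kappa> (varX * A + varY * B) \<noteq> 0" .
  moreover have "chart \<kappa> varX = [:0, 1:]" "chart \<kappa> varY = [:- 1, \<kappa>:]"
    by (simp_all add: chart_def varX_def varY_def)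
  ultimately show "[:0, 1:] * ?A + [:- 1, \<kappa>:] * ?B \<noteq> 0" by (simp only: chart_simps not_False_eq_True)
  show "leg \<alpha> \<beta> A B (p, q) x = 0 \<longleftrightarrow>
      x / (q + (\<kappa> - p) * x) = ?\<sigma> \<or> poly (?A + smult p ?B) (x / (q + (\<kappa> - p) * x)) = 0"
    if t: "q + (\<kappa> - p) * x \<noteq> 0" for p q x
  proof -
    define t where "t = q + (\<kappa> - p) * x"
    define s where "s = x / t"
    have t0: "t \<noteq> 0" using t by (simp add: t_def)
    have x: "x = t * s" "p * x - q = t * (\<kappa> * s - 1)"
      using t0 by (simp_all add: s_def t_def field_simps)
    have "leg \<alpha> \<beta> A B (p, q) x = t ^ Suc m * (\<alpha> * s + \<beta> * (\<kappa> * s - 1)) *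
        (ev A s (\<kappa> * s - 1) + p * ev B s (\<kappa> * s - 1))"
      by (rule leg_homogeneous[OF hom refl x])
    also have "\<alpha> * s + \<beta> * (\<kappa> * s - 1) = ?\<tau> * (s - ?\<sigma>)"
      using \<tau> by (simp add: field_simps)
    finally have "leg \<alpha> \<beta> A B (p, q) x = 0 \<longleftrightarrow> s = ?\<sigma> \<or> poly (?A + smult p ?B) s = 0"
      using t0 \<tau> by (simp add: poly_chart)
    then show ?thesis by (simp only: s_def t_def)
  qed
  show "leg \<alpha> \<beta> A B (p, q) x \<noteq> 0"
    if "coeff (?A + smult p ?B) m \<noteq> 0" "q \<noteq> 0" "q + (\<kappa> - p) * x = 0" for p q x
  proof -
    \<comment> \<open>Here (x, y) points in the missing direction (1, \<kappa>), so the web equation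
      is evaluated there instead of in the chart.\<close>
    have "p * x - q = x * \<kappa>" using that(3) by (simp add: algebra_simps)
    then have l: "leg \<alpha> \<beta> A B (p, q) x = x ^ Suc m * (\<alpha> * 1 + \<beta> * \<kappa>) * (ev A 1 \<kappa> + p * ev B 1 \<kappa>)"
      by (intro leg_homogeneous[OF hom refl]) auto
    have "x \<noteq> 0" using that(2,3) by auto
    then have x: "x ^ Suc m \<noteq> 0" by (rule power_not_zero)
    have "\<alpha> * 1 + \<beta> * \<kappa> = ?\<tau>" by (simp add: algebra_simps)
    then have t: "\<alpha> * 1 + \<beta> * \<kappa> \<noteq> 0" using \<tau> by metis
    have c: "ev A 1 \<kappa> + p * ev B 1 \<kappa> \<noteq> 0"
      using that(1) by (simp add: coeff_chart[OF hom(1)] coeff_chart[OF hom(2)])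
    show ?thesis
      unfolding l by (intro no_zero_divisors x t c)
  qed
qed

text \<open>Treats the direction of the line and the other points of the fibre alike. The condition
  on u1 is harmless for the criterion: at an unramified point the weight \<nu> - 1 is zero on the
  line, and elsewhere the factor 1 - 1/\<nu> removes the quotient.\<close>

lemma fibre_point_data:
  assumes hom: "homogeneous m A" "homogeneous m B" and cop: "coprime A B"
    and XY: "(X, Y) \<noteq> (0, 0)" and zero: "ev A X Y + p0 * ev B X Y = 0"
    and lead: "ev A 1 \<kappa> + p0 * ev B 1 \<kappa> \<noteq> 0"
  defines "\<tau> \<equiv> \<kappa> * X - Y" and "r \<equiv> ramification_index (gauss A B) (pt Y X)"
  defines "c \<equiv> X / \<tau>" and "Pr \<equiv> P_pt A B Y X r"
  obtains K where "\<tau> \<noteq> 0" "ev B X Y \<noteq> 0" "r \<ge> 1" "chart \<kappa> A + smult p0 (chart \<kappa> B) = [:- c, 1:] ^ r * K" "poly K c \<noteq> 0"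
    "\<forall>u1 u2. r \<noteq> 1 \<or> u1 = 0 \<longrightarrow> \<tau> * point_quotient A B Pr X Y u1 u2 =
      chart_quotient \<kappa> p0 B K m (of_nat m - of_nat r) c u1 u2"
proof -
  let ?D = "A + cst p0 * B"
  have evD: "ev ?D x y = ev A x y + p0 * ev B x y" for x y by simp
  have homD: "homogeneous m ?D"
    using homogeneous_add[OF hom(1)] homogeneous_mult[OF homogeneous_cst hom(2)] by simp
  have D0: "?D \<noteq> 0"
  proof
    assume "?D = 0"
    then have "ev ?D 1 \<kappa> = 0" by (simp only: ev_zero)
    then show False using lead by simp
  qed
  have A: "ev A X Y = - p0 * ev B X Y" using zero by (simp add: eq_neg_iff_add_eq_0)
  then have B: "ev B X Y \<noteq> 0" using coprime_no_common_zero[OF hom cop XY] by auto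
  have \<tau>0: "\<tau> \<noteq> 0"
  proof
    assume "\<tau> = 0"
    then have Y: "Y = X * \<kappa>" by (simp add: \<tau>_def mult.commute)
    then have "X ^ m * (ev A 1 \<kappa> + p0 * ev B 1 \<kappa>) = 0"
      using zero ev_homogeneous[OF hom(1), of X 1 \<kappa>] ev_homogeneous[OF hom(2), of X 1 \<kappa>]
      by (simp add: algebra_simps)
    then show False using lead XY Y by auto
  qed
  obtain \<nu> P where P: "?D = root_form X Y ^ \<nu> * P" "\<nu> \<le> m" "homogeneous (m - \<nu>) P" "ev P X Y \<noteq> 0"
    using homogeneous_factor_root[OF homD D0 XY] .
  have "gauss A B (pt Y X) = pt p0 1" using gauss_eq_iff[OF hom cop XY] zero by simp
  from ramification_index_gauss[OF hom cop XY this P(1,3,4)] have r: "r = \<nu>" by (simp add: r_def)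
  have r1: "r \<ge> 1"
  proof (rule ccontr)
    assume "\<not> r \<ge> 1"
    then have "\<nu> = 0" using r by simp
    then have "?D = P" using P(1) by simp
    then show False using P(4) zero evD by metis
  qed
  have XYc: "X = \<tau> * c" "Y = \<tau> * (\<kappa> * c - 1)"
    using \<tau>0 by (simp_all add: c_def \<tau>_def field_simps)
  have Pr: "Pr = cst (ev B X Y) * P"
    unfolding Pr_def r by (rule P_pt_eq[OF XY A P(1)])
  define K where "K = smult (\<tau> ^ \<nu>) (chart \<kappa> P)"
  have ml: "m - \<nu> + \<nu> = m" using P(2) by simp
  have QC: "u1 = 0 \<or> poly (pderiv (chart \<kappa> ?D)) c = 0 \<Longrightarrow>
      \<tau> * point_quotient A B Pr X Y u1 u2 = chart_quotient \<kappa> p0 B K m (of_nat (m - \<nu>)) c u1 u2" for u1 u2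
    unfolding Pr K_def by (rule ev_quotient_chart(4)[OF hom P(3) ml XYc \<tau>0 P(1) A B P(4)])
  note F = ev_quotient_chart(1,2)[OF hom P(3) ml XYc \<tau>0 P(1) A B P(4), of 0, folded K_def]
  have fac: "chart \<kappa> A + smult p0 (chart \<kappa> B) = [:- c, 1:] ^ r * K" and K: "poly K c \<noteq> 0"
    using F by (simp_all add: r)
  have pd: "poly (pderiv (chart \<kappa> ?D)) c = 0" if "r \<noteq> 1"
  proof -
    define n where "n = r - 2"
    have n: "r = Suc (Suc n)" using that r1 by (simp add: n_def)
    have "chart \<kappa> ?D = [:- c, 1:] ^ r * K" using fac by simp
    then show ?thesis by (simp add: n pderiv_mult del: mult_pCons_left mult_pCons_right)
  qed
  have "of_nat (m - \<nu>) = (of_nat m - of_nat r :: complex)" using P(2) r by (simp add: of_nat_diff)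
  note QC = QC[unfolded this]
  show ?thesis
  proof (rule that[OF \<tau>0 B r1 fac K], intro allI impI)
    fix u1 u2 :: complex
    assume "r \<noteq> 1 \<or> u1 = 0"
    then have "u1 = 0 \<or> poly (pderiv (chart \<kappa> ?D)) c = 0" using pd by blast
    then show "\<tau> * point_quotient A B Pr X Y u1 u2 =
        chart_quotient \<kappa> p0 B K m (of_nat m - of_nat r) c u1 u2"
      by (rule QC)
  qed
qed

section \<open>The criterion in the original coordinates\<close>

theorem theorem3p18:
  fixes d n :: nat
    and \<alpha> \<beta> p\<^sub>0 :: complex
    and A B :: bpoly
    and a b :: "nat \<Rightarrow> complex"
    and \<nu> :: "nat \<Rightarrow> nat"
  assumes "d \<ge> 3"
    and "(\<alpha>, \<beta>) \<noteq> (0, 0)"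
    and "homogeneous (d - 1) A" and "homogeneous (d - 1) B"
    and "coprime A B"
    and "\<And>i. i \<in> {1..n} \<Longrightarrow> (a i, b i) \<noteq> (0, 0)"
    and "{P \<in> P1. gauss A B P = gauss A B (pt (- \<alpha>) \<beta>)} =
           insert (pt (- \<alpha>) \<beta>) ((\<lambda>i. pt (a i) (b i)) ` {1..n})"
    and "inj_on (\<lambda>i. pt (a i) (b i)) {1..n}"
    and "pt (- \<alpha>) \<beta> \<notin> (\<lambda>i. pt (a i) (b i)) ` {1..n}"
    and "\<nu> 0 = ramification_index (gauss A B) (pt (- \<alpha>) \<beta>)"
    and "\<And>i. i \<in> {1..n} \<Longrightarrow> \<nu> i = ramification_index (gauss A B) (pt (a i) (b i))"
    and "gauss A B (pt (- \<alpha>) \<beta>) \<noteq> inf_pt"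
    and "pt p\<^sub>0 1 = gauss A B (pt (- \<alpha>) \<beta>)"
  shows "curvature_holomorphic_on (leg \<alpha> \<beta> A B) d (D_ell \<alpha> \<beta> A B) \<longleftrightarrow>
    (1 + 1 / of_nat (\<nu> 0)) *
      ((\<alpha> + p\<^sub>0 * \<beta>) * ev (Q_ell A B \<alpha> \<beta> (\<nu> 0)) \<beta> (- \<alpha>) /
       (ev B \<beta> (- \<alpha>) * ev (P_ell A B \<alpha> \<beta> (\<nu> 0)) \<beta> (- \<alpha>))) +
    (\<Sum>i = 1..n. (1 - 1 / of_nat (\<nu> i)) * (p\<^sub>0 * b i - a i) *
      (ev (Q_pt A B (a i) (b i) (\<nu> i)) (b i) (a i) /
         (ev B (b i) (a i) * ev (P_pt A B (a i) (b i) (\<nu> i)) (b i) (a i)) +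
       3 * of_nat (\<nu> i) * (\<alpha> + p\<^sub>0 * \<beta>) / (\<alpha> * b i + \<beta> * a i))) = 0"
proof -
  define m where "m = d - 1"
  have m: "m \<ge> 2" and d: "d = Suc m" using assms(1) by (auto simp: m_def)
  have homA: "homogeneous m A" and homB: "homogeneous m B" using assms(3,4) by (simp_all add: m_def)
  note hom = homA homB and cop = assms(5)
  have fin: "finite (insert (pt (- \<alpha>) \<beta>) ((\<lambda>i. pt (a i) (b i)) ` {1..n}))" by simp
  have inj: "inj (\<lambda>\<kappa>. pt \<kappa> 1)" by (rule injI) (simp add: pt_eq_iff)
  have "finite {\<kappa>. pt \<kappa> 1 \<in> insert (pt (- \<alpha>) \<beta>) ((\<lambda>i. pt (a i) (b i)) ` {1..n})}"
    using finite_vimageI[OF fin inj] by (simp add: vimage_def)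
  \<comment> \<open>The fibre over p0 is finite, so some finite slope \<kappa> lies outside it; then
    the direction missing from the chart is no point of the fibre.\<close>
  then obtain \<kappa> where "\<kappa> \<notin> {\<kappa>. pt \<kappa> 1 \<in> insert (pt (- \<alpha>) \<beta>) ((\<lambda>i. pt (a i) (b i)) ` {1..n})}"
    using ex_new_if_finite[OF infinite_UNIV_char_0] by blast
  then have "pt \<kappa> 1 \<notin> {P \<in> P1. gauss A B P = pt p\<^sub>0 1}"
    using assms(7,13) by simp
  moreover have "pt \<kappa> 1 \<in> P1"
    unfolding P1_def by (intro CollectI exI[of _ \<kappa>] exI[of _ 1]) simp
  ultimately have "gauss A B (pt \<kappa> 1) \<noteq> pt p\<^sub>0 1" by simp
  then have lead: "ev A 1 \<kappa> + p\<^sub>0 * ev B 1 \<kappa> \<noteq> 0"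
    using gauss_eq_iff[OF hom cop, of 1 \<kappa>] by simp
  have fibre: "pt y x \<in> insert (pt (- \<alpha>) \<beta>) ((\<lambda>i. pt (a i) (b i)) ` {1..n}) \<longleftrightarrow> ev A x y + p\<^sub>0 * ev B x y = 0"
    if "(x, y) \<noteq> (0, 0)" for x y
  proof -
    have "pt y x \<in> P1" using that unfolding P1_def by blast
    then show ?thesis
      unfolding assms(7)[symmetric] assms(13)[symmetric] using gauss_eq_iff[OF hom cop that] by simp
  qed
  have \<alpha>\<beta>: "(\<beta>, - \<alpha>) \<noteq> (0, 0)" using assms(2) by auto
  have z0: "ev A \<beta> (- \<alpha>) + p\<^sub>0 * ev B \<beta> (- \<alpha>) = 0" using fibre[OF \<alpha>\<beta>] by simp
  have ab: "(b i, a i) \<noteq> (0, 0)" if "i \<in> {1..n}" for i using assms(6)[OF that] by auto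
  have zi: "ev A (b i) (a i) + p\<^sub>0 * ev B (b i) (a i) = 0" if "i \<in> {1..n}" for i
    using fibre[OF ab[OF that]] that by blast
  define \<tau> where "\<tau> = \<kappa> * \<beta> + \<alpha>"
  define \<sigma> where "\<sigma> = \<beta> / \<tau>"
  obtain K0 where K0: "\<kappa> * \<beta> - - \<alpha> \<noteq> 0" "ev B \<beta> (- \<alpha>) \<noteq> 0" "\<nu> 0 \<ge> 1"
    "chart \<kappa> A + smult p\<^sub>0 (chart \<kappa> B) = [:- (\<beta> / (\<kappa> * \<beta> - - \<alpha>)), 1:] ^ \<nu> 0 * K0"
    "poly K0 (\<beta> / (\<kappa> * \<beta> - - \<alpha>)) \<noteq> 0" and Q0: "\<forall>u1 u2. \<nu> 0 \<noteq> 1 \<or> u1 = 0 \<longrightarrow>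
      (\<kappa> * \<beta> - - \<alpha>) * point_quotient A B (P_pt A B (- \<alpha>) \<beta> (\<nu> 0)) \<beta> (- \<alpha>) u1 u2 =
      chart_quotient \<kappa> p\<^sub>0 B K0 m (of_nat m - of_nat (\<nu> 0)) (\<beta> / (\<kappa> * \<beta> - - \<alpha>)) u1 u2"
    unfolding assms(10) by (rule fibre_point_data[OF hom cop \<alpha>\<beta> z0 lead])
  have e\<tau>: "\<kappa> * \<beta> - - \<alpha> = \<tau>" by (simp add: \<tau>_def)
  note K0 = K0[unfolded e\<tau>, folded \<sigma>_def] and Q0 = Q0[unfolded e\<tau>, folded \<sigma>_def]
  interpret L: leg_chart m "chart \<kappa> A" "chart \<kappa> B" \<kappa> \<sigma> p\<^sub>0 "leg \<alpha> \<beta> A B"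
    unfolding \<sigma>_def \<tau>_def using K0(1) by (intro leg_chart_leg[OF hom cop m z0 lead]) (simp add: \<tau>_def)
  have "ev A \<beta> (- \<alpha>) = - p\<^sub>0 * ev B \<beta> (- \<alpha>)" using z0 by (simp add: eq_neg_iff_add_eq_0)
  then have D: "D_ell \<alpha> \<beta> A B = {(p, q). p = p\<^sub>0}"
    using D_ell_eq[OF hom _ assms(2) _ K0(2)] m by simp
  define s where "s i = b i / (\<kappa> * b i - a i)" for i
  define R where "R c = 6 * deriv (L.H c) c" for c
  have line: "(1 + 1 / of_nat (\<nu> 0)) *
      ((\<alpha> + p\<^sub>0 * \<beta>) * ev (Q_ell A B \<alpha> \<beta> (\<nu> 0)) \<beta> (- \<alpha>) /
       (ev B \<beta> (- \<alpha>) * ev (P_ell A B \<alpha> \<beta> (\<nu> 0)) \<beta> (- \<alpha>))) = R \<sigma>"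
  proof -
    let ?P = "P_pt A B (- \<alpha>) \<beta> (\<nu> 0)"
    have "L.Phi p\<^sub>0 = [:- \<sigma>, 1:] ^ \<nu> 0 * K0" unfolding L.Phi_def by (rule K0(4))
    note mc = L.mult_cofac_unique[OF this K0(5)]
    have w: "\<alpha> + p\<^sub>0 * \<beta> = \<tau> * L.N p\<^sub>0 \<sigma>"
      using K0(1) by (simp add: L.N_def \<sigma>_def field_simps) (simp add: \<tau>_def algebra_simps)
    have Q: "ev (Q_ell A B \<alpha> \<beta> (\<nu> 0)) \<beta> (- \<alpha>) / (ev B \<beta> (- \<alpha>) * ev ?P \<beta> (- \<alpha>)) =
        point_quotient A B ?P \<beta> (- \<alpha>) (of_nat (\<nu> 0) - 1) (2 * of_nat (\<nu> 0) + 1)"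
      by (simp add: Q_ell_def P_ell_eq_P_pt det2_def point_quotient_def)
    \<comment> \<open>At an unramified line the weight \<nu> 0 - 1 is zero, which is the admissible
      alternative in \<open>Q0\<close>.\<close>
    have "\<nu> 0 \<noteq> 1 \<or> of_nat (\<nu> 0) - 1 = (0 :: complex)" by auto
    note q = Q0[rule_format, of _ "2 * of_nat (\<nu> 0) + 1", OF this, folded Q, unfolded chart_quotient_def, folded L.N_def]
    have gen: "g * (t * N * x / y) = g * (N * z)" if "t * (x / y) = z" for g t N x y z :: complex
      unfolding that[symmetric] by simp
    show ?thesis
      unfolding R_def L.residue_at_line mc w P_ell_eq_P_pt by (rule gen[OF q])
  qed
  have off: "(1 - 1 / of_nat (\<nu> i)) * (p\<^sub>0 * b i - a i) *
      (ev (Q_pt A B (a i) (b i) (\<nu> i)) (b i) (a i) /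
         (ev B (b i) (a i) * ev (P_pt A B (a i) (b i) (\<nu> i)) (b i) (a i)) +
       3 * of_nat (\<nu> i) * (\<alpha> + p\<^sub>0 * \<beta>) / (\<alpha> * b i + \<beta> * a i)) = R (s i)"
    and root: "s i \<in> L.roots p\<^sub>0" "s i \<noteq> \<sigma>" "\<kappa> * b i - a i \<noteq> 0" if i: "i \<in> {1..n}" for i
  proof -
    let ?\<tau> = "\<kappa> * b i - a i"
    let ?P = "P_pt A B (a i) (b i) (\<nu> i)"
    obtain K where K: "?\<tau> \<noteq> 0" "ev B (b i) (a i) \<noteq> 0" "\<nu> i \<ge> 1"
      "chart \<kappa> A + smult p\<^sub>0 (chart \<kappa> B) = [:- s i, 1:] ^ \<nu> i * K" "poly K (s i) \<noteq> 0" and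
      Qi: "\<forall>u1 u2. \<nu> i \<noteq> 1 \<or> u1 = 0 \<longrightarrow> ?\<tau> * point_quotient A B ?P (b i) (a i) u1 u2 =
        chart_quotient \<kappa> p\<^sub>0 B K m (of_nat m - of_nat (\<nu> i)) (s i) u1 u2"
      unfolding assms(11)[OF i] s_def by (rule fibre_point_data[OF hom cop ab[OF i] zi[OF i] lead])
    show "?\<tau> \<noteq> 0" by (rule K)
    have bi: "b i = ?\<tau> * s i" "a i = ?\<tau> * (\<kappa> * s i - 1)"
      using K(1) by (simp_all add: s_def field_simps)
    have "poly ([:- s i, 1:] ^ \<nu> i * K) (s i) = 0" using K(3) by (simp add: power_0_left)
    then show rt: "s i \<in> L.roots p\<^sub>0" by (simp add: L.roots_def L.Phi_def K(4))
    have nl: "\<beta> * a i \<noteq> - (\<alpha> * b i)"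
    proof
      assume "\<beta> * a i = - (\<alpha> * b i)"
      then have "pt (a i) (b i) = pt (- \<alpha>) \<beta>"
        using assms(6)[OF i] assms(2) by (subst pt_eq_iff) (auto simp: mult.commute)
      then show False using assms(9) imageI[OF i, of "\<lambda>i. pt (a i) (b i)"] by simp
    qed
    have ds: "\<alpha> * b i + \<beta> * a i = ?\<tau> * \<tau> * (s i - \<sigma>)"
    proof -
      have b: "\<tau> * \<sigma> = \<beta>" using K0(1) by (simp add: \<sigma>_def)
      have "?\<tau> * \<tau> * (s i - \<sigma>) = \<tau> * (?\<tau> * s i) - ?\<tau> * (\<tau> * \<sigma>)" by algebra
      also have "\<dots> = \<tau> * b i - ?\<tau> * \<beta>" unfolding b bi(1)[symmetric] ..
      finally show ?thesis by (simp add: \<tau>_def algebra_simps)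
    qed
    show ne: "s i \<noteq> \<sigma>"
    proof
      assume "s i = \<sigma>"
      then have "\<alpha> * b i + \<beta> * a i = 0" using ds by simp
      then show False using nl by (simp only: add_eq_0_iff)
    qed
    have "L.Phi p\<^sub>0 = [:- s i, 1:] ^ \<nu> i * K" unfolding L.Phi_def by (rule K(4))
    note mc = L.mult_cofac_unique[OF this K(5)]
    have "?\<tau> * L.N p\<^sub>0 (s i) = ?\<tau> + (p\<^sub>0 - \<kappa>) * (?\<tau> * s i)"
      unfolding L.N_def by algebra
    also have "\<dots> = p\<^sub>0 * b i - a i" unfolding bi(1)[symmetric] by (simp add: algebra_simps)
    finally have w: "p\<^sub>0 * b i - a i = ?\<tau> * L.N p\<^sub>0 (s i)" ..
    have w0: "\<alpha> + p\<^sub>0 * \<beta> = \<tau> * L.N p\<^sub>0 \<sigma>"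
      using K0(1) by (simp add: L.N_def \<sigma>_def field_simps) (simp add: \<tau>_def algebra_simps)
    show "(1 - 1 / of_nat (\<nu> i)) * (p\<^sub>0 * b i - a i) *
      (ev (Q_pt A B (a i) (b i) (\<nu> i)) (b i) (a i) / (ev B (b i) (a i) * ev ?P (b i) (a i)) +
       3 * of_nat (\<nu> i) * (\<alpha> + p\<^sub>0 * \<beta>) / (\<alpha> * b i + \<beta> * a i)) = R (s i)"
    \<comment> \<open>At an unramified point both sides carry the factor 1 - 1/1 = 0; no identity
      for the quotient is available there.\<close>
    proof (cases "\<nu> i = 1")
      case True
      then show ?thesis unfolding R_def L.residue_off_line[OF rt ne] mc by simp
    next
      case False
      have Q: "ev (Q_pt A B (a i) (b i) (\<nu> i)) (b i) (a i) / (ev B (b i) (a i) * ev ?P (b i) (a i)) =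
          point_quotient A B ?P (b i) (a i) (of_nat (\<nu> i) - 2) (2 * (of_nat (\<nu> i) + 1))"
        by (simp add: Q_pt_def det2_def point_quotient_def)
      have "\<nu> i \<noteq> 1 \<or> of_nat (\<nu> i) - 2 = (0 :: complex)" using False by simp
      note q = Qi[rule_format, of _ "2 * (of_nat (\<nu> i) + 1)", OF this, folded Q, unfolded chart_quotient_def, folded L.N_def]
      have canc: "t * (g * (u * N) / (t * u * e)) = g * N / e" if "t \<noteq> 0" "u \<noteq> 0" for t u g N e :: complex
        using that by simp
      have f: "?\<tau> * (3 * of_nat (\<nu> i) * (\<alpha> + p\<^sub>0 * \<beta>) / (\<alpha> * b i + \<beta> * a i)) =
          3 * of_nat (\<nu> i) * L.N p\<^sub>0 \<sigma> / (s i - \<sigma>)" (is "_ = ?f")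
        unfolding w0 ds by (rule canc[OF K(1) K0(1)])
      have gen: "g * (t * N) * (x + y) = g * (N * (x' + y'))" if "t * x = x'" "t * y = y'" for g t N x y x' y' :: complex
        using that by (simp add: algebra_simps)
      show ?thesis
        unfolding R_def L.residue_off_line[OF rt ne] mc w by (rule gen[OF q f])
    qed
  qed
  \<comment> \<open>By the choice of \<kappa> the chart contains the whole fibre, so the listed
    points correspond exactly to the roots of \<open>Phi p\<^sub>0\<close> other than the direction
    of the line.\<close>
  have bij: "bij_betw s {1..n} (L.roots p\<^sub>0 - {\<sigma>})"
    unfolding bij_betw_def
  proof
    show "inj_on s {1..n}"
    proof (rule inj_onI)
      fix i j assume i: "i \<in> {1..n}" and j: "j \<in> {1..n}" and "s i = s j"
      then have "b i * (\<kappa> * b j - a j) = b j * (\<kappa> * b i - a i)"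
        using root(3) by (simp add: s_def frac_eq_eq)
      then have "a i * b j = a j * b i" by (simp add: algebra_simps)
      then have "pt (a i) (b i) = pt (a j) (b j)"
        using assms(6) i j by (subst pt_eq_iff) auto
      then show "i = j" using inj_onD[OF assms(8)] i j by auto
    qed
    show "s ` {1..n} = L.roots p\<^sub>0 - {\<sigma>}"
    proof (intro equalityI subsetI)
      fix x assume "x \<in> s ` {1..n}"
      then obtain i where "i \<in> {1..n}" "x = s i" by (rule imageE)
      then show "x \<in> L.roots p\<^sub>0 - {\<sigma>}" using root(1,2)[of i] by blast
    next
      fix c assume c: "c \<in> L.roots p\<^sub>0 - {\<sigma>}"
      then have "ev A c (\<kappa> * c - 1) + p\<^sub>0 * ev B c (\<kappa> * c - 1) = 0"
        by (simp add: L.roots_def L.poly_Phi poly_chart)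
      moreover have nz: "(c, \<kappa> * c - 1) \<noteq> (0, 0)" by auto
      ultimately have "pt (\<kappa> * c - 1) c \<in> insert (pt (- \<alpha>) \<beta>) ((\<lambda>i. pt (a i) (b i)) ` {1..n})"
        using fibre by blast
      moreover have "pt (\<kappa> * c - 1) c \<noteq> pt (- \<alpha>) \<beta>"
      proof
        assume "pt (\<kappa> * c - 1) c = pt (- \<alpha>) \<beta>"
        then have "(\<kappa> * c - 1) * \<beta> = - \<alpha> * c"
          using nz assms(2) by (subst (asm) pt_eq_iff) auto
        then have "c * \<tau> = \<beta>" by (simp add: \<tau>_def algebra_simps)
        then show False using c K0(1) by (auto simp: \<sigma>_def)
      qed
      ultimately obtain i where i: "i \<in> {1..n}" "pt (\<kappa> * c - 1) c = pt (a i) (b i)" by blast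
      then have "(\<kappa> * c - 1) * b i = a i * c"
        using nz assms(6)[OF i(1)] by (subst (asm) pt_eq_iff) auto
      then have "c * (\<kappa> * b i - a i) = b i" by (simp add: algebra_simps)
      then have "c = s i" using root(3)[OF i(1)] by (simp add: s_def eq_divide_eq)
      then show "c \<in> s ` {1..n}" using i(1) by blast
    qed
  qed
  have "(\<Sum>c\<in>L.roots p\<^sub>0. R c) = R \<sigma> + (\<Sum>c\<in>L.roots p\<^sub>0 - {\<sigma>}. R c)"
    using L.finite_roots[OF L.lead_Phi_p0] L.root0' by (intro sum.remove)
  also have "(\<Sum>c\<in>L.roots p\<^sub>0 - {\<sigma>}. R c) = (\<Sum>i = 1..n. R (s i))"
    using sum.reindex_bij_betw[OF bij, of R] by simp
  finally have rho: "6 * L.rho = R \<sigma> + (\<Sum>i = 1..n. R (s i))"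
    by (simp add: L.rho_def R_def sum_distrib_left)
  have curv: "curvature_holomorphic_on (leg \<alpha> \<beta> A B) d (D_ell \<alpha> \<beta> A B) \<longleftrightarrow> L.rho = 0"
    unfolding D d by (rule L.curvature_holomorphic_on_iff)
  have sum_off: "(\<Sum>i = 1..n. (1 - 1 / of_nat (\<nu> i)) * (p\<^sub>0 * b i - a i) *
      (ev (Q_pt A B (a i) (b i) (\<nu> i)) (b i) (a i) /
         (ev B (b i) (a i) * ev (P_pt A B (a i) (b i) (\<nu> i)) (b i) (a i)) +
       3 * of_nat (\<nu> i) * (\<alpha> + p\<^sub>0 * \<beta>) / (\<alpha> * b i + \<beta> * a i))) = (\<Sum>i = 1..n. R (s i))"
    by (rule sum.cong[OF refl off])
  show ?thesis
    unfolding curv line sum_off rho[symmetric] by simp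
qed

end
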